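(* Let $b$ be a positive integer and let $S,T$ be ordered trees. There exists an ordered tree $U$ such that for each coloring with $b$ colors of all rigid surjections from $U$ to $S$ there is a rigid surjection $g_0\colon U\to T$ such that the set \[ \{ f\circ g_0\mid f\colon T\to S \text{ a rigid surjection}\} \] is monochromatic.
   Context: A tree is a finite, non-empty partially ordered set $(T,\sqsubseteq_T)$ with a smallest element (the root) such that the set of predecessors of each element is linearly ordered; each node counts as its own predecessor and successor. For $v,w\in T$, $v\wedge_T w$ is the $\sqsubseteq_T$-largest common predecessor of $v$ and $w$. For $v\in T$, ${\rm im}_T(v)$ is the set of immediate successors of $v$. A tree is ordered if each ${\rm im}(v)$ carries a fixed linear order; this induces the lexicographic linear order $\leq_T$ on $T$: $v\leq_T w$ if $v\sqsubseteq_T w$, and if $v,w$ are $\sqsubseteq_T$-incomparable, $v\leq_T w$ iff the predecessor of $v$ in ${\rm im}(v\wedge_T w)$ is below or equal to the predecessor of $w$ in ${\rm im}(v\wedge_T w)$ in the given order. A morphism $e\colon S\to T$ of ordered trees is a function with $e(v\wedge_S w)=e(v)\wedge_T e(w)$ for all $v,w$, with $v\leq_S w\Rightarrow e(v)\leq_T e(w)$, and mapping the root of $S$ to the root of $T$. A function $f\colon T\to S$ between ordered trees is a rigid surjection if there is a morphism $e\colon S\to T$ with $f\circ e={\rm id}_S$ and $e(f(w))\sqsubseteq_T w$ for all $w\in T$. *)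

theory Defs
  imports "HOL-Library.FuncSet"
begin

record 'a otree =
  nodes :: "'a set"
  tle :: "'a \<Rightarrow> 'a \<Rightarrow> bool"
  sle :: "'a \<Rightarrow> 'a \<Rightarrow> bool"

definition is_tree :: "'a set \<Rightarrow> ('a \<Rightarrow> 'a \<Rightarrow> bool) \<Rightarrow> bool" where
  "is_tree T le \<longleftrightarrow>
     finite T \<and> T \<noteq> {} \<and>
     (\<forall>v\<in>T. le v v) \<and>
     (\<forall>v\<in>T. \<forall>w\<in>T. le v w \<and> le w v \<longrightarrow> v = w) \<and>
     (\<forall>u\<in>T. \<forall>v\<in>T. \<forall>w\<in>T. le u v \<and> le v w \<longrightarrow> le u w) \<and>
     (\<exists>r\<in>T. \<forall>v\<in>T. le r v) \<and>
     (\<forall>v\<in>T. \<forall>u\<in>T. \<forall>w\<in>T. le u v \<and> le w v \<longrightarrow> le u w \<or> le w u)"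

definition im :: "'a otree \<Rightarrow> 'a \<Rightarrow> 'a set" where
  "im T v = {w \<in> nodes T. tle T v w \<and> w \<noteq> v \<and>
              (\<forall>u\<in>nodes T. tle T v u \<and> tle T u w \<longrightarrow> u = v \<or> u = w)}"

definition ordered_tree :: "'a otree \<Rightarrow> bool" where
  "ordered_tree T \<longleftrightarrow> is_tree (nodes T) (tle T) \<and>
     (\<forall>v\<in>nodes T.
        (\<forall>x\<in>im T v. sle T x x) \<and>
        (\<forall>x\<in>im T v. \<forall>y\<in>im T v. sle T x y \<and> sle T y x \<longrightarrow> x = y) \<and>
        (\<forall>x\<in>im T v. \<forall>y\<in>im T v. \<forall>z\<in>im T v. sle T x y \<and> sle T y z \<longrightarrow> sle T x z) \<and>
        (\<forall>x\<in>im T v. \<forall>y\<in>im T v. sle T x y \<or> sle T y x))"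

definition root :: "'a otree \<Rightarrow> 'a" where
  "root T = (THE r. r \<in> nodes T \<and> (\<forall>v\<in>nodes T. tle T r v))"

definition meet :: "'a otree \<Rightarrow> 'a \<Rightarrow> 'a \<Rightarrow> 'a" where
  "meet T v w = (THE u. u \<in> nodes T \<and> tle T u v \<and> tle T u w \<and>
      (\<forall>u'\<in>nodes T. tle T u' v \<and> tle T u' w \<longrightarrow> tle T u' u))"

definition pred_in_im :: "'a otree \<Rightarrow> 'a \<Rightarrow> 'a \<Rightarrow> 'a" where
  "pred_in_im T m v = (THE u. u \<in> im T m \<and> tle T u v)"

definition lexle :: "'a otree \<Rightarrow> 'a \<Rightarrow> 'a \<Rightarrow> bool" where
  "lexle T v w \<longleftrightarrow> tle T v w \<or>
     (\<not> tle T v w \<and> \<not> tle T w v \<and>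
      sle T (pred_in_im T (meet T v w) v) (pred_in_im T (meet T v w) w))"

definition morphism :: "'a otree \<Rightarrow> 'b otree \<Rightarrow> ('a \<Rightarrow> 'b) \<Rightarrow> bool" where
  "morphism S T e \<longleftrightarrow> e \<in> nodes S \<rightarrow> nodes T \<and>
     (\<forall>v\<in>nodes S. \<forall>w\<in>nodes S. e (meet S v w) = meet T (e v) (e w)) \<and>
     (\<forall>v\<in>nodes S. \<forall>w\<in>nodes S. lexle S v w \<longrightarrow> lexle T (e v) (e w)) \<and>
     e (root S) = root T"

text \<open>Rigid surjections T \<rightarrow> S, as functions on the carrier of T
  (extensional, so that distinct elements are distinct maps).\<close>
definition rigid_surj :: "'a otree \<Rightarrow> 'b otree \<Rightarrow> ('a \<Rightarrow> 'b) \<Rightarrow> bool" where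
  "rigid_surj T S f \<longleftrightarrow> f \<in> nodes T \<rightarrow> nodes S \<and>
     (\<exists>e. morphism S T e \<and> (\<forall>s\<in>nodes S. f (e s) = s) \<and>
          (\<forall>w\<in>nodes T. tle T (e (f w)) w))"

definition RS :: "'a otree \<Rightarrow> 'b otree \<Rightarrow> ('a \<Rightarrow> 'b) set" where
  "RS T S = {f \<in> extensional (nodes T). rigid_surj T S f}"

end

theory Submission
  imports Defs
begin

text \<open>
  A rigid surjection is determined by its embedding \<open>e\<close> and a free choice, at every node outside
  the image of \<open>e\<close>, of a value \<open>s\<close> with \<open>e s\<close> below that node. Rigid surjections are therefore
  handled as labellings of forests with labels in \<open>A \<union> F\<close>, where \<open>A\<close> is an alphabet of constants
  always available. Above \<open>e s\<close> the label \<open>s\<close> joins the alphabet, which gives a recursive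
  description (\<open>rigid\<close>) of these labellings.

  The Ramsey statement for labellings over \<open>A \<union> F\<close> is proved by induction on \<open>F\<close>. For empty \<open>F\<close> it
  is a version of the Hales--Jewett theorem on forests. If \<open>s\<close> is the first root of \<open>F\<close>, the
  induction hypotheses first make the colour of a labelling depend only on the node \<open>e s\<close> and on the
  labels of its proper ancestors. The Hales--Jewett theorem for an alphabet of pairs
  (direction, label) then removes the dependence on the labels, and a pigeonhole principle for
  nodes of forests removes the dependence on the node.
\<close>

text \<open>What lies above a node or to the right of it is a forest, and above \<open>e s\<close>
  the value \<open>s\<close> is always admissible; this forces forests and constants into the
  induction. The theorem has no constants, but the root of \<open>U\<close> must carry the root of
  \<open>S\<close>, so above it there is an alphabet with one letter. Every alphabet of the
  induction is non-empty and supplies a default letter. On chains the statement is the dual Ramsey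
  theorem of Graham and Rothschild.

  Since \<open>s\<close> is the first root, the proper ancestors of \<open>e s\<close> carry
  constants only, the part above \<open>e s\<close> is a labelling for the alphabet with
  \<open>s\<close> added, and later trees are labelled over the remaining forest. The induction
  hypotheses thus control everything but the path to \<open>e s\<close>, which is a word over the
  alphabet. Paths to different nodes share initial parts, so their letters cannot be treated node by
  node: a letter has to be coupled with the direction in which the path goes on. Shapes are chosen
  from the target outwards, labellings from the outermost shape inwards.\<close>

text \<open>Forests are in left-child right-sibling form: \<open>Tr x C G\<close> is a tree with root \<open>x\<close> above which
  lies the forest \<open>C\<close>, followed by the forest \<open>G\<close>.\<close>

datatype (labels: 'x) forest = Void | Tr 'x "'x forest" "'x forest"
  for map: fmap

section \<open>Rigid labellings and their composition\<close>

abbreviation shape :: "'x forest \<Rightarrow> unit forest" where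
  "shape \<equiv> fmap (\<lambda>_. ())"

lemma fmap_fmap [simp]: "fmap f (fmap g \<phi>) = fmap (\<lambda>x. f (g x)) \<phi>"
  by (simp add: forest.map_comp comp_def)

lemma finite_labels [simp]: "finite (labels \<phi>)"
  by (induction \<phi>) auto

text \<open>Distinct labels serve as names of nodes: a labelling of the nodes of \<open>G\<close> is
  then a function \<open>f\<close>, and the labelled forest is \<open>fmap f G\<close>.\<close>

fun fdist :: "'x forest \<Rightarrow> bool" where
  "fdist Void \<longleftrightarrow> True"
| "fdist (Tr x C G) \<longleftrightarrow> x \<notin> labels C \<and> x \<notin> labels G \<and> labels C \<inter> labels G = {} \<and>
     fdist C \<and> fdist G"

text \<open>The three cases for a forest with first root labelled \<open>x\<close>: no node of \<open>F\<close> is embedded in the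
  first tree; the first root \<open>s\<close> of \<open>F\<close> is sent to the first root; \<open>s\<close> is sent above it.\<close>

fun rigid :: "'x set \<Rightarrow> 'x forest \<Rightarrow> 'x forest \<Rightarrow> bool" where
  "rigid A Void Void \<longleftrightarrow> True"
| "rigid A Void (Tr s D F) \<longleftrightarrow> False"
| "rigid A (Tr x C G) Void \<longleftrightarrow> x \<in> A \<and> rigid A C Void \<and> rigid A G Void"
| "rigid A (Tr x C G) (Tr s D F) \<longleftrightarrow>
     x \<in> A \<and> rigid A C Void \<and> rigid A G (Tr s D F) \<or>
     x = s \<and> rigid (insert s A) C D \<and> rigid A G F \<or>
     x \<in> A \<and> rigid A C (Tr s D Void) \<and> rigid A G F"

lemma rigid_Void_left [simp]: "rigid A Void F \<longleftrightarrow> F = Void"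
  by (cases F) auto

lemma rigid_Void [simp]: "rigid A \<phi> Void \<longleftrightarrow> labels \<phi> \<subseteq> A"
  by (induction \<phi>) auto

lemma rigid_labels: "rigid A \<phi> F \<Longrightarrow> labels \<phi> \<subseteq> A \<union> labels F"
  by (induction A \<phi> F rule: rigid.induct) auto

lemma rigid_labels_onto: "rigid A \<phi> F \<Longrightarrow> labels F \<subseteq> labels \<phi>"
  by (induction A \<phi> F rule: rigid.induct) auto

lemma rigid_mono: "rigid A \<phi> F \<Longrightarrow> A \<subseteq> B \<Longrightarrow> rigid B \<phi> F"
proof (induction A \<phi> F arbitrary: B rule: rigid.induct)
  case (4 A x C G s D F)
  have "insert s A \<subseteq> insert s B" using 4 by auto
  with 4 show ?case by (auto)
qed auto

lemma rigid_refl: "rigid A \<phi> \<phi>"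
  by (induction \<phi> arbitrary: A) auto

lemma rigid_fmap: "rigid A \<phi> F \<Longrightarrow> rigid (h ` A) (fmap h \<phi>) (fmap h F)"
  by (induction A \<phi> F rule: rigid.induct) auto

text \<open>The embedding of a composite is the composite of the embeddings. The alphabets may
  differ; constants of \<open>g\<close> only have to become constants under \<open>f\<close>. The
  induction follows the embedding of \<open>G\<close>, and in each of its cases the place of the
  first root of \<open>F\<close> relative to the first tree of \<open>G\<close> selects the
  disjunct.\<close>

lemma rigid_comp:
  "rigid B g G \<Longrightarrow> rigid A (fmap f G) F \<Longrightarrow> f ` B \<subseteq> A \<Longrightarrow> rigid A (fmap f g) F"
proof (induction B g G arbitrary: A F rule: rigid.induct)
  case (4 B x C Gs t D G')
  have fx: "f y \<in> A" if "y \<in> B" for y using 4 that by auto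
  consider
      (a) "x \<in> B" "labels C \<subseteq> B" "rigid B Gs (Tr t D G')"
    | (b) "x = t" "rigid (insert t B) C D" "rigid B Gs G'"
    | (c) "x \<in> B" "rigid B C (Tr t D Void)" "rigid B Gs G'"
    using 4(7) by auto
  then show ?case
  proof cases
    case a
    have "rigid A (fmap f Gs) F" using 4(2) a 4 by auto
    then show ?thesis using a fx by (cases F) (auto simp: forest.set_map)
  next
    case b
    have lC: "labels C \<subseteq> insert t B \<union> labels D" using rigid_labels[OF b(2)] .
    have GG: "rigid A (fmap f Gs) F'" if "rigid A (fmap f G') F'" for F'
      using 4(4) b 4(9) that by auto
    show ?thesis
    proof (cases F)
      case Void
      have "f t \<in> A" "f ` labels D \<subseteq> A" "rigid A (fmap f G') Void"
        using 4(8) Void by (auto simp: forest.set_map)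
      moreover from this have "f y \<in> A" if "y \<in> labels C" for y
        using that lC fx by blast
      ultimately show ?thesis using GG[of Void] b fx Void by (auto simp: forest.set_map)
    next
      case (Tr s DF F')
      consider
          (1) "f t \<in> A" "labels (fmap f D) \<subseteq> A" "rigid A (fmap f G') F"
        | (2) "f t = s" "rigid (insert s A) (fmap f D) DF" "rigid A (fmap f G') F'"
        | (3) "f t \<in> A" "rigid A (fmap f D) (Tr s DF Void)" "rigid A (fmap f G') F'"
        using 4(8) Tr by auto
      then show ?thesis
      proof cases
        case 1
        then have "f y \<in> A" if "y \<in> labels C" for y
          using that lC fx by (auto simp: forest.set_map)
        then have "labels (fmap f C) \<subseteq> A" by (auto simp: forest.set_map)
        then show ?thesis using 1 GG b Tr by auto
      next
        case 2
        \<comment> \<open>Above its node \<open>t\<close> is a constant for \<open>g\<close>; it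
          becomes \<open>s\<close>, which is the constant gained on the side of the target.\<close>
        have "rigid (insert s A) (fmap f C) DF"
          using 4(3)[OF b(2) 2(2)] 4(9) 2 by auto
        then show ?thesis using 2 GG b Tr by auto
      next
        case 3
        have "rigid A (fmap f C) (Tr s DF Void)"
          using 4(3)[OF b(2) 3(2)] 4(9) 3 by auto
        then show ?thesis using 3 GG b Tr by auto
      qed
    qed
  next
    case c
    have lC: "labels C \<subseteq> B \<union> insert t (labels D)" using rigid_labels[OF c(2)] by simp
    have GG: "rigid A (fmap f Gs) F'" if "rigid A (fmap f G') F'" for F'
      using 4(4) c 4(9) that by auto
    have CC: "rigid A (fmap f C) F'" if "rigid A (fmap f (Tr t D Void)) F'" for F'
      using 4(5)[OF c(2) that] 4(9) by auto
    show ?thesis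
    proof (cases F)
      case Void
      have "f t \<in> A" "f ` labels D \<subseteq> A" "rigid A (fmap f G') Void"
        using 4(8) Void by (auto simp: forest.set_map)
      moreover from this have "f y \<in> A" if "y \<in> labels C" for y
        using that lC fx by blast
      ultimately show ?thesis using GG[of Void] c fx Void by (auto simp: forest.set_map)
    next
      case (Tr s DF F')
      consider
          (1) "f t \<in> A" "labels (fmap f D) \<subseteq> A" "rigid A (fmap f G') F"
        | (2) "f t = s" "rigid (insert s A) (fmap f D) DF" "rigid A (fmap f G') F'"
        | (3) "f t \<in> A" "rigid A (fmap f D) (Tr s DF Void)" "rigid A (fmap f G') F'"
        using 4(8) Tr by auto
      then show ?thesis
      proof cases
        case 1
        then have "f y \<in> A" if "y \<in> labels C" for y
          using that lC fx by (auto simp: forest.set_map)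
        then have "labels (fmap f C) \<subseteq> A" by (auto simp: forest.set_map)
        then show ?thesis using 1 GG c Tr fx by auto
      next
        case 2
        then show ?thesis using CC[of "Tr s DF Void"] GG c Tr fx by auto
      next
        case 3
        then show ?thesis using CC[of "Tr s DF Void"] GG c Tr fx by auto
      qed
    qed
  qed
qed (auto simp: forest.set_map)

subsection \<open>Concatenation\<close>

fun app :: "'x forest \<Rightarrow> 'x forest \<Rightarrow> 'x forest" where
  "app Void Y = Y"
| "app (Tr x C G) Y = Tr x C (app G Y)"

lemma fmap_app [simp]: "fmap f (app X Y) = app (fmap f X) (fmap f Y)"
  by (induction X) auto

lemma labels_app [simp]: "labels (app X Y) = labels X \<union> labels Y"
  by (induction X) auto

lemma app_Void [simp]: "app X Void = X"
  by (induction X) auto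

lemma app_assoc: "app (app X Y) Z = app X (app Y Z)"
  by (induction X) auto

lemma rigid_app: "rigid A X F \<Longrightarrow> rigid A Y F' \<Longrightarrow> rigid A (app X Y) (app F F')"
proof (induction A X F rule: rigid.induct)
  case (3 A x C G)
  then show ?case by (cases F') auto
qed auto

lemma rigid_app_skip: "labels X \<subseteq> A \<Longrightarrow> rigid A Y F \<Longrightarrow> rigid A (app X Y) F"
  using rigid_app[of A X Void Y F] by simp

lemma rigid_app_skip2: "rigid A X F \<Longrightarrow> labels Y \<subseteq> A \<Longrightarrow> rigid A (app X Y) F"
  using rigid_app[of A X F Y Void] by simp

lemma fdist_app: "fdist (app X Y) \<longleftrightarrow> fdist X \<and> fdist Y \<and> labels X \<inter> labels Y = {}"
  by (induction X) auto

subsection \<open>Traces\<close>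

text \<open>The route to the first occurrence of \<open>s\<close>: \<open>None\<close> is a step to the next sibling, \<open>Some x\<close> a
  step from a node labelled \<open>x\<close> to its first child.\<close>

fun tr :: "'x \<Rightarrow> 'x forest \<Rightarrow> 'x option list" where
  "tr s Void = []"
| "tr s (Tr x C G) = (if x = s then [] else if s \<in> labels C then Some x # tr s C
     else None # tr s G)"

fun nroots :: "'x forest \<Rightarrow> nat" where
  "nroots Void = 0"
| "nroots (Tr x C G) = Suc (nroots G)"

lemma nroots_fmap [simp]: "nroots (fmap f X) = nroots X"
  by (induction X) auto

lemma tr_app_left: "s \<in> labels X \<Longrightarrow> tr s (app X Y) = tr s X"
  by (induction X) auto

lemma tr_app_right: "s \<notin> labels X \<Longrightarrow> tr s (app X Y) = replicate (nroots X) None @ tr s Y"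
  by (induction X) auto

lemma tr_fmap:
  "\<forall>x\<in>labels g. f x = f t \<longrightarrow> x = t \<Longrightarrow> tr (f t) (fmap f g) = map (map_option f) (tr t g)"
  by (induction g) (auto simp: forest.set_map image_iff)

text \<open>A label \<open>y\<close> outside \<open>A\<close> on a proper ancestor \<open>w\<close>
  of \<open>e s\<close> would put \<open>e y\<close> at or below \<open>w\<close>, so that
  \<open>y\<close> would be a proper predecessor of the root \<open>s\<close>.\<close>

lemma tr_rigid_subset:
  "rigid A \<phi> (Tr s D F) \<Longrightarrow> s \<notin> A \<Longrightarrow> Some x \<in> set (tr s \<phi>) \<Longrightarrow> x \<in> A"
proof (induction \<phi> arbitrary: D F)
  case (Tr y C G)
  show ?case
  proof (cases "y = s \<or> s \<in> labels C")
    case True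
    then show ?thesis using Tr by (auto split: if_splits)
  next
    case False
    then show ?thesis using Tr(2,3,4,5) rigid_labels_onto[of A C "Tr s D Void"] by auto
  qed
qed auto

text \<open>As \<open>s\<close> is not a constant, all its occurrences lie above the image of
  \<open>s\<close>, and the first one is that image. The composite embeds \<open>s\<close> where
  \<open>g\<close> embeds the node \<open>v\<close> to which \<open>f\<close> embeds
  \<open>s\<close>, so the route to \<open>s\<close> is the route to \<open>v\<close> with its
  labels translated.\<close>

lemma tr_comp:
  "rigid B g G \<Longrightarrow> rigid A (fmap f G) (Tr s D F) \<Longrightarrow> f ` B \<subseteq> A \<Longrightarrow> s \<notin> A \<Longrightarrow>
   \<exists>v\<in>labels G. f v = s \<and> tr s (fmap f g) = map (map_option f) (tr v g)"
proof (induction B g G arbitrary: A D F rule: rigid.induct)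
  case (4 B x C Gs t D' G')
  have fx: "f y \<in> A" if "y \<in> B" for y using 4 that by auto
  consider
      (a) "x \<in> B" "labels C \<subseteq> B" "rigid B Gs (Tr t D' G')"
    | (b) "x = t" "rigid (insert t B) C D'" "rigid B Gs G'"
    | (c) "x \<in> B" "rigid B C (Tr t D' Void)" "rigid B Gs G'"
    using 4(7) by auto
  then show ?case
  proof cases
    case a
    obtain v where v: "v \<in> labels (Tr t D' G')" "f v = s"
      "tr s (fmap f Gs) = map (map_option f) (tr v Gs)"
      using 4(2)[OF a(3) 4(8-10)] by blast
    have "f x \<noteq> s" "s \<notin> f ` labels C"
      using a fx 4(10) by blast+
    moreover from this have "x \<noteq> v" "v \<notin> labels C" using v by auto
    ultimately show ?thesis using v by (intro bexI[of _ v]) (auto simp: forest.set_map)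
  next
    case b
    consider
        (1) "f t \<in> A" "labels (fmap f D') \<subseteq> A" "rigid A (fmap f G') (Tr s D F)"
      | (2) "f t = s"
      | (3) "f t \<in> A" "rigid A (fmap f D') (Tr s D Void)"
      using 4(8) by auto
    then show ?thesis
    proof cases
      case 1
      obtain v where v: "v \<in> labels G'" "f v = s"
        "tr s (fmap f Gs) = map (map_option f) (tr v Gs)"
        using 4(4)[OF b(3) 1(3) 4(9-10)] by blast
      have "f y \<in> A" if "y \<in> labels C" for y
        using rigid_labels[OF b(2)] that 1 fx by (auto simp: forest.set_map)
      then have "f x \<noteq> s" "s \<notin> f ` labels C"
        using b fx 4(10) 1 by blast+
      moreover from this have "x \<noteq> v" "v \<notin> labels C" using v by auto
      ultimately show ?thesis using v by (intro bexI[of _ v]) (auto simp: forest.set_map)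
    next
      case 2
      then show ?thesis using b by auto
    next
      case 3
      have "f ` insert t B \<subseteq> A" using 3 4 by auto
      from 4(3)[OF b(2) 3(2) this 4(10)]
      obtain v where v: "v \<in> labels D'" "f v = s"
        "tr s (fmap f C) = map (map_option f) (tr v C)"
        by blast
      have "v \<in> labels C" using rigid_labels_onto[OF b(2)] v by auto
      moreover have "f x \<noteq> s" "x \<noteq> v" using b 3 4(10) v by auto
      ultimately show ?thesis using v by (intro bexI[of _ v]) (auto simp: forest.set_map)
    qed
  next
    case c
    consider
        (1) "f t \<in> A" "labels (fmap f D') \<subseteq> A" "rigid A (fmap f G') (Tr s D F)"
      | (2) "rigid A (fmap f (Tr t D' Void)) (Tr s D Void)"
      using 4(8) by auto
    then show ?thesis
    proof cases
      case 1
      obtain v where v: "v \<in> labels G'" "f v = s"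
        "tr s (fmap f Gs) = map (map_option f) (tr v Gs)"
        using 4(4)[OF c(3) 1(3) 4(9-10)] by blast
      have "f y \<in> A" if "y \<in> labels C" for y
        using rigid_labels[OF c(2)] that 1 fx by (auto simp: forest.set_map)
      then have "f x \<noteq> s" "s \<notin> f ` labels C"
        using c fx 4(10) 1 by blast+
      moreover from this have "x \<noteq> v" "v \<notin> labels C" using v by auto
      ultimately show ?thesis using v by (intro bexI[of _ v]) (auto simp: forest.set_map)
    next
      case 2
      from 4(5)[OF c(2) 2 4(9-10)]
      obtain v where v: "v \<in> labels (Tr t D' Void)" "f v = s"
        "tr s (fmap f C) = map (map_option f) (tr v C)"
        by blast
      have "v \<in> labels C" using rigid_labels_onto[OF c(2)] v by auto
      moreover have "f x \<noteq> s" using fx[OF c(1)] 4(10) by auto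
      moreover from this have "x \<noteq> v" using v by auto
      ultimately show ?thesis using v by (intro bexI[of _ v]) (auto simp: forest.set_map)
    qed
  qed
qed (auto simp: forest.set_map)

subsection \<open>Relabelling\<close>

lemma relabel_exists:
  "fdist G \<Longrightarrow> shape \<phi> = shape G \<Longrightarrow> \<exists>h. fmap h G = \<phi>"
proof (induction G arbitrary: \<phi>)
  case (Tr x C G)
  then obtain y C' G' where p: "\<phi> = Tr y C' G'" "shape C' = shape C" "shape G' = shape G"
    by (cases \<phi>) auto
  obtain h1 h2 where h: "fmap h1 C = C'" "fmap h2 G = G'"
    using Tr p by fastforce
  let ?h = "\<lambda>z. if z = x then y else if z \<in> labels C then h1 z else h2 z"
  have "fmap ?h C = C'" unfolding h(1)[symmetric]
    using Tr by (intro forest.map_cong0) auto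
  moreover have "fmap ?h G = G'" unfolding h(2)[symmetric]
    using Tr by (intro forest.map_cong0) auto
  ultimately show ?case using p by (intro exI[of _ ?h]) auto
next
  case Void
  then show ?case by (cases \<phi>) auto
qed

abbreviation fixing :: "'x set \<Rightarrow> ('x \<Rightarrow> 'x) \<Rightarrow> bool" where
  "fixing A f \<equiv> \<forall>a\<in>A. f a = a"

text \<open>Reads a labelled forest of the shape of \<open>G\<close> back as a function on the
  labels of \<open>G\<close>, so that it can be substituted into labellings over \<open>G\<close>;
  constants stay fixed.\<close>

definition relab :: "'x set \<Rightarrow> 'x forest \<Rightarrow> 'x forest \<Rightarrow> 'x \<Rightarrow> 'x" where
  "relab A G \<phi> = (SOME h. fmap h G = \<phi> \<and> fixing A h)"

lemma relab:
  assumes "fdist G" "labels G \<inter> A = {}" "shape \<phi> = shape G"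
  shows "fmap (relab A G \<phi>) G = \<phi>" "fixing A (relab A G \<phi>)"
proof -
  obtain h where h: "fmap h G = \<phi>" using relabel_exists assms by blast
  let ?h = "\<lambda>x. if x \<in> A then x else h x"
  have "fmap ?h G = \<phi>" unfolding h[symmetric] using assms(2)
    by (intro forest.map_cong0) auto
  then have "\<exists>h. fmap h G = \<phi> \<and> fixing A h" by (intro exI[of _ ?h]) auto
  from someI_ex[OF this] show "fmap (relab A G \<phi>) G = \<phi>" "fixing A (relab A G \<phi>)"
    unfolding relab_def by auto
qed

lemma fmap_eqD: "fmap f G = fmap h G \<Longrightarrow> x \<in> labels G \<Longrightarrow> f x = h x"
  by (induction G) auto

text \<open>This transports colourings: a colouring \<open>c\<close> of labellings of the shape of
  \<open>g\<close> induces the colouring of labellings \<open>\<phi>\<close> of \<open>G\<close> by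
  \<open>c (fmap (relab A G \<phi>) g)\<close>, whose value at \<open>fmap f G\<close> is
  \<open>c (fmap f g)\<close>.\<close>

lemma fmap_relab:
  assumes "fdist G" "labels G \<inter> A = {}" "fixing A f" "labels g \<subseteq> A \<union> labels G"
  shows "fmap (relab A G (fmap f G)) g = fmap f g"
proof (rule forest.map_cong0)
  note r = relab[of G A "fmap f G"]
  have r': "fmap (relab A G (fmap f G)) G = fmap f G" "fixing A (relab A G (fmap f G))"
    using r assms by auto
  fix x assume "x \<in> labels g"
  then show "relab A G (fmap f G) x = f x"
    using fmap_eqD[OF r'(1)] r'(2) assms by auto
qed

lemma labelled_exists:
  fixes H :: "unit forest" and A :: "nat set"
  shows "finite A \<Longrightarrow> \<exists>G. shape G = H \<and> fdist G \<and> labels G \<inter> A = {}"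
proof (induction H arbitrary: A)
  case Void
  then show ?case by (intro exI[of _ Void]) auto
next
  case (Tr u C G)
  obtain x where x: "x \<notin> A" using ex_new_if_finite[OF infinite_UNIV_nat Tr(3)] by blast
  obtain C' where C': "shape C' = C" "fdist C'" "labels C' \<inter> insert x A = {}"
    using Tr(1)[of "insert x A"] Tr(3) by auto
  obtain G' where G': "shape G' = G" "fdist G'" "labels G' \<inter> (insert x A \<union> labels C') = {}"
    using Tr(2)[of "insert x A \<union> labels C'"] Tr(3) by auto
  show ?case using x C' G' by (intro exI[of _ "Tr x C' G'"]) auto
qed

text \<open>Finitely many colourings are made homogeneous together by colouring with the vector of
  their values. Numbering the vectors keeps the colours an initial segment of the naturals.\<close>

lemma vector_colouring:
  fixes b :: nat and I :: "'i set"
  assumes "finite I"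
  obtains enc :: "('i \<Rightarrow> nat) \<Rightarrow> nat" where
    "\<And>v. (\<forall>i\<in>I. v i < b) \<Longrightarrow> enc v < b ^ card I"
    "\<And>v v'. (\<forall>i\<in>I. v i < b) \<Longrightarrow> (\<forall>i\<in>I. v' i < b) \<Longrightarrow> enc v = enc v' \<Longrightarrow> \<forall>i\<in>I. v i = v' i"
proof -
  let ?P = "PiE I (\<lambda>_. {..<b})"
  have fin: "finite ?P" using assms by (intro finite_PiE) auto
  have card: "card ?P = b ^ card I" using assms by (simp add: card_PiE)
  obtain h where h: "bij_betw h ?P {0..<b ^ card I}"
    using ex_bij_betw_finite_nat[OF fin] card by auto
  have P: "restrict v I \<in> ?P" if "\<forall>i\<in>I. v i < b" for v using that by auto
  show ?thesis
  proof (rule that[of "\<lambda>v. h (restrict v I)"])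
    fix v assume "\<forall>i\<in>I. v i < b"
    then show "h (restrict v I) < b ^ card I" using P bij_betwE[OF h] by fastforce
  next
    fix v v' assume *: "\<forall>i\<in>I. v i < b" "\<forall>i\<in>I. v' i < b" "h (restrict v I) = h (restrict v' I)"
    then have "restrict v I = restrict v' I"
      using P bij_betw_imp_inj_on[OF h] by (meson inj_onD)
    then show "\<forall>i\<in>I. v i = v' i" by (metis restrict_apply')
  qed
qed

subsection \<open>The Hales--Jewett theorem\<close>

definition subst :: "'a \<Rightarrow> 'a option list \<Rightarrow> 'a list" where
  "subst a l = map (\<lambda>x. case x of None \<Rightarrow> a | Some y \<Rightarrow> y) l"

definition line :: "'a set \<Rightarrow> nat \<Rightarrow> 'a option list \<Rightarrow> bool" where
  "line A N l \<longleftrightarrow> length l = N \<and> None \<in> set l \<and> set l \<subseteq> insert None (Some ` A)"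

definition hj :: "'a set \<Rightarrow> nat \<Rightarrow> nat \<Rightarrow> bool" where
  "hj A b N \<longleftrightarrow> (\<forall>c :: 'a list \<Rightarrow> nat. (\<forall>w. c w < b) \<longrightarrow>
     (\<exists>l. line A N l \<and> (\<forall>a\<in>A. \<forall>a'\<in>A. c (subst a l) = c (subst a' l))))"

lemma subst_append [simp]: "subst a (l @ l') = subst a l @ subst a l'"
  by (simp add: subst_def)

lemma subst_map_Some [simp]: "subst a (map Some w) = w"
  by (simp add: subst_def comp_def)

lemma set_subst: "set l \<subseteq> insert None (Some ` A) \<Longrightarrow> a \<in> A \<Longrightarrow> set (subst a l) \<subseteq> A"
  by (auto simp: subst_def split: option.splits)

lemma length_subst [simp]: "length (subst a l) = length l"
  by (simp add: subst_def)

lemma hj_vec: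
  assumes "hj A (b ^ card I) N" "finite I" "\<And>i w. i \<in> I \<Longrightarrow> c i w < b"
  shows "\<exists>l. line A N l \<and> (\<forall>i\<in>I. \<forall>a\<in>A. \<forall>a'\<in>A. c i (subst a l) = c i (subst a' l))"
proof -
  obtain enc :: "('b \<Rightarrow> nat) \<Rightarrow> nat" where e:
    "\<And>v. (\<forall>i\<in>I. v i < b) \<Longrightarrow> enc v < b ^ card I"
    "\<And>v v'. (\<forall>i\<in>I. v i < b) \<Longrightarrow> (\<forall>i\<in>I. v' i < b) \<Longrightarrow> enc v = enc v' \<Longrightarrow> \<forall>i\<in>I. v i = v' i"
    by (rule vector_colouring[OF assms(2), where b = b]) blast
  have "\<forall>w. enc (\<lambda>i. c i w) < b ^ card I" using e(1) assms(3) by auto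
  then obtain l where l: "line A N l"
    "\<forall>a\<in>A. \<forall>a'\<in>A. enc (\<lambda>i. c i (subst a l)) = enc (\<lambda>i. c i (subst a' l))"
    using assms(1)[unfolded hj_def, rule_format, of "\<lambda>w. enc (\<lambda>i. c i w)"] by blast
  have "c i (subst a l) = c i (subst a' l)" if "i \<in> I" "a \<in> A" "a' \<in> A" for i a a'
  proof -
    have "enc (\<lambda>i. c i (subst a l)) = enc (\<lambda>i. c i (subst a' l))" using l(2) that by blast
    from e(2)[OF _ _ this] show ?thesis using that assms(3) by blast
  qed
  then show ?thesis using l(1) by blast
qed

text \<open>The induction on the alphabet is by colour focusing: lines in the large alphabet \<open>B\<close>
  sharing their value at the new letter \<open>z\<close>, but of pairwise different colours on \<open>A\<close>,
  are accumulated until the colours are exhausted.\<close>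

definition monochromatic_line :: "'a set \<Rightarrow> nat \<Rightarrow> ('a list \<Rightarrow> nat) \<Rightarrow> bool" where
  "monochromatic_line B N c \<longleftrightarrow> (\<exists>l x. line B N l \<and> (\<forall>a\<in>B. c (subst a l) = x))"

definition focused :: "'a set \<Rightarrow> 'a \<Rightarrow> nat \<Rightarrow> ('a list \<Rightarrow> nat) \<Rightarrow> nat set \<Rightarrow> 'a list \<Rightarrow> bool" where
  "focused A z N c X p \<longleftrightarrow> length p = N \<and> set p \<subseteq> insert z A \<and>
     (\<forall>x\<in>X. \<exists>l. line (insert z A) N l \<and> subst z l = p \<and> (\<forall>a\<in>A. c (subst a l) = x))"

lemma hj_focus:
  fixes A :: "'a set"
  assumes IH: "\<And>b. \<exists>N. hj A b N" and A: "finite A" "A \<noteq> {}"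
  shows "\<exists>N. \<forall>c. (\<forall>w. c w < b) \<longrightarrow> monochromatic_line (insert z A) N c \<or>
     (\<exists>X p. finite X \<and> card X = k \<and> focused A z N c X p)"
proof (induction k)
  case 0
  show ?case
    by (intro exI[of _ 0] allI impI disjI2 exI[of _ "{}"] exI[of _ "[]"]) (auto simp: focused_def)
next
  case (Suc k)
  let ?B = "insert z A"
  obtain N where N: "\<forall>c. (\<forall>w. c w < b) \<longrightarrow> monochromatic_line ?B N c \<or>
     (\<exists>X p. finite X \<and> card X = k \<and> focused A z N c X p)"
    using Suc by blast
  let ?I = "{w. set w \<subseteq> ?B \<and> length w = N}"
  have finI: "finite ?I" using finite_lists_length_eq[of ?B N] A by simp
  \<comment> \<open>The second block has to behave alike behind every word of the first block, so
    its colours are vectors indexed by these words.\<close>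
  obtain M where M: "hj A (b ^ card ?I) M" using IH by blast
  show ?case
  proof (intro exI[of _ "N + M"] allI impI)
    fix c :: "'a list \<Rightarrow> nat" assume c: "\<forall>w. c w < b"
    obtain L where L: "line A M L"
      "\<forall>w\<in>?I. \<forall>a\<in>A. \<forall>a'\<in>A. c (w @ subst a L) = c (w @ subst a' L)"
      using hj_vec[OF M finI, of "\<lambda>w v. c (w @ v)"] c by blast
    obtain a0 where a0: "a0 \<in> A" using A by blast
    let ?u = "subst a0 L"
    have u: "set ?u \<subseteq> ?B" "length ?u = M" using set_subst[of L A a0] L a0
      by (auto simp: line_def)
    have mono: "monochromatic_line ?B (N + M) c"
      if "line ?B N l" "\<forall>a\<in>?B. c (subst a l @ ?u) = x" for l x
    proof -
      have "line ?B (N + M) (l @ map Some ?u)" using that(1) u by (auto simp: line_def)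
      then show ?thesis using that(2) unfolding monochromatic_line_def
        by (intro exI[of _ "l @ map Some ?u"] exI[of _ x]) simp
    qed
    have lineL: "line ?B (N + M) (l @ L)" if "length l = N" "set l \<subseteq> insert None (Some ` ?B)" for l
      using that L by (auto simp: line_def)
    have wI: "subst a l \<in> ?I" if "line ?B N l" "a \<in> ?B" for a l
      using that set_subst[of l ?B a] by (auto simp: line_def)
    have "monochromatic_line ?B N (\<lambda>w. c (w @ ?u)) \<or>
      (\<exists>X p. finite X \<and> card X = k \<and> focused A z N (\<lambda>w. c (w @ ?u)) X p)"
      using N[THEN spec, of "\<lambda>w. c (w @ ?u)", THEN mp] c by simp
    then show "monochromatic_line ?B (N + M) c \<or>
      (\<exists>X p. finite X \<and> card X = Suc k \<and> focused A z (N + M) c X p)"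
    proof (elim disjE exE conjE)
      assume "monochromatic_line ?B N (\<lambda>w. c (w @ ?u))"
      then show ?thesis using mono unfolding monochromatic_line_def[of _ N] by blast
    next
      fix X p assume X: "finite X" "card X = k" and foc: "focused A z N (\<lambda>w. c (w @ ?u)) X p"
      have lines: "\<forall>x\<in>X. \<exists>l. line ?B N l \<and> subst z l = p \<and> (\<forall>a\<in>A. c (subst a l @ ?u) = x)"
        using foc[unfolded focused_def, THEN conjunct2, THEN conjunct2] .
      let ?y = "c (p @ ?u)"
      show ?thesis
      proof (cases "?y \<in> X")
        case True
        then obtain l where l: "line ?B N l" "subst z l = p" "\<forall>a\<in>A. c (subst a l @ ?u) = ?y"
          using bspec[OF lines True] by auto
        then have "\<forall>a\<in>?B. c (subst a l @ ?u) = ?y" by simp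
        then show ?thesis using mono l(1) by blast
      next
        case False
        have pI: "p \<in> ?I" using foc by (auto simp: focused_def)
        \<comment> \<open>Appending \<open>L\<close> keeps the colour of an old line on
          \<open>A\<close> and moves its focus to \<open>p @ subst z L\<close>. The word
          \<open>p\<close> without wildcards, followed by \<open>L\<close>, is a line with the same
          focus, and it brings in the new colour.\<close>
        have "\<exists>l. line ?B (N + M) l \<and> subst z l = p @ subst z L \<and> (\<forall>a\<in>A. c (subst a l) = x)"
          if xX: "x \<in> insert ?y X" for x
        proof (cases "x = ?y")
          case True
          have "c (p @ subst a L) = ?y" if "a \<in> A" for a using L(2) pI that a0 by blast
          moreover have "line ?B (N + M) (map Some p @ L)" using pI by (intro lineL) auto
          ultimately show ?thesis unfolding True
            by (intro exI[of _ "map Some p @ L"]) simp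
        next
          case False
          then obtain l where l: "line ?B N l" "subst z l = p" "\<forall>a\<in>A. c (subst a l @ ?u) = x"
            using bspec[OF lines, of x] xX by auto
          have "c (subst a l @ subst a L) = x" if "a \<in> A" for a
          proof -
            have "c (subst a l @ subst a L) = c (subst a l @ ?u)"
              using L(2) wI[OF l(1), of a] that a0 by blast
            then show ?thesis using l(3) that by simp
          qed
          moreover have "line ?B (N + M) (l @ L)" using l(1) by (intro lineL) (auto simp: line_def)
          ultimately show ?thesis using l(2) by (intro exI[of _ "l @ L"]) simp
        qed
        moreover have "set (p @ subst z L) \<subseteq> ?B" "length (p @ subst z L) = N + M"
        proof -
          have "set L \<subseteq> insert None (Some ` ?B)" using L(1) by (auto simp: line_def)
          from set_subst[OF this, of z] show "set (p @ subst z L) \<subseteq> ?B" using pI by auto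
          show "length (p @ subst z L) = N + M" using pI L(1) by (simp add: line_def)
        qed
        ultimately have "focused A z (N + M) c (insert ?y X) (p @ subst z L)"
          unfolding focused_def by blast
        moreover have "card (insert ?y X) = Suc k" using X False by simp
        ultimately show ?thesis using X(1) by blast
      qed
    qed
  qed
qed

theorem hales_jewett: "finite A \<Longrightarrow> \<exists>N. hj A b N"
proof (induction A arbitrary: b rule: finite_induct)
  case empty
  have "hj {} b 1" unfolding hj_def line_def by (intro allI impI exI[of _ "[None]"]) auto
  then show ?case by blast
next
  case (insert z A)
  show ?case
  proof (cases "A = {}")
    case True
    have "hj {z} b 1" unfolding hj_def line_def by (intro allI impI exI[of _ "[None]"]) auto
    then show ?thesis using True by blast
  next
    case False
    \<comment> \<open>A family with \<open>Suc b\<close> different colours below \<open>b\<close>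
      cannot exist, so only the monochromatic line remains.\<close>
    obtain N where N: "\<forall>c. (\<forall>w. c w < b) \<longrightarrow> monochromatic_line (insert z A) N c \<or>
      (\<exists>X p. finite X \<and> card X = Suc b \<and> focused A z N c X p)"
      using hj_focus[OF insert.IH insert.hyps(1) False] by blast
    have "hj (insert z A) b N" unfolding hj_def
    proof (intro allI impI)
      fix c :: "'a list \<Rightarrow> nat" assume c: "\<forall>w. c w < b"
      have False if X: "finite X" "card X = Suc b" "focused A z N c X p" for X p
      proof -
        obtain a where a: "a \<in> A" using \<open>A \<noteq> {}\<close> by auto
        have lines: "\<forall>x\<in>X. \<exists>l. line (insert z A) N l \<and> subst z l = p \<and> (\<forall>a\<in>A. c (subst a l) = x)"
          using X(3)[unfolded focused_def, THEN conjunct2, THEN conjunct2] .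
        have "x < b" if xX: "x \<in> X" for x
        proof -
          obtain l where "\<forall>a\<in>A. c (subst a l) = x"
            using bspec[OF lines xX] by auto
          then have "c (subst a l) = x" using a by simp
          then show ?thesis using c by auto
        qed
        then have "X \<subseteq> {..<b}" by auto
        then have "card X \<le> b" using card_mono[of "{..<b}" X] by simp
        then show False using X by simp
      qed
      then have "monochromatic_line (insert z A) N c" using N c by blast
      then obtain l x where "line (insert z A) N l" "\<forall>a\<in>insert z A. c (subst a l) = x"
        unfolding monochromatic_line_def by blast
      then show "\<exists>l. line (insert z A) N l \<and>
        (\<forall>a\<in>insert z A. \<forall>a'\<in>insert z A. c (subst a l) = c (subst a' l))"
        by (intro exI[of _ l]) simp
    qed
    then show ?thesis by blast
  qed
qed

section \<open>Ramsey statements for labelled forests\<close>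

definition homog :: "nat set \<Rightarrow> nat forest \<Rightarrow> (nat forest \<Rightarrow> nat forest \<Rightarrow> bool) \<Rightarrow>
    (nat forest \<Rightarrow> nat) \<Rightarrow> nat forest \<Rightarrow> bool" where
  "homog A G E c g \<longleftrightarrow> (\<forall>f f'. fixing A f \<longrightarrow> fixing A f' \<longrightarrow> E (fmap f G) (fmap f' G) \<longrightarrow>
     c (fmap f g) = c (fmap f' g))"

text \<open>The relation \<open>E\<close> lists the pairs of labellings that must receive the same
  colour. Full homogeneity, dependence on the trace alone, and the combination of two demands by a
  disjunction are then instances of one notion. The shape \<open>H\<close> is fixed before the
  colouring is given.\<close>

definition good :: "nat set \<Rightarrow> nat \<Rightarrow> unit forest \<Rightarrow> nat forest \<Rightarrow>
    (nat forest \<Rightarrow> nat forest \<Rightarrow> bool) \<Rightarrow> bool" where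
  "good A b H G E \<longleftrightarrow> (\<forall>c. (\<forall>\<phi>. c \<phi> < b) \<longrightarrow>
     (\<exists>g. shape g = H \<and> rigid A g G \<and> homog A G E c g))"

definition ramsey :: "nat set \<Rightarrow> (nat forest \<Rightarrow> nat forest \<Rightarrow> bool) \<Rightarrow> bool" where
  "ramsey A E \<longleftrightarrow> (\<forall>b G. fdist G \<longrightarrow> labels G \<inter> A = {} \<longrightarrow> (\<exists>H. good A b H G E))"

lemma homogD:
  "homog A G E c g \<Longrightarrow> fixing A f \<Longrightarrow> fixing A f' \<Longrightarrow> E (fmap f G) (fmap f' G) \<Longrightarrow>
   c (fmap f g) = c (fmap f' g)"
  unfolding homog_def by (elim allE impE) assumption+

lemma goodD:
  assumes "good A b H G E" "\<And>\<phi>. c \<phi> < b"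
  obtains g where "shape g = H" "rigid A g G" "homog A G E c g"
proof -
  have "\<exists>g. shape g = H \<and> rigid A g G \<and> homog A G E c g"
    using assms(1)[unfolded good_def, THEN spec, of c] assms(2) by simp
  then show ?thesis using that by (elim exE conjE)
qed

lemma good_vec:
  assumes "good A (b ^ card I) H G E" "finite I" "\<And>i \<phi>. i \<in> I \<Longrightarrow> c i \<phi> < b"
  obtains g where "shape g = H" "rigid A g G" "\<And>i. i \<in> I \<Longrightarrow> homog A G E (c i) g"
proof -
  obtain enc :: "('a \<Rightarrow> nat) \<Rightarrow> nat" where e:
    "\<And>v. (\<forall>i\<in>I. v i < b) \<Longrightarrow> enc v < b ^ card I"
    "\<And>v v'. (\<forall>i\<in>I. v i < b) \<Longrightarrow> (\<forall>i\<in>I. v' i < b) \<Longrightarrow> enc v = enc v' \<Longrightarrow> \<forall>i\<in>I. v i = v' i"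
    by (rule vector_colouring[OF assms(2), where b = b]) blast
  have "enc (\<lambda>i. c i \<phi>) < b ^ card I" for \<phi> using e(1) assms(3) by auto
  from goodD[OF assms(1) this] obtain g where g: "shape g = H" "rigid A g G"
    "homog A G E (\<lambda>\<phi>. enc (\<lambda>i. c i \<phi>)) g" .
  have "homog A G E (c i) g" if "i \<in> I" for i
    unfolding homog_def
  proof (intro allI impI)
    fix f f' :: "nat \<Rightarrow> nat"
    assume "fixing A f" "fixing A f'" "E (fmap f G) (fmap f' G)"
    from e(2)[OF _ _ homogD[OF g(3) this]] show "c i (fmap f g) = c i (fmap f' g)"
      using that assms(3) by blast
  qed
  then show ?thesis using that g by blast
qed

text \<open>An outer labelling, homogeneous for \<open>E1\<close>, is taken over a forest of the
  shape \<open>H2\<close> that serves \<open>E2\<close>; the inner labelling is then homogeneous for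
  the induced colouring. By \<open>stable\<close>, pairs related by \<open>E1\<close> remain related
  after composition with the inner labelling, so the outer one still applies to them. The relation
  \<open>E1\<close> has to be Ramsey for all forests because \<open>H2\<close> is arbitrary.\<close>

lemma good_union:
  assumes A: "finite A" and E1: "ramsey A E1" and E2: "good A b H2 G E2"
    and stable: "\<And>g f f'. rigid A g G \<Longrightarrow> fixing A f \<Longrightarrow> fixing A f' \<Longrightarrow>
      E1 (fmap f G) (fmap f' G) \<Longrightarrow> E1 (fmap f g) (fmap f' g)"
  shows "\<exists>H. good A b H G (\<lambda>\<phi> \<phi>'. E1 \<phi> \<phi>' \<or> E2 \<phi> \<phi>')"
proof -
  obtain G1 where G1: "shape G1 = H2" "fdist G1" "labels G1 \<inter> A = {}"
    using labelled_exists[OF A] by blast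
  obtain H where H: "good A b H G1 E1" using E1 G1 unfolding ramsey_def by blast
  have "good A b H G (\<lambda>\<phi> \<phi>'. E1 \<phi> \<phi>' \<or> E2 \<phi> \<phi>')" unfolding good_def
  proof (intro allI impI)
    fix c :: "nat forest \<Rightarrow> nat" assume c: "\<forall>\<phi>. c \<phi> < b"
    obtain g where g: "shape g = H" "rigid A g G1" "homog A G1 E1 c g"
      using goodD[OF H] c by blast
    let ?c = "\<lambda>x. c (fmap (relab A G1 x) g)"
    obtain g1 where g1: "shape g1 = H2" "rigid A g1 G" "homog A G E2 ?c g1"
      by (rule goodD[OF E2, of ?c]) (use c in auto)
    let ?h = "relab A G1 g1"
    have h: "fmap ?h G1 = g1" "fixing A ?h" using relab[of G1 A g1] G1 g1 by auto
    have lab: "labels g \<subseteq> A \<union> labels G1" using rigid_labels[OF g(2)] .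
    show "\<exists>g. shape g = H \<and> rigid A g G \<and> homog A G (\<lambda>\<phi> \<phi>'. E1 \<phi> \<phi>' \<or> E2 \<phi> \<phi>') c g"
    proof (intro exI[of _ "fmap ?h g"] conjI)
      show "shape (fmap ?h g) = H" using g by simp
      have "?h ` A \<subseteq> A" using h(2) by auto
      then show "rigid A (fmap ?h g) G" using rigid_comp[OF g(2), of A ?h G] h(1) g1(2) by simp
      show "homog A G (\<lambda>\<phi> \<phi>'. E1 \<phi> \<phi>' \<or> E2 \<phi> \<phi>') c (fmap ?h g)"
        unfolding homog_def
      proof (intro allI impI)
        fix f f' :: "nat \<Rightarrow> nat"
        assume f: "fixing A f" "fixing A f'"
          and E: "E1 (fmap f G) (fmap f' G) \<or> E2 (fmap f G) (fmap f' G)"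
        have fh: "fmap (\<lambda>x. f (?h x)) G1 = fmap f g1" for f using h(1) by (metis fmap_fmap)
        show "c (fmap f (fmap ?h g)) = c (fmap f' (fmap ?h g))"
          using E
        proof
          assume "E1 (fmap f G) (fmap f' G)"
          then have "E1 (fmap f g1) (fmap f' g1)" using stable[OF g1(2) f] by blast
          then show ?thesis
            using homogD[OF g(3), of "\<lambda>x. f (?h x)" "\<lambda>x. f' (?h x)"] f h(2) fh[of f] fh[of f'] by simp
        next
          assume "E2 (fmap f G) (fmap f' G)"
          then have "?c (fmap f g1) = ?c (fmap f' g1)" using homogD[OF g1(3) f] by blast
          moreover have "fmap (relab A G1 (fmap f g1)) g = fmap (\<lambda>x. f (?h x)) g"
            if "fixing A f" for f
            using fmap_relab[OF G1(2,3) _ lab, of "\<lambda>x. f (?h x)"] that h(2) fh[of f] by simp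
          ultimately show ?thesis using f by simp
        qed
      qed
    qed
  qed
  then show ?thesis by blast
qed

lemma finite_labelled: "finite L \<Longrightarrow> finite {\<phi>. shape \<phi> = H \<and> labels \<phi> \<subseteq> L}"
proof (induction H)
  case Void
  have "{\<phi>. shape \<phi> = Void \<and> labels \<phi> \<subseteq> L} \<subseteq> {Void}"
  proof safe
    fix \<phi> :: "'a forest" assume "shape \<phi> = Void"
    then show "\<phi> = Void" by (cases \<phi>) auto
  qed
  then show ?case by (rule finite_subset) simp
next
  case (Tr u C G)
  let ?S = "\<lambda>H. {\<phi>. shape \<phi> = H \<and> labels \<phi> \<subseteq> L}"
  have "?S (Tr u C G) \<subseteq> (\<lambda>(x, \<phi>, \<psi>). Tr x \<phi> \<psi>) ` (L \<times> ?S C \<times> ?S G)"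
  proof
    fix \<phi> assume "\<phi> \<in> ?S (Tr u C G)"
    then show "\<phi> \<in> (\<lambda>(x, \<phi>, \<psi>). Tr x \<phi> \<psi>) ` (L \<times> ?S C \<times> ?S G)"
      by (cases \<phi>) (auto simp: image_iff)
  qed
  then show ?case by (rule finite_subset) (use Tr in simp)
qed

text \<open>A product argument. To pass from \<open>f\<close> to \<open>f'\<close>, the first
  component is changed while the second is held fixed, and then the second while the first is held
  fixed. The bound \<open>L\<close> leaves finitely many forests to hold fixed.\<close>

lemma good_app:
  assumes "finite A" "finite L" "A \<subseteq> L"
    and E1: "\<And>b. \<exists>X. good A b X G1 E1" and E2: "\<And>b. \<exists>Y. good A b Y G2 E2"
    and dist: "fdist (app G1 G2)" and disj: "labels (app G1 G2) \<inter> A = {}"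
    and L: "\<And>f f'. fixing A f \<Longrightarrow> fixing A f' \<Longrightarrow> E (fmap f (app G1 G2)) (fmap f' (app G1 G2)) \<Longrightarrow>
       labels (fmap f (app G1 G2)) \<subseteq> L \<and> labels (fmap f' (app G1 G2)) \<subseteq> L \<and>
       E1 (fmap f G1) (fmap f' G1) \<and> E2 (fmap f G2) (fmap f' G2)"
  shows "\<exists>H. good A b H (app G1 G2) E"
proof -
  have d2: "fdist G2" "labels G2 \<inter> A = {}" using dist disj by (auto simp: fdist_app)
  \<comment> \<open>The vectors for \<open>X\<close> cannot be indexed by labellings of
    \<open>Y\<close>, which is chosen later. Labellings of \<open>G2\<close> suffice: once
    \<open>gY\<close> is found, only forests \<open>fmap f gY\<close> occur in second place, and
    they are determined by \<open>fmap f G2\<close>.\<close>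
  let ?I2 = "{\<phi>. shape \<phi> = shape G2 \<and> labels \<phi> \<subseteq> L}"
  obtain X where X: "good A (b ^ card ?I2) X G1 E1" using E1 by blast
  let ?I1 = "{\<phi>. shape \<phi> = X \<and> labels \<phi> \<subseteq> L}"
  obtain Y where Y: "good A (b ^ card ?I1) Y G2 E2" using E2 by blast
  have "good A b (app X Y) (app G1 G2) E" unfolding good_def
  proof (intro allI impI)
    fix c :: "nat forest \<Rightarrow> nat" assume c: "\<forall>\<phi>. c \<phi> < b"
    obtain gY where gY: "shape gY = Y" "rigid A gY G2"
      "\<And>x. x \<in> ?I1 \<Longrightarrow> homog A G2 E2 (\<lambda>y. c (app x y)) gY"
      by (rule good_vec[OF Y finite_labelled[OF assms(2)], of "\<lambda>x y. c (app x y)"])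
        (use c in auto)
    obtain gX where gX: "shape gX = X" "rigid A gX G1"
      "\<And>\<phi>. \<phi> \<in> ?I2 \<Longrightarrow> homog A G1 E1 (\<lambda>x. c (app x (fmap (relab A G2 \<phi>) gY))) gX"
      by (rule good_vec[OF X finite_labelled[OF assms(2)],
            of "\<lambda>\<phi> x. c (app x (fmap (relab A G2 \<phi>) gY))"])
        (use c in auto)
    show "\<exists>g. shape g = app X Y \<and> rigid A g (app G1 G2) \<and> homog A (app G1 G2) E c g"
    proof (intro exI[of _ "app gX gY"] conjI)
      show "shape (app gX gY) = app X Y" using gX gY by simp
      show "rigid A (app gX gY) (app G1 G2)" using rigid_app gX gY by blast
      show "homog A (app G1 G2) E c (app gX gY)" unfolding homog_def
      proof (intro allI impI)
        fix f f' :: "nat \<Rightarrow> nat"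
        assume f: "fixing A f" "fixing A f'"
          and E: "E (fmap f (app G1 G2)) (fmap f' (app G1 G2))"
        note LL = L[OF f E]
        have "fmap f G2 \<in> ?I2" using LL by auto
        from homogD[OF gX(3)[OF this] f] LL
        have "c (app (fmap f gX) (fmap f gY)) = c (app (fmap f' gX) (fmap f gY))"
          using fmap_relab[OF d2 f(1) rigid_labels[OF gY(2)]] by simp
        moreover have "fmap f' gX \<in> ?I1"
        proof -
          have "f' y \<in> L" if "y \<in> labels gX" for y
          proof (cases "y \<in> A")
            case True
            then show ?thesis using f(2) assms(3) by auto
          next
            case False
            then have "y \<in> labels G1" using rigid_labels[OF gX(2)] that by auto
            then show ?thesis using LL by (auto simp: forest.set_map)
          qed
          then show ?thesis using gX by (auto simp: forest.set_map)
        qed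
        from homogD[OF gY(3)[OF this] f] LL
        have "c (app (fmap f' gX) (fmap f gY)) = c (app (fmap f' gX) (fmap f' gY))" by simp
        ultimately show "c (fmap f (app gX gY)) = c (fmap f' (app gX gY))" by simp
      qed
    qed
  qed
  then show ?thesis by blast
qed

definition both_rigid :: "nat set \<Rightarrow> nat forest \<Rightarrow> nat forest \<Rightarrow> nat forest \<Rightarrow> bool" where
  "both_rigid A F \<phi> \<phi>' \<longleftrightarrow> rigid A \<phi> F \<and> rigid A \<phi>' F"

lemma both_rigid_stable:
  assumes "rigid A g G" "fixing A f" "fixing A f'" "both_rigid A F (fmap f G) (fmap f' G)"
  shows "both_rigid A F (fmap f g) (fmap f' g)"
proof -
  have "f ` A \<subseteq> A" "f' ` A \<subseteq> A" using assms by auto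
  moreover have "rigid A (fmap f G) F" "rigid A (fmap f' G) F"
    using assms(4) unfolding both_rigid_def by auto
  ultimately show ?thesis
    using rigid_comp[OF assms(1), of A f F] rigid_comp[OF assms(1), of A f' F]
    unfolding both_rigid_def by simp
qed

subsection \<open>Words on forests\<close>

definition inst :: "nat set \<Rightarrow> nat forest \<Rightarrow> nat forest \<Rightarrow> nat forest \<Rightarrow> bool" where
  "inst A C g y \<longleftrightarrow> (\<exists>f. fixing A f \<and> f ` labels C \<subseteq> A \<and> y = fmap f g)"

lemma inst_labels:
  assumes "inst A C g y" "rigid A g C"
  shows "labels y \<subseteq> A" "shape y = shape g"
proof -
  obtain f where f: "fixing A f" "f ` labels C \<subseteq> A" "y = fmap f g"
    using assms(1) unfolding inst_def by blast
  have "f x \<in> A" if "x \<in> labels g" for x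
    using rigid_labels[OF assms(2)] that f by (cases "x \<in> A") auto
  then show "labels y \<subseteq> A" "shape y = shape g" using f by (auto simp: forest.set_map)
qed

text \<open>The place where the forest above a new node branches off a path becomes known only after
  a monochromatic line is found. Hence a copy over \<open>C\<close> is prepared at each of
  \<open>N\<close> places, with a colour that does not see which instances are inserted.\<close>

lemma successive_homog:
  fixes I :: "'i set"
  assumes A: "finite A" "A \<noteq> {}" and I: "finite I"
    and C: "\<And>b. \<exists>X. good A b X C (both_rigid A Void)"
  shows "\<exists>Xs. length Xs = N \<and> (\<forall>c :: 'i \<Rightarrow> nat forest list \<Rightarrow> nat. (\<forall>i ys. c i ys < b) \<longrightarrow>
     (\<exists>gs. map shape gs = Xs \<and> (\<forall>g\<in>set gs. rigid A g C) \<and>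
        (\<forall>i\<in>I. \<forall>ys ys'. list_all2 (inst A C) gs ys \<longrightarrow> list_all2 (inst A C) gs ys' \<longrightarrow>
           c i ys = c i ys')))"
proof (induction N)
  case 0
  show ?case by (intro exI[of _ "[]"] conjI allI impI) auto
next
  case (Suc N)
  obtain Xs where Xs: "length Xs = N" "\<forall>c :: 'i \<Rightarrow> nat forest list \<Rightarrow> nat. (\<forall>i ys. c i ys < b) \<longrightarrow>
     (\<exists>gs. map shape gs = Xs \<and> (\<forall>g\<in>set gs. rigid A g C) \<and>
        (\<forall>i\<in>I. \<forall>ys ys'. list_all2 (inst A C) gs ys \<longrightarrow> list_all2 (inst A C) gs ys' \<longrightarrow>
           c i ys = c i ys'))"
    using Suc by (elim exE conjE)
  let ?Y = "{ys. map shape ys = Xs \<and> (\<forall>y\<in>set ys. labels y \<subseteq> A)}"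
  have "?Y \<subseteq> {ys. set ys \<subseteq> (\<Union>X\<in>set Xs. {\<phi>. shape \<phi> = X \<and> labels \<phi> \<subseteq> A}) \<and> length ys = N}"
    using Xs(1) by auto
  moreover have "finite {ys. set ys \<subseteq> (\<Union>X\<in>set Xs. {\<phi>. shape \<phi> = X \<and> labels \<phi> \<subseteq> A}) \<and> length ys = N}"
    using finite_labelled[OF A(1)] by (intro finite_lists_length_eq) auto
  ultimately have Y: "finite ?Y" by (rule finite_subset)
  \<comment> \<open>The head is made homogeneous for every index and every conceivable tail at once;
    afterwards it is frozen at the default instance given by \<open>?f0\<close> while the tail is
    treated.\<close>
  let ?J = "I \<times> ?Y"
  have J: "finite ?J" using I Y by simp
  obtain X where X: "good A (b ^ card ?J) X C (both_rigid A Void)" using C by blast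
  obtain a0 where a0: "a0 \<in> A" using A by blast
  let ?f0 = "\<lambda>x. if x \<in> A then x else a0"
  show ?case
  proof (intro exI[of _ "X # Xs"] conjI allI impI)
    fix c :: "'i \<Rightarrow> nat forest list \<Rightarrow> nat" assume c: "\<forall>i ys. c i ys < b"
    obtain g where g: "shape g = X" "rigid A g C"
      "\<And>j. j \<in> ?J \<Longrightarrow> homog A C (both_rigid A Void) (\<lambda>x. c (fst j) (x # snd j)) g"
      by (rule good_vec[OF X J, of "\<lambda>j x. c (fst j) (x # snd j)"]) (use c in auto)
    let ?c = "\<lambda>i ys. c i (fmap ?f0 g # ys)"
    have "\<forall>i ys. ?c i ys < b" using c by simp
    from Xs(2)[THEN spec, THEN mp, OF this]
    obtain gs where gs: "map shape gs = Xs" "\<forall>g\<in>set gs. rigid A g C"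
        "\<forall>i\<in>I. \<forall>ys ys'. list_all2 (inst A C) gs ys \<longrightarrow> list_all2 (inst A C) gs ys' \<longrightarrow>
           ?c i ys = ?c i ys'"
      by (elim exE conjE)
    have key: "c i zs = ?c i ys"
      if i: "i \<in> I" and z: "zs = z # ys" "inst A C g z" "list_all2 (inst A C) gs ys" for i z ys zs
    proof -
      obtain f where f: "fixing A f" "f ` labels C \<subseteq> A" "z = fmap f g" using z(2) unfolding inst_def by blast
      have "\<forall>y\<in>set ys. labels y \<subseteq> A" "map shape ys = map shape gs"
        using z(3) gs(2) by (induction rule: list_all2_induct) (use inst_labels in auto)
      then have "(i, ys) \<in> ?J" using i gs(1) by auto
      from homogD[OF g(3)[OF this] f(1), of ?f0] f(2) a0 z(1) f(3)
      show ?thesis by (auto simp: both_rigid_def forest.set_map)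
    qed
    show "\<exists>gs. map shape gs = X # Xs \<and> (\<forall>g\<in>set gs. rigid A g C) \<and>
        (\<forall>i\<in>I. \<forall>ys ys'. list_all2 (inst A C) gs ys \<longrightarrow> list_all2 (inst A C) gs ys' \<longrightarrow>
           c i ys = c i ys')"
    proof (intro exI[of _ "g # gs"] conjI ballI allI impI)
      fix i ys ys' assume i: "i \<in> I" and ys: "list_all2 (inst A C) (g # gs) ys" "list_all2 (inst A C) (g # gs) ys'"
      obtain z zs z' zs' where z: "ys = z # zs" "inst A C g z" "list_all2 (inst A C) gs zs"
        "ys' = z' # zs'" "inst A C g z'" "list_all2 (inst A C) gs zs'"
        using ys by (auto simp: list_all2_Cons1)
      have "?c i zs = ?c i zs'" using gs(3) i z(3,6) by blast
      then show "c i ys = c i ys'" using key[OF i z(1-3)] key[OF i z(4-6)] by simp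
    qed (use g gs in auto)
  qed (use Xs in auto)
qed

text \<open>A comb: a chain of nodes carrying the word \<open>w\<close>, with its own forest of \<open>xs\<close> attached
  at each of them. A monochromatic line determines only where its first wildcard is, and
  the forest above the new node must branch off at exactly that point.\<close>

fun comb :: "'x list \<Rightarrow> 'x forest list \<Rightarrow> 'x forest" where
  "comb (a # w) (x # xs) = Tr a (app (comb w xs) x) Void"
| "comb _ _ = Void"

lemma fmap_comb [simp]: "fmap f (comb w xs) = comb (map f w) (map (fmap f) xs)"
  by (induction w xs rule: comb.induct) auto

lemma labels_comb: "labels (comb w xs) \<subseteq> set w \<union> (\<Union>x\<in>set xs. labels x)"
  by (induction w xs rule: comb.induct) auto

text \<open>Below \<open>t\<close> the chain and its attached forests carry constants. The rest of
  the chain lies above \<open>t\<close>, where \<open>t\<close> counts as a constant too, so it may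
  repeat \<open>t\<close> and still leaves all of \<open>C\<close> to \<open>g\<close>.\<close>

lemma rigid_comb:
  assumes "set p \<subseteq> A" "set q \<subseteq> insert t A" "length xp = length p"
    "\<forall>x\<in>set xp \<union> set xq. labels x \<subseteq> A" "rigid (insert t A) g C"
  shows "rigid A (comb (p @ t # q) (xp @ g # xq)) (Tr t C Void)"
  using assms
proof (induction p arbitrary: xp)
  case Nil
  have "labels (comb q xq) \<subseteq> insert t A" using labels_comb[of q xq] Nil by fastforce
  then show ?case using Nil rigid_app_skip[of "comb q xq" "insert t A" g C] by simp
next
  case (Cons a p)
  obtain x xs where x: "xp = x # xs" using Cons by (cases xp) auto
  have "rigid A (comb (p @ t # q) (xs @ g # xq)) (Tr t C Void)"
    using Cons x by auto
  then have "rigid A (app (comb (p @ t # q) (xs @ g # xq)) x) (Tr t C Void)"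
    using Cons x by (intro rigid_app_skip2) auto
  then show ?case using x Cons by simp
qed

text \<open>Once the colour ignores the instances attached to the comb, it is a colouring of words.
  The wildcard of a line stands for the label of \<open>t\<close>, and monochromaticity says that
  this label does not matter.\<close>

lemma word_tree:
  assumes A: "finite A" "A \<noteq> {}" and t: "t \<notin> A"
    and C: "\<And>b. \<exists>X. good A b X C (both_rigid A Void)"
  shows "\<exists>H. good A b H (Tr t C Void) (both_rigid A Void)"
proof -
  obtain N where N: "hj A b N" using hales_jewett[OF A(1)] by blast
  let ?W = "{w. set w \<subseteq> A \<and> length w = N}"
  have W: "finite ?W" using finite_lists_length_eq[OF A(1)] by simp
  obtain Xs where Xs: "length Xs = N" "\<forall>c. (\<forall>i ys. c i ys < b) \<longrightarrow>
     (\<exists>gs. map shape gs = Xs \<and> (\<forall>g\<in>set gs. rigid A g C) \<and>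
        (\<forall>i\<in>?W. \<forall>ys ys'. list_all2 (inst A C) gs ys \<longrightarrow> list_all2 (inst A C) gs ys' \<longrightarrow>
           c i ys = (c i ys' :: nat)))"
    using successive_homog[OF A W C, of N b] by (elim exE conjE)
  obtain a0 where a0: "a0 \<in> A" using A by blast
  let ?f0 = "\<lambda>x. if x \<in> A then x else a0"
  have "good A b (comb (replicate N ()) Xs) (Tr t C Void) (both_rigid A Void)"
    unfolding good_def
  proof (intro allI impI)
    fix c :: "nat forest \<Rightarrow> nat" assume c: "\<forall>\<phi>. c \<phi> < b"
    have "\<forall>w ys. c (comb w ys) < b" using c by simp
    from Xs(2)[THEN spec, THEN mp, OF this]
    obtain gs where gs: "map shape gs = Xs" "\<forall>g\<in>set gs. rigid A g C"
        "\<forall>w\<in>?W. \<forall>ys ys'. list_all2 (inst A C) gs ys \<longrightarrow> list_all2 (inst A C) gs ys' \<longrightarrow>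
           c (comb w ys) = c (comb w ys')"
      by (elim exE conjE)
    let ?y0 = "map (fmap ?f0) gs"
    have inst0: "inst A C g (fmap ?f0 g)" for g using a0 unfolding inst_def by (intro exI[of _ ?f0]) auto
    have y0: "list_all2 (inst A C) gs ?y0" using inst0 by (simp add: list_all2_conv_all_nth)
    have "\<exists>l. line A N l \<and> (\<forall>a\<in>A. \<forall>a'\<in>A. c (comb (subst a l) ?y0) = c (comb (subst a' l) ?y0))"
      using N[unfolded hj_def, THEN spec, of "\<lambda>w. c (comb w ?y0)"] c by simp
    then obtain l where l: "line A N l"
      "\<forall>a\<in>A. \<forall>a'\<in>A. c (comb (subst a l) ?y0) = c (comb (subst a' l) ?y0)" by blast
    obtain lp lq where lpq: "l = lp @ None # lq" "None \<notin> set lp"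
      using l(1) split_list_first[of None l] unfolding line_def by blast
    have lenl: "length l = N" "length gs = N" using l(1) gs(1) Xs(1) by (auto simp: line_def)
    define gp g gq where "gp = take (length lp) gs" and "g = gs ! length lp" and "gq = drop (Suc (length lp)) gs"
    have gsp: "gs = gp @ g # gq" "length gp = length lp" using lenl lpq
      by (auto simp: gp_def g_def gq_def id_take_nth_drop[symmetric])
    \<comment> \<open>Only the forest at the first wildcard keeps the labels of \<open>C\<close>; at
      all other places the default instance is inserted, which consists of constants.\<close>
    let ?xs = "map (fmap ?f0) gp @ g # map (fmap ?f0) gq"
    let ?g = "comb (subst t l) ?xs"
    show "\<exists>g. shape g = comb (replicate N ()) Xs \<and> rigid A g (Tr t C Void) \<and>
      homog A (Tr t C Void) (both_rigid A Void) c g"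
    proof (intro exI[of _ ?g] conjI)
      have "map (\<lambda>_. ()) (subst t l) = replicate N ()" using lenl(1)
        by (intro nth_equalityI) auto
      moreover have "map shape ?xs = Xs" using gs(1) gsp(1) by (simp add: comp_def)
      ultimately show "shape ?g = comb (replicate N ()) Xs" by simp
      have "rigid (insert t A) g C" using gs(2) gsp(1) rigid_mono[of A g C "insert t A"] by auto
      moreover have "set (subst t lp) \<subseteq> A" "set (subst t lq) \<subseteq> insert t A"
        using l(1) lpq by (auto simp: line_def subst_def split: option.splits)
      moreover have "labels (fmap ?f0 g) \<subseteq> A" for g using a0 by (auto simp: forest.set_map)
      ultimately have "rigid A (comb (subst t lp @ t # subst t lq) ?xs) (Tr t C Void)"
        using gsp(2) by (intro rigid_comb) auto
      then show "rigid A ?g (Tr t C Void)" unfolding lpq(1) by (simp add: subst_def)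
      have key: "c (fmap f ?g) = c (comb (subst (f t) l) ?y0) \<and> f t \<in> A"
        if f: "fixing A f" "rigid A (fmap f (Tr t C Void)) Void" for f
      proof -
        have fC: "f t \<in> A" "f ` labels C \<subseteq> A" using f(2) by (auto simp: forest.set_map)
        have "map f (subst t l) = subst (f t) l" using l(1) f(1)
          by (auto simp: subst_def line_def split: option.splits)
        moreover have "subst (f t) l \<in> ?W" using l(1) fC(1) set_subst[of l A "f t"]
          by (auto simp: line_def)
        moreover have "list_all2 (inst A C) gs (map (fmap f) ?xs)"
        proof -
          have 1: "inst A C g (fmap f (fmap ?f0 g))" for g
            using a0 f(1) unfolding inst_def by (intro exI[of _ "\<lambda>x. f (?f0 x)"]) auto
          have 2: "inst A C g (fmap f g)" using f(1) fC unfolding inst_def by blast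
          show ?thesis unfolding gsp(1) using 1 2
            by (auto intro!: list_all2_appendI simp: list_all2_map2 list.rel_refl_strong)
        qed
        ultimately have "c (comb (map f (subst t l)) (map (fmap f) ?xs)) = c (comb (subst (f t) l) ?y0)"
          using gs(3)[THEN bspec, THEN spec, THEN spec, THEN mp, THEN mp, OF _ _ y0] by simp
        then show ?thesis using fC(1) by simp
      qed
      show "homog A (Tr t C Void) (both_rigid A Void) c ?g" unfolding homog_def both_rigid_def
      proof (intro allI impI, elim conjE)
        fix f f' assume "fixing A f" "fixing A f'" "rigid A (fmap f (Tr t C Void)) Void"
          "rigid A (fmap f' (Tr t C Void)) Void"
        then show "c (fmap f ?g) = c (fmap f' ?g)"
          using key[of f] key[of f'] l(2)[THEN bspec, THEN bspec, of "f t" "f' t"] by simp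
      qed
    qed
  qed
  then show ?thesis by blast
qed

lemma good_Void: "\<exists>H. good A b H Void E"
  unfolding good_def homog_def by (intro exI[of _ Void] allI impI) auto

theorem ramsey_words:
  assumes A: "finite A" "A \<noteq> {}"
  shows "ramsey A (both_rigid A Void)"
proof -
  have "fdist G \<Longrightarrow> labels G \<inter> A = {} \<Longrightarrow> \<exists>H. good A b H G (both_rigid A Void)" for G b
  proof (induction G arbitrary: b)
    case Void
    then show ?case using good_Void by blast
  next
    case (Tr t C G)
    have "\<exists>H. good A b H (app (Tr t C Void) G) (both_rigid A Void)"
    proof (rule good_app[where L = A and ?E1.0 = "both_rigid A Void" and ?E2.0 = "both_rigid A Void"])
      show "\<exists>X. good A b X (Tr t C Void) (both_rigid A Void)" for b
        using Tr A by (intro word_tree) auto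
      show "\<exists>X. good A b X G (both_rigid A Void)" for b using Tr by auto
    qed (use Tr A in \<open>auto simp: both_rigid_def\<close>)
    then show ?case by simp
  qed
  then show ?thesis unfolding ramsey_def by blast
qed

subsection \<open>Dependence on traces\<close>

definition same_trace :: "nat set \<Rightarrow> nat \<Rightarrow> nat forest \<Rightarrow> nat forest \<Rightarrow> nat forest \<Rightarrow> bool" where
  "same_trace A s F \<phi> \<phi>' \<longleftrightarrow> both_rigid A F \<phi> \<phi>' \<and> tr s \<phi> = tr s \<phi>'"

text \<open>The trace reveals whether \<open>s\<close> sits at the root \<open>t\<close> or above
  it. In the first case the hypothesis on \<open>D\<close>, with \<open>s\<close> as an additional
  constant, governs what lies above; in the second the trace starts with the constant at
  \<open>t\<close> and continues as a trace in \<open>C\<close>. One forest must serve both cases,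
  so \<open>g1\<close> settles the first over a forest of the shape on which \<open>g2\<close>
  settles the second.\<close>

lemma trace_tree:
  assumes A: "finite A" and s: "s \<notin> A" and t: "t \<notin> A" and C: "fdist C" "labels C \<inter> A = {}" "t \<notin> labels C"
    and D: "ramsey (insert s A) (both_rigid (insert s A) D)"
    and CQ: "\<And>b. \<exists>X. good A b X C (same_trace A s (Tr s D Void))"
  shows "\<exists>H. good A b H (Tr t C Void) (same_trace A s (Tr s D Void))"
proof -
  let ?Q = "same_trace A s (Tr s D Void)"
  \<comment> \<open>One coordinate for each constant that the root \<open>t\<close> may
    carry.\<close>
  obtain X1 where X1: "good A (b ^ card A) X1 C ?Q" using CQ by blast
  have "finite (insert s (insert t A))" using A by simp
  from labelled_exists[OF this] obtain G1 where G1: "shape G1 = X1" "fdist G1"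
    "labels G1 \<inter> insert s (insert t A) = {}" by blast
  have G1A: "labels G1 \<inter> A = {}" "t \<notin> labels G1" "s \<notin> labels G1" using G1 by auto
  have "labels G1 \<inter> insert s A = {}" using G1 by auto
  then obtain X where X: "good (insert s A) b X G1 (both_rigid (insert s A) D)"
    using D G1(2) unfolding ramsey_def by blast
  have "good A b (Tr () X Void) (Tr t C Void) ?Q" unfolding good_def
  proof (intro allI impI)
    fix c :: "nat forest \<Rightarrow> nat" assume c: "\<forall>\<phi>. c \<phi> < b"
    obtain g1 where g1: "shape g1 = X" "rigid (insert s A) g1 G1"
      "homog (insert s A) G1 (both_rigid (insert s A) D) (\<lambda>x. c (Tr s x Void)) g1"
      by (rule goodD[OF X, of "\<lambda>x. c (Tr s x Void)"]) (use c in auto)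
    \<comment> \<open>In \<open>g1\<close> the constant \<open>s\<close> repeats the label of the
      root. Renamed to \<open>t\<close> it follows that label: it turns back into \<open>s\<close>
      if \<open>f t = s\<close>, and into a constant of \<open>A\<close> if \<open>f t\<close> is
      one.\<close>
    define r where "r = (\<lambda>x. if x = s then t else x)"
    define g1' where "g1' = fmap r g1"
    have "fmap r G1 = G1" using G1A by (auto simp: r_def intro: forest.map_ident_strong)
    then have g1': "rigid (insert t A) g1' G1"
      using rigid_comp[OF g1(2), of "insert t A" r G1] rigid_refl by (auto simp: r_def g1'_def)
    have lab1: "labels g1' \<subseteq> insert t A \<union> labels G1" using rigid_labels[OF g1'] .
    let ?c2 = "\<lambda>a x. c (Tr a (fmap ((relab A G1 x)(t := a)) g1') Void)"
    obtain g2 where g2: "shape g2 = X1" "rigid A g2 C" "\<And>a. a \<in> A \<Longrightarrow> homog A C ?Q (?c2 a) g2"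
      by (rule good_vec[OF X1 A, of ?c2]) (use c in auto)
    have rl: "fmap (relab A G1 g2) G1 = g2" "fixing A (relab A G1 g2)"
      using relab[of G1 A g2] G1 g2 G1A by auto
    define h where "h = (relab A G1 g2)(t := t)"
    have h: "fixing A h" "h t = t" using rl(2) t by (auto simp: h_def)
    have hG1: "fmap h G1 = g2"
    proof -
      have "fmap h G1 = fmap (relab A G1 g2) G1" using G1A by (intro forest.map_cong0) (auto simp: h_def)
      then show ?thesis using rl(1) by simp
    qed
    have g2t: "rigid (insert t A) g2 C" using g2(2) by (rule rigid_mono) auto
    have hC: "rigid (insert t A) (fmap h g1') C"
      by (rule rigid_comp[OF g1']) (use hG1 g2t h in auto)
    let ?g = "Tr t (fmap h g1') Void"
    have top: "c (fmap f ?g) = c (fmap f' ?g)"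
      if f: "fixing A f" "fixing A f'" "f t = s" "f' t = s" "rigid (insert s A) (fmap f C) D" "rigid (insert s A) (fmap f' C) D"
      for f f'
    proof -
      have k: "fixing (insert s A) (\<lambda>x. f (h (r x)))" if "fixing A f" "f t = s" for f
        using that h s by (auto simp: r_def)
      have kG: "fmap (\<lambda>x. f (h (r x))) G1 = fmap f g2" for f
      proof -
        have "fmap (\<lambda>x. f (h (r x))) G1 = fmap f (fmap h (fmap r G1))" by simp
        then show ?thesis using hG1 \<open>fmap r G1 = G1\<close> by simp
      qed
      have "rigid (insert s A) (fmap f g2) D" if "fixing A f" "f t = s" "rigid (insert s A) (fmap f C) D" for f
        by (rule rigid_comp[OF g2t that(3)]) (use that in auto)
      then have "both_rigid (insert s A) D (fmap (\<lambda>x. f (h (r x))) G1) (fmap (\<lambda>x. f' (h (r x))) G1)"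
        using f unfolding both_rigid_def kG by blast
      from homogD[OF g1(3) k k this] f show ?thesis by (simp add: g1'_def)
    qed
    have inner: "c (fmap f ?g) = ?c2 (f t) (fmap f g2)" if f: "fixing A f" for f
    proof -
      have e: "fmap (relab A G1 (fmap f g2)) G1 = fmap f g2" "fixing A (relab A G1 (fmap f g2))"
        using relab[of G1 A "fmap f g2"] G1 g2 G1A by auto
      have "fmap (relab A G1 (fmap f g2)) G1 = fmap (\<lambda>x. f (h x)) G1"
        using e(1) hG1 fmap_fmap[of f h G1] by simp
      then have "((relab A G1 (fmap f g2))(t := f t)) x = f (h x)" if "x \<in> labels g1'" for x
        using lab1 that e(2) h f fmap_eqD by fastforce
      then have "fmap ((relab A G1 (fmap f g2))(t := f t)) g1' = fmap (\<lambda>x. f (h x)) g1'"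
        by (rule forest.map_cong0)
      then show ?thesis by simp
    qed
    show "\<exists>g. shape g = Tr () X Void \<and> rigid A g (Tr t C Void) \<and> homog A (Tr t C Void) ?Q c g"
    proof (intro exI[of _ ?g] conjI)
      show "shape ?g = Tr () X Void" using g1(1) by (simp add: g1'_def)
      show "rigid A ?g (Tr t C Void)" using hC by simp
      show "homog A (Tr t C Void) ?Q c ?g" unfolding homog_def
      proof (intro allI impI)
        fix f f' :: "nat \<Rightarrow> nat" assume f: "fixing A f" "fixing A f'"
          and Q: "?Q (fmap f (Tr t C Void)) (fmap f' (Tr t C Void))"
        have cases: "f t = s \<and> rigid (insert s A) (fmap f C) D \<or>
            f t \<in> A \<and> rigid A (fmap f C) (Tr s D Void) \<and> s \<in> labels (fmap f C)"
          if "rigid A (fmap f (Tr t C Void)) (Tr s D Void)" for f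
          using that rigid_labels_onto[of A "fmap f C" "Tr s D Void"] by auto
        have tr: "tr s (fmap f (Tr t C Void)) = tr s (fmap f' (Tr t C Void))"
          and R: "rigid A (fmap f (Tr t C Void)) (Tr s D Void)" "rigid A (fmap f' (Tr t C Void)) (Tr s D Void)"
          using Q unfolding same_trace_def both_rigid_def by blast+
        show "c (fmap f ?g) = c (fmap f' ?g)"
        proof (cases "f t = s")
          case True
          then have "f' t = s" using tr by (auto split: if_splits)
          moreover have "rigid (insert s A) (fmap f C) D" using cases[OF R(1)] True s by auto
          moreover have "rigid (insert s A) (fmap f' C) D"
            using cases[OF R(2)] \<open>f' t = s\<close> s by auto
          ultimately show ?thesis using top[OF f True] by blast
        next
          case False
          then have "f' t \<noteq> s" using tr by (auto split: if_splits)
          then have ff: "f t \<in> A" "rigid A (fmap f C) (Tr s D Void)" "s \<in> labels (fmap f C)"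
             "f' t \<in> A" "rigid A (fmap f' C) (Tr s D Void)" "s \<in> labels (fmap f' C)"
            using cases[OF R(1)] cases[OF R(2)] False by blast+
          then have "f t = f' t" "tr s (fmap f C) = tr s (fmap f' C)"
            using tr s by (auto split: if_splits)
          moreover have "?Q (fmap f C) (fmap f' C)"
            using ff calculation unfolding same_trace_def both_rigid_def by blast
          ultimately show ?thesis
            using inner[OF f(1)] inner[OF f(2)] homogD[OF g2(3)[OF ff(1)] f] by simp
        qed
      qed
    qed
  qed
  then show ?thesis by blast
qed

text \<open>If \<open>s\<close> is met in the first tree of \<open>G\<close>, the later trees are
  labelled over \<open>F\<close>, for which full homogeneity is available. If not, the first tree
  consists of constants and the trace continues in the later ones. The trace tells these cases
  apart, since it begins with \<open>None\<close> exactly in the second; each component therefore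
  has to satisfy a disjunction of two relations.\<close>

theorem ramsey_same_trace:
  assumes A: "finite A" "A \<noteq> {}" and s: "s \<notin> A"
    and D: "ramsey (insert s A) (both_rigid (insert s A) D)"
    and F: "ramsey A (both_rigid A F)"
  shows "ramsey A (same_trace A s (Tr s D F))"
proof -
  \<comment> \<open>The forest \<open>F\<close> varies, because inside the first tree the target is
    \<open>Tr s D Void\<close>; its remaining forest is empty, and \<open>ramsey_words\<close>
    provides the hypothesis.\<close>
  have "fdist G \<Longrightarrow> labels G \<inter> A = {} \<Longrightarrow> ramsey A (both_rigid A F) \<Longrightarrow>
     \<exists>H. good A b H G (same_trace A s (Tr s D F))" for G b F
  proof (induction G arbitrary: b F)
    case Void
    then show ?case using good_Void by blast
  next
    case (Tr t C G)
    note V = ramsey_words[OF A]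
    let ?R = "both_rigid A" and ?Q = "same_trace A s"
    have dC: "labels C \<inter> A = {}" and dG: "labels G \<inter> A = {}" using Tr.prems(2) by auto
    have C: "\<exists>X. good A b X (Tr t C Void) (?Q (Tr s D Void))" for b
      using Tr.prems A(1) s D Tr.IH(1)[OF _ dC V] by (intro trace_tree) auto
    have X: "\<exists>X. good A b X (Tr t C Void) (\<lambda>\<phi> \<phi>'. ?R Void \<phi> \<phi>' \<or> ?Q (Tr s D Void) \<phi> \<phi>')" for b
    proof -
      obtain X where "good A b X (Tr t C Void) (?Q (Tr s D Void))" using C by blast
      from good_union[OF A(1) V this both_rigid_stable] show ?thesis .
    qed
    have Y: "\<exists>X. good A b X G (\<lambda>\<phi> \<phi>'. ?R F \<phi> \<phi>' \<or> ?Q (Tr s D F) \<phi> \<phi>')" for b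
    proof -
      obtain X where "good A b X G (?Q (Tr s D F))"
        using Tr.IH(2)[OF _ dG Tr.prems(3)] Tr.prems(1) by auto
      from good_union[OF A(1) Tr.prems(3) this both_rigid_stable] show ?thesis .
    qed
    let ?L = "A \<union> labels (Tr s D F)"
    have "\<exists>H. good A b H (app (Tr t C Void) G) (?Q (Tr s D F))"
    proof (rule good_app[where L = ?L, OF _ _ _ X Y])
      fix f f' :: "nat \<Rightarrow> nat" assume f: "fixing A f" "fixing A f'"
        and Q: "?Q (Tr s D F) (fmap f (app (Tr t C Void) G)) (fmap f' (app (Tr t C Void) G))"
      let ?p = "\<lambda>f. fmap f (Tr t C Void)" and ?q = "\<lambda>f. fmap f G"
      have tr: "tr s (app (?p f) (?q f)) = tr s (app (?p f') (?q f'))"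
        and R: "rigid A (app (?p f) (?q f)) (Tr s D F)" "rigid A (app (?p f') (?q f')) (Tr s D F)"
        using Q unfolding same_trace_def both_rigid_def by simp_all
      have cases: "(s \<in> labels (?p f) \<and> rigid A (?p f) (Tr s D Void) \<and> rigid A (?q f) F) \<or>
         (s \<notin> labels (?p f) \<and> labels (?p f) \<subseteq> A \<and> rigid A (?q f) (Tr s D F))"
        if "rigid A (app (?p f) (?q f)) (Tr s D F)" for f
        using that s rigid_labels_onto[of A "fmap f C" "Tr s D Void"] by auto
      have trp: "tr s (app (?p f) (?q f)) = tr s (?p f)" if "s \<in> labels (?p f)" for f
        using that by (rule tr_app_left)
      have trq: "tr s (app (?p f) (?q f)) = None # tr s (?q f)" if "s \<notin> labels (?p f)" for f
        using tr_app_right[OF that] by simp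
      have trp': "hd (tr s (?p f)) \<noteq> None \<or> tr s (?p f) = []" if "s \<in> labels (?p f)" for f
        using that by auto
      have iff: "s \<in> labels (?p f) \<longleftrightarrow> s \<in> labels (?p f')"
      proof -
        have False if "s \<in> labels (?p f)" "s \<notin> labels (?p f')" "tr s (app (?p f) (?q f)) = tr s (app (?p f') (?q f'))"
          for f f'
        proof -
          have "tr s (?p f) = None # tr s (?q f')" using trp[OF that(1)] trq[OF that(2)] that(3) by simp
          then show False using trp'[OF that(1)] by simp
        qed
        then show ?thesis using tr by metis
      qed
      have "(?R Void (?p f) (?p f') \<or> ?Q (Tr s D Void) (?p f) (?p f')) \<and>
         (?R F (?q f) (?q f') \<or> ?Q (Tr s D F) (?q f) (?q f'))"
      proof (cases "s \<in> labels (?p f)")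
        case True
        then have "s \<in> labels (?p f')" using iff by blast
        then show ?thesis using True cases[OF R(1)] cases[OF R(2)] tr trp[OF True] trp[of f']
          unfolding same_trace_def both_rigid_def by metis
      next
        case False
        then have "s \<notin> labels (?p f')" using iff by blast
        then show ?thesis using False cases[OF R(1)] cases[OF R(2)] tr trq[OF False] trq[of f']
          unfolding same_trace_def both_rigid_def rigid_Void by (metis list.inject)
      qed
      moreover have "labels (fmap f (app (Tr t C Void) G)) \<subseteq> ?L" "labels (fmap f' (app (Tr t C Void) G)) \<subseteq> ?L"
        using rigid_labels[OF R(1)] rigid_labels[OF R(2)] by auto
      ultimately show "labels (fmap f (app (Tr t C Void) G)) \<subseteq> ?L \<and> labels (fmap f' (app (Tr t C Void) G)) \<subseteq> ?L \<and>
         (?R Void (?p f) (?p f') \<or> ?Q (Tr s D Void) (?p f) (?p f')) \<and>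
         (?R F (?q f) (?q f') \<or> ?Q (Tr s D F) (?q f) (?q f'))" by blast
    qed (use Tr.prems A in auto)
    then show ?case by simp
  qed
  from this[OF _ _ F] show ?thesis by (simp add: ramsey_def)
qed

subsection \<open>Colourings of traces\<close>

text \<open>The colour of a route may depend on the node that it leads to, but not on the constants
  read along it. What is left is a colouring of the nodes of \<open>G\<close>, to which a pigeonhole
  principle applies.\<close>

definition trace_homog :: "nat set \<Rightarrow> nat forest \<Rightarrow> (nat option list \<Rightarrow> nat) \<Rightarrow> nat forest \<Rightarrow> bool" where
  "trace_homog A G d g \<longleftrightarrow> (\<forall>t\<in>labels G. \<forall>f f'. fixing A f \<longrightarrow> fixing A f' \<longrightarrow>
     f ` labels G \<subseteq> A \<longrightarrow> f' ` labels G \<subseteq> A \<longrightarrow>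
     d (map (map_option f) (tr t g)) = d (map (map_option f') (tr t g)))"

definition trace_good :: "nat set \<Rightarrow> nat \<Rightarrow> unit forest \<Rightarrow> nat forest \<Rightarrow> bool" where
  "trace_good A b H G \<longleftrightarrow> (\<forall>d. (\<forall>\<tau>. d \<tau> < b) \<longrightarrow>
     (\<exists>g. shape g = H \<and> rigid A g G \<and> trace_homog A G d g))"

lemma trace_homogD:
  assumes "trace_homog A G d g" "t \<in> labels G" "fixing A f" "fixing A f'"
    "f ` labels G \<subseteq> A" "f' ` labels G \<subseteq> A"
  shows "d (map (map_option f) (tr t g)) = d (map (map_option f') (tr t g))"
  using assms(1)[unfolded trace_homog_def, rule_format, OF assms(2), of f f'] assms(3-6) by blast

lemma trace_goodD:
  assumes "trace_good A b H G" "\<And>\<tau>. d \<tau> < b"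
  obtains g where "shape g = H" "rigid A g G" "trace_homog A G d g"
proof -
  have "\<exists>g. shape g = H \<and> rigid A g G \<and> trace_homog A G d g"
    using assms(1)[unfolded trace_good_def, THEN spec, of d] assms(2) by simp
  then show ?thesis using that by (elim exE conjE)
qed

lemma trace_good_vec:
  assumes "trace_good A (b ^ card I) H G" "finite I" "\<And>i \<tau>. i \<in> I \<Longrightarrow> d i \<tau> < b"
  obtains g where "shape g = H" "rigid A g G" "\<And>i. i \<in> I \<Longrightarrow> trace_homog A G (d i) g"
proof -
  obtain enc :: "('a \<Rightarrow> nat) \<Rightarrow> nat" where e:
    "\<And>v. (\<forall>i\<in>I. v i < b) \<Longrightarrow> enc v < b ^ card I"
    "\<And>v v'. (\<forall>i\<in>I. v i < b) \<Longrightarrow> (\<forall>i\<in>I. v' i < b) \<Longrightarrow> enc v = enc v' \<Longrightarrow> \<forall>i\<in>I. v i = v' i"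
    by (rule vector_colouring[OF assms(2), where b = b]) blast
  have "enc (\<lambda>i. d i \<tau>) < b ^ card I" for \<tau> using e(1) assms(3) by auto
  from trace_goodD[OF assms(1) this] obtain g where g: "shape g = H" "rigid A g G"
    "trace_homog A G (\<lambda>\<tau>. enc (\<lambda>i. d i \<tau>)) g" .
  have "trace_homog A G (d i) g" if "i \<in> I" for i
    unfolding trace_homog_def
  proof (intro ballI allI impI)
    fix t f f'
    assume "t \<in> labels G" "fixing A f" "fixing A f'" "f ` labels G \<subseteq> A" "f' ` labels G \<subseteq> A"
    from e(2)[OF _ _ trace_homogD[OF g(3) this]]
    show "d i (map (map_option f) (tr t g)) = d i (map (map_option f') (tr t g))"
      using that assms(3) by blast
  qed
  then show ?thesis using that g by blast
qed

section \<open>Routes through towers of blocks\<close>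

fun apps :: "'x forest list \<Rightarrow> 'x forest" where
  "apps [] = Void"
| "apps (z # zs) = app z (apps zs)"

fun trees :: "'x forest \<Rightarrow> 'x forest list" where
  "trees Void = []"
| "trees (Tr x C G) = Tr x C Void # trees G"

lemma apps_trees [simp]: "apps (trees G) = G"
  by (induction G) auto

lemma trees_single: "T \<in> set (trees G) \<Longrightarrow> \<exists>v D. T = Tr v D Void"
  by (induction G) auto

lemma labels_apps [simp]: "labels (apps zs) = (\<Union>z\<in>set zs. labels z)"
  by (induction zs) auto

lemma fmap_apps [simp]: "fmap f (apps zs) = apps (map (fmap f) zs)"
  by (induction zs) auto

lemma apps_append: "apps (xs @ ys) = app (apps xs) (apps ys)"
  by (induction xs) (auto simp: app_assoc)

lemma labels_trees: "labels G = (\<Union>z\<in>set (trees G). labels z)"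
  using labels_apps[of "trees G"] by simp

lemma trees_disjoint:
  "fdist G \<Longrightarrow> i < length (trees G) \<Longrightarrow> j < length (trees G) \<Longrightarrow> i \<noteq> j \<Longrightarrow>
   labels (trees G ! i) \<inter> labels (trees G ! j) = {}"
proof (induction G arbitrary: i j)
  case (Tr x C G)
  have sub: "labels (trees G ! k) \<subseteq> labels G" if "k < length (trees G)" for k
    using labels_trees[of G] that by auto
  show ?case
  proof (cases i)
    case 0
    then obtain k where "j = Suc k" "k < length (trees G)" using Tr.prems by (cases j) auto
    then show ?thesis using 0 sub[of k] Tr.prems(1) by auto
  next
    case (Suc i')
    show ?thesis
    proof (cases j)
      case 0
      then show ?thesis using Suc sub[of i'] Tr.prems by auto
    next
      case (Suc j')
      then show ?thesis using \<open>i = Suc i'\<close> Tr.IH(2)[of i' j'] Tr.prems by simp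
    qed
  qed
qed auto

lemma rigid_apps: "list_all2 (rigid B) zs Ts \<Longrightarrow> rigid B (apps zs) (apps Ts)"
  by (induction rule: list_all2_induct) (auto intro: rigid_app)

lemma rigid_apps_single:
  assumes "j < length zs" "rigid B (zs ! j) F" "\<And>i. i < length zs \<Longrightarrow> i \<noteq> j \<Longrightarrow> labels (zs ! i) \<subseteq> B"
  shows "rigid B (apps zs) F"
proof -
  have "labels (apps (take j zs)) \<subseteq> B" "labels (apps (drop (Suc j) zs)) \<subseteq> B"
  proof -
    have "labels z \<subseteq> B" if z: "z \<in> set (take j zs)" for z
    proof -
      obtain i where "i < j" "z = zs ! i" using z by (auto simp: in_set_conv_nth)
      then show ?thesis using assms(1) assms(3)[of i] by simp
    qed
    then show "labels (apps (take j zs)) \<subseteq> B" by auto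
    have "labels z \<subseteq> B" if z: "z \<in> set (drop (Suc j) zs)" for z
    proof -
      obtain i where "i < length zs - Suc j" "z = zs ! (Suc j + i)"
        using z by (auto simp: in_set_conv_nth)
      then show ?thesis using assms(3)[of "Suc j + i"] by auto
    qed
    then show "labels (apps (drop (Suc j) zs)) \<subseteq> B" by auto
  qed
  then have "rigid B (app (apps (take j zs)) (app (zs ! j) (apps (drop (Suc j) zs)))) F"
    using assms(2) by (intro rigid_app_skip rigid_app_skip2)
  moreover have "zs = take j zs @ zs ! j # drop (Suc j) zs" using assms(1) by (rule id_take_nth_drop)
  then have "apps zs = app (apps (take j zs)) (app (zs ! j) (apps (drop (Suc j) zs)))"
    by (metis apps_append apps.simps(2))
  ultimately show ?thesis by simp
qed

text \<open>All blocks have the same number \<open>r\<close> of roots, so the route past them shows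
  only the index \<open>j\<close>, not what they contain.\<close>

lemma tr_apps:
  assumes "j < length zs" "s \<in> labels (zs ! j)"
    "\<And>i. i < j \<Longrightarrow> s \<notin> labels (zs ! i) \<and> nroots (zs ! i) = r"
  shows "tr s (apps zs) = replicate (j * r) None @ tr s (zs ! j)"
  using assms
proof (induction j arbitrary: zs)
  case 0
  then obtain z zs' where "zs = z # zs'" by (cases zs) auto
  then show ?case using 0 by (simp add: tr_app_left)
next
  case (Suc j)
  then obtain z zs' where z: "zs = z # zs'" by (cases zs) auto
  have "tr s (apps zs') = replicate (j * r) None @ tr s (zs' ! j)"
  proof (rule Suc.IH)
    fix i assume "i < j"
    then show "s \<notin> labels (zs' ! i) \<and> nroots (zs' ! i) = r" using Suc.prems(3)[of "Suc i"] z by simp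
  qed (use Suc.prems z in auto)
  moreover have "s \<notin> labels z" "nroots z = r" using Suc.prems(3)[of 0] z by auto
  ultimately show ?case using z by (simp add: tr_app_right replicate_add)
qed

text \<open>A node of the tree \<open>tower X m n\<close> has \<open>m\<close> blocks of children, and a word of length \<open>n\<close> over
  pairs (block, label) describes a labelled path to a copy of \<open>X\<close>. In a monochromatic line over
  this alphabet the branches through the different blocks separate exactly at the first wildcard.\<close>

fun tower :: "unit forest \<Rightarrow> nat \<Rightarrow> nat \<Rightarrow> unit forest" where
  "tower X m 0 = X"
| "tower X m (Suc n) = Tr () (apps (replicate m (tower X m n))) Void"

context
  fixes X :: "unit forest" and m :: nat and a0 t :: nat and xs :: "nat forest list"
begin

abbreviation fill :: "nat \<Rightarrow> nat forest" where
  "fill n \<equiv> fmap (\<lambda>_. a0) (tower X m n)"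

fun pth :: "(nat \<times> nat) list \<Rightarrow> nat forest \<Rightarrow> nat forest" where
  "pth [] x = x"
| "pth ((j, a) # w) x = Tr a (apps ((replicate m (fill (length w)))[j := pth w x])) Void"

fun ptr :: "(nat \<times> nat) list \<Rightarrow> nat option list" where
  "ptr [] = []"
| "ptr ((j, a) # w) = Some a # replicate (j * nroots (tower X m (length w))) None @ ptr w"

text \<open>A single path leads to the first wildcard. There \<open>t\<close> is placed and all
  \<open>m\<close> blocks are opened at once, with the later wildcards read as \<open>(j, t)\<close>
  inside block \<open>j\<close>. A node in block \<open>j\<close> is thus reached by the word
  \<open>subst (j, t) l\<close>.\<close>

fun spl :: "(nat \<times> nat) option list \<Rightarrow> nat forest" where
  "spl [] = Void"
| "spl (Some (j, a) # l) = Tr a (apps ((replicate m (fill (length l)))[j := spl l])) Void"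
| "spl (None # l) = Tr t (apps (map (\<lambda>j. pth (subst (j, t) l) (xs ! j)) [0..<m])) Void"

lemma shape_unit [simp]: "shape H = H"
  by (induction H) auto

lemma shape_update:
  "shape z = H \<Longrightarrow> map shape ((replicate m (fmap (\<lambda>_. a0) H))[j := z]) = replicate m H"
  by (cases "j < m"; rule nth_equalityI) (simp_all add: nth_list_update list_update_beyond)

lemma shape_pth: "shape x = X \<Longrightarrow> shape (pth w x) = tower X m (length w)"
proof (induction w)
  case (Cons p w)
  then show ?case by (cases p) (simp del: map_replicate add: shape_update)
qed simp

lemma shape_spl:
  "None \<in> set l \<Longrightarrow> \<forall>j<m. shape (xs ! j) = X \<Longrightarrow> shape (spl l) = tower X m (length l)"
proof (induction l rule: spl.induct)
  case (3 l)
  have "map shape (map (\<lambda>j. pth (subst (j, t) l) (xs ! j)) [0..<m]) = replicate m (tower X m (length l))"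
    using 3 by (auto intro!: nth_equalityI simp: shape_pth)
  then show ?case by simp
qed (simp_all del: map_replicate add: shape_update)

lemma map_ptr: "map (map_option f) (ptr w) = ptr (map (\<lambda>(j, a). (j, f a)) w)"
  by (induction w) auto

lemma rigid_update_fill:
  assumes "a0 \<in> B" "j < m" "rigid B z F"
  shows "rigid B (apps ((replicate m (fill n))[j := z])) F"
  by (rule rigid_apps_single[where j = j])
    (use assms in \<open>simp_all add: nth_list_update forest.set_map image_subset_iff\<close>)

lemma tr_update_fill:
  assumes "s \<noteq> a0" "j < m" "s \<in> labels z"
  shows "tr s (apps ((replicate m (fill n))[j := z])) =
    replicate (j * nroots (tower X m n)) None @ tr s z"
proof -
  let ?zs = "(replicate m (fill n))[j := z]"
  have "tr s (apps ?zs) = replicate (j * nroots (tower X m n)) None @ tr s (?zs ! j)"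
    by (rule tr_apps) (use assms in \<open>auto simp: nth_list_update forest.set_map\<close>)
  then show ?thesis using assms by simp
qed

lemma in_labels_update: "j < m \<Longrightarrow> s \<in> labels z \<Longrightarrow> s \<in> labels (apps ((replicate m (fill n))[j := z]))"
  unfolding labels_apps by (rule UN_I[OF set_update_memI]) simp_all

lemma rigid_pth:
  assumes "a0 \<in> B" "set w \<subseteq> {..<m} \<times> B" "rigid B x (Tr v D Void)"
  shows "rigid B (pth w x) (Tr v D Void)"
  using assms(2)
proof (induction w)
  case (Cons p w)
  then show ?case using rigid_update_fill[OF assms(1), of "fst p" "pth w x" "Tr v D Void" "length w"]
    by (cases p) auto
qed (use assms in auto)

lemma labels_pth: "labels x \<subseteq> labels (pth w x)" if "set w \<subseteq> {..<m} \<times> B"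
  using that
proof (induction w)
  case (Cons p w)
  show ?case
  proof
    fix s assume "s \<in> labels x"
    then have "s \<in> labels (pth w x)" using Cons by auto
    then show "s \<in> labels (pth (p # w) x)"
      using in_labels_update[of "fst p" s "pth w x" "length w"] Cons(2) by (cases p) auto
  qed
qed auto

lemma labels_pth_sub: "labels (pth w x) \<subseteq> insert a0 (snd ` set w \<union> labels x)"
proof (induction w)
  case (Cons p w)
  obtain j a where p: "p = (j, a)" by fastforce
  have "set ((replicate m (fill (length w)))[j := pth w x]) \<subseteq> insert (pth w x) {fill (length w)}"
    using set_update_subset_insert[of "replicate m (fill (length w))" j "pth w x"] by auto
  moreover have "labels (fill (length w)) \<subseteq> {a0}" by (auto simp: forest.set_map)
  ultimately have "labels (apps ((replicate m (fill (length w)))[j := pth w x])) \<subseteq> labels (pth w x) \<union> {a0}"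
    unfolding labels_apps by blast
  then show ?case using Cons p by auto
qed auto

lemma tr_pth:
  assumes "set w \<subseteq> {..<m} \<times> B" "s \<notin> B" "s \<noteq> a0" "s \<in> labels x"
  shows "tr s (pth w x) = ptr w @ tr s x"
  using assms(1)
proof (induction w)
  case (Cons p w)
  obtain j a where p: "p = (j, a)" by fastforce
  have "s \<in> labels (pth w x)" using labels_pth[of w B x] Cons assms by auto
  then show ?case
    using Cons p assms in_labels_update[of j s "pth w x" "length w"] tr_update_fill[of s j "pth w x" "length w"]
    by auto
qed auto

lemma rigid_spl:
  assumes A: "a0 \<in> A" and l: "None \<in> set l" "set l \<subseteq> insert None (Some ` ({..<m} \<times> A))"
    and x: "length (trees C) = m" "\<forall>j<m. rigid (insert t A) (xs ! j) (trees C ! j)"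
  shows "rigid A (spl l) (Tr t C Void)"
  using l
proof (induction l rule: spl.induct)
  case (2 j a l)
  then show ?case using rigid_update_fill[OF A, of j "spl l" "Tr t C Void" "length l"] by auto
next
  case (3 l)
  have "list_all2 (rigid (insert t A)) (map (\<lambda>j. pth (subst (j, t) l) (xs ! j)) [0..<m]) (trees C)"
    unfolding list_all2_conv_all_nth
  proof (intro conjI allI impI)
    fix j assume "j < length (map (\<lambda>j. pth (subst (j, t) l) (xs ! j)) [0..<m])"
    then have j: "j < m" by simp
    obtain v D where vD: "trees C ! j = Tr v D Void" using trees_single[of "trees C ! j" C] x(1) j by auto
    have "set (subst (j, t) l) \<subseteq> {..<m} \<times> insert t A"
      using 3 j by (auto simp: subst_def split: option.splits)
    then show "rigid (insert t A) (map (\<lambda>j. pth (subst (j, t) l) (xs ! j)) [0..<m] ! j) (trees C ! j)"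
      using rigid_pth[of "insert t A" "subst (j, t) l" "xs ! j" v D] A x(2)[THEN spec, THEN mp, OF j] j vD by simp
  qed (use x in simp)
  from rigid_apps[OF this] show ?case by simp
qed auto

lemma tr_spl:
  assumes A: "a0 \<in> A" and l: "None \<in> set l" "set l \<subseteq> insert None (Some ` ({..<m} \<times> A))"
    and j: "j < m" "v \<in> labels (xs ! j)" "v \<notin> insert t A" "\<forall>i<m. i \<noteq> j \<longrightarrow> v \<notin> labels (xs ! i)"
    and X: "\<forall>i<m. shape (xs ! i) = X"
  shows "tr v (spl l) = ptr (subst (j, t) l) @ tr v (xs ! j) \<and> v \<in> labels (spl l)"
  using l
proof (induction l rule: spl.induct)
  case (2 i a l)
  have IH: "tr v (spl l) = ptr (subst (j, t) l) @ tr v (xs ! j)" "v \<in> labels (spl l)" using 2 by auto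
  have i: "i < m" "a \<in> A" using 2(3) by auto
  have "v \<noteq> a0" "v \<noteq> a" using A j(3) i by auto
  then show ?case
    using IH tr_update_fill[of v i "spl l" "length l"] in_labels_update[of i v "spl l" "length l"] i
    by (simp add: subst_def)
next
  case (3 l)
  let ?z = "\<lambda>i. pth (subst (i, t) l) (xs ! i)" and ?zs = "map (\<lambda>j. pth (subst (j, t) l) (xs ! j)) [0..<m]"
  have w: "set (subst (i, t) l) \<subseteq> {..<m} \<times> insert t A" if "i < m" for i
    using 3(2) that by (auto simp: subst_def split: option.splits)
  have va: "v \<noteq> a0" "v \<noteq> t" using A j(3) by auto
  have notin: "v \<notin> labels (?z i)" if "i < m" "i \<noteq> j" for i
  proof -
    have "snd ` set (subst (i, t) l) \<subseteq> insert t A" using w[OF that(1)] by auto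
    then show ?thesis using labels_pth_sub[of "subst (i, t) l" "xs ! i"] j(3,4) va that by blast
  qed
  have isin: "v \<in> labels (?z j)" using labels_pth[OF w[OF j(1)], of "xs ! j"] j(2) by auto
  have nr: "nroots (?z i) = nroots (tower X m (length l))" if "i < m" for i
    using shape_pth[of "xs ! i" "subst (i, t) l"] X that nroots_fmap[of "\<lambda>_. ()" "?z i"] by simp
  have "tr v (apps ?zs) = replicate (j * nroots (tower X m (length l))) None @ tr v (?zs ! j)"
    by (rule tr_apps) (use j(1) isin notin nr in auto)
  also have "tr v (?zs ! j) = ptr (subst (j, t) l) @ tr v (xs ! j)"
    using tr_pth[OF w[OF j(1)] j(3) va(1) j(2)] j(1) by simp
  finally have "tr v (apps ?zs) = replicate (j * nroots (tower X m (length l))) None @ ptr (subst (j, t) l) @ tr v (xs ! j)" .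
  moreover have "v \<in> labels (apps ?zs)" using isin j(1) by auto
  ultimately show ?case using va by (auto simp: subst_def)
qed auto

end

text \<open>A node of the \<open>j\<close>-th tree of \<open>C\<close> is reached by the word of a
  line at \<open>(j, t)\<close>, followed by a route in a copy of \<open>X\<close>. Homogeneity of
  \<open>X\<close> behind every word removes the constants on the second part; the line then removes
  the dependence on the label of \<open>t\<close>. The route to \<open>t\<close> itself carries only
  constants, which no assignment changes.\<close>

lemma trace_good_tree:
  assumes A: "finite A" "A \<noteq> {}" and t: "t \<notin> A" "t \<notin> labels C" and C: "fdist C" "labels C \<inter> A = {}"
    and IH: "\<And>b. \<exists>X. trace_good A b X C"
  shows "\<exists>H. trace_good A b H (Tr t C Void)"
proof -
  define m where "m = length (trees C)"
  let ?P = "{..<m} \<times> A"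
  \<comment> \<open>One line has to serve all nodes of \<open>C\<close>, hence a coordinate for each
    of them.\<close>
  obtain N where N: "hj ?P (b ^ card (labels C)) N" using hales_jewett[of ?P] A by blast
  let ?W = "{w. set w \<subseteq> ?P \<and> length w = N}"
  have W: "finite ?W" using A by (intro finite_lists_length_eq) auto
  obtain X where X: "trace_good A (b ^ card ?W) X C" using IH by blast
  obtain a0 where a0: "a0 \<in> A" using A by blast
  let ?f0 = "\<lambda>x. if x \<in> A then x else a0"
  let ?H = "tower X m N"
  have "trace_good A b ?H (Tr t C Void)" unfolding trace_good_def
  proof (intro allI impI)
    fix d :: "nat option list \<Rightarrow> nat" assume d: "\<forall>\<tau>. d \<tau> < b"
    obtain gX where gX: "shape gX = X" "rigid A gX C"
      "\<And>w. w \<in> ?W \<Longrightarrow> trace_homog A C (\<lambda>\<tau>. d (ptr X m w @ \<tau>)) gX"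
      by (rule trace_good_vec[OF X W, of "\<lambda>w \<tau>. d (ptr X m w @ \<tau>)"]) (use d in auto)
    let ?col = "\<lambda>v w. d (ptr X m w @ map (map_option ?f0) (tr v gX))"
    have "\<exists>l. line ?P N l \<and> (\<forall>v\<in>labels C. \<forall>p\<in>?P. \<forall>p'\<in>?P. ?col v (subst p l) = ?col v (subst p' l))"
      by (rule hj_vec[OF N finite_labels]) (use d in auto)
    then obtain l where l: "line ?P N l"
      "\<forall>v\<in>labels C. \<forall>p\<in>?P. \<forall>p'\<in>?P. ?col v (subst p l) = ?col v (subst p' l)" by blast
    have l': "None \<in> set l" "set l \<subseteq> insert None (Some ` ?P)" "length l = N"
      using l(1) by (auto simp: line_def)
    \<comment> \<open>Copy \<open>j\<close> serves the \<open>j\<close>-th tree of \<open>C\<close>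
      only: labels of the other trees collapse to the default constant, so each node of
      \<open>C\<close> is reached through exactly one block.\<close>
    define \<sigma> where "\<sigma> = (\<lambda>j x. if x \<in> A \<union> labels (trees C ! j) then x else a0)"
    define xs where "xs = map (\<lambda>j. fmap (\<sigma> j) gX) [0..<m]"
    have xs: "xs ! j = fmap (\<sigma> j) gX" if "j < m" for j using that by (simp add: xs_def)
    have \<sigma>fix: "fixing A (\<sigma> j)" for j by (simp add: \<sigma>_def)
    have rig: "rigid A (fmap (\<sigma> j) gX) (trees C ! j)" if "j < m" for j
    proof -
      have "rigid A (apps (map (fmap (\<sigma> j)) (trees C))) (trees C ! j)"
      proof (rule rigid_apps_single[where j = j])
        have "fmap (\<sigma> j) (trees C ! j) = trees C ! j"
          by (rule forest.map_ident_strong) (simp add: \<sigma>_def)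
        then show "rigid A (map (fmap (\<sigma> j)) (trees C) ! j) (trees C ! j)"
          using that rigid_refl by (simp add: m_def)
      next
        fix i assume i: "i < length (map (fmap (\<sigma> j)) (trees C))" "i \<noteq> j"
        have "\<sigma> j x \<in> A" if "x \<in> labels (trees C ! i)" for x
          using trees_disjoint[OF C(1), of i j] i \<open>j < m\<close> that a0 by (auto simp: \<sigma>_def m_def)
        then show "labels (map (fmap (\<sigma> j)) (trees C) ! i) \<subseteq> A" using i by (auto simp: forest.set_map)
      qed (use that in \<open>simp add: m_def\<close>)
      then have "rigid A (fmap (\<sigma> j) C) (trees C ! j)" using fmap_apps[of "\<sigma> j" "trees C"] by simp
      then show ?thesis using \<sigma>fix[of j] by (intro rigid_comp[OF gX(2)]) (auto simp del: fmap_fmap)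
    qed
    let ?g = "spl X m a0 t xs l"
    have rg: "rigid A ?g (Tr t C Void)"
    proof (rule rigid_spl[OF a0 l'(1,2)])
      show "\<forall>j<m. rigid (insert t A) (xs ! j) (trees C ! j)"
      proof (intro allI impI)
        fix j assume j: "j < m"
        show "rigid (insert t A) (xs ! j) (trees C ! j)"
          unfolding xs[OF j] by (rule rigid_mono[OF rig[OF j]]) auto
      qed
    qed (simp add: m_def)
    have sh: "shape ?g = ?H" using shape_spl[of l m xs X a0 t] l' xs gX(1) by simp
    have "trace_homog A (Tr t C Void) d ?g" unfolding trace_homog_def
    proof (intro ballI allI impI)
      fix v f f' assume v: "v \<in> labels (Tr t C Void)" and f: "fixing A f" "fixing A f'"
        and fA: "f ` labels (Tr t C Void) \<subseteq> A" "f' ` labels (Tr t C Void) \<subseteq> A"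
      show "d (map (map_option f) (tr v ?g)) = d (map (map_option f') (tr v ?g))"
      proof (cases "v = t")
        case True
        have inA: "x \<in> A" if "Some x \<in> set (tr t ?g)" for x
          using tr_rigid_subset[OF rg t(1) that] .
        have "map (map_option f) (tr v ?g) = map (map_option f') (tr v ?g)"
        proof (rule map_cong[OF refl])
          fix y assume y: "y \<in> set (tr v ?g)"
          show "map_option f y = map_option f' y"
          proof (cases y)
            case (Some x)
            then show ?thesis using y True f inA[of x] by simp
          qed simp
        qed
        then show ?thesis by (simp only:)
      next
        case False
        then have vC: "v \<in> labels C" using v by simp
        then obtain j where j: "j < m" "v \<in> labels (trees C ! j)"
          unfolding labels_trees[of C] by (auto simp: m_def in_set_conv_nth)
        have vA: "v \<notin> insert t A" using False vC C(2) by auto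
        have notin: "v \<notin> labels (xs ! i)" if "i < m" "i \<noteq> j" for i
          using rigid_labels[OF rig[OF that(1)]] trees_disjoint[OF C(1), of i j] that j vA xs[OF that(1)]
          by (auto simp: m_def)
        have vin: "v \<in> labels (xs ! j)" using rigid_labels_onto[OF rig[OF j(1)]] j xs by auto
        have tr1: "tr v ?g = ptr X m (subst (j, t) l) @ tr v (xs ! j)"
          using tr_spl[OF a0 l'(1,2) j(1) vin vA, of X] notin xs gX(1) by auto
        have \<sigma>v: "\<sigma> j v = v" using j by (simp add: \<sigma>_def)
        have "tr (\<sigma> j v) (fmap (\<sigma> j) gX) = map (map_option (\<sigma> j)) (tr v gX)"
          by (rule tr_fmap) (use \<sigma>v vA a0 in \<open>auto simp: \<sigma>_def\<close>)
        then have tr2: "tr v (xs ! j) = map (map_option (\<sigma> j)) (tr v gX)" using \<sigma>v xs[OF j(1)] by simp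
        have key: "d (map (map_option f) (tr v ?g)) = ?col v (subst (j, f t) l) \<and> f t \<in> A"
          if f: "fixing A f" "f ` labels (Tr t C Void) \<subseteq> A" for f
        proof -
          have ft: "f t \<in> A" using f by auto
          have "map (\<lambda>(j, a). (j, f a)) (subst (j, t) l) = subst (j, f t) l"
            using l'(2) f(1) by (auto simp: subst_def split: option.splits)
          then have e: "map (map_option f) (tr v ?g) =
              ptr X m (subst (j, f t) l) @ map (map_option (\<lambda>x. f (\<sigma> j x))) (tr v gX)"
            unfolding tr1 tr2 by (simp add: map_ptr option.map_comp comp_def)
          have W': "subst (j, f t) l \<in> ?W" using set_subst[OF l'(2), of "(j, f t)"] ft j l'(3) by auto
          have fs: "fixing A (\<lambda>x. f (\<sigma> j x))" using f(1) \<sigma>fix by simp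
          have "\<sigma> j x \<in> A \<union> labels C" for x
            using a0 labels_trees[of C] j(1) by (auto simp: \<sigma>_def m_def)
          then have fs': "(\<lambda>x. f (\<sigma> j x)) ` labels C \<subseteq> A" using f by force
          have "d (ptr X m (subst (j, f t) l) @ map (map_option (\<lambda>x. f (\<sigma> j x))) (tr v gX)) = ?col v (subst (j, f t) l)"
            by (rule trace_homogD[OF gX(3)[OF W'] vC fs _ fs']) (use a0 in auto)
          then show ?thesis using e ft by simp
        qed
        have "?col v (subst (j, f t) l) = ?col v (subst (j, f' t) l)"
          using l(2)[THEN bspec, OF vC, THEN bspec, THEN bspec, of "(j, f t)" "(j, f' t)"]
            key[OF f(1) fA(1)] key[OF f(2) fA(2)] j(1) by simp
        then show ?thesis using key[OF f(1) fA(1)] key[OF f(2) fA(2)] by simp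
      qed
    qed
    then show "\<exists>g. shape g = ?H \<and> rigid A g (Tr t C Void) \<and> trace_homog A (Tr t C Void) d g"
      using rg sh by blast
  qed
  then show ?thesis by blast
qed

theorem trace_good_exists:
  assumes A: "finite A" "A \<noteq> {}"
  shows "fdist G \<Longrightarrow> labels G \<inter> A = {} \<Longrightarrow> \<exists>H. trace_good A b H G"
proof (induction G arbitrary: b)
  case Void
  show ?case unfolding trace_good_def trace_homog_def by (intro exI[of _ Void] allI impI) auto
next
  case (Tr t C G)
  have dC: "labels C \<inter> A = {}" and dG: "labels G \<inter> A = {}" using Tr.prems(2) by auto
  have "\<exists>H. trace_good A b H (Tr t C Void)"
    by (rule trace_good_tree[OF A]) (use Tr.prems Tr.IH(1) dC in auto)
  then obtain H1 where H1: "trace_good A b H1 (Tr t C Void)" by blast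
  have "\<exists>H. trace_good A b H G" using Tr.IH(2)[OF _ dG, of b] Tr.prems(1) by simp
  then obtain H2 where H2: "trace_good A b H2 G" by blast
  let ?T = "Tr t C Void"
  have "trace_good A b (app H1 H2) (Tr t C G)" unfolding trace_good_def
  proof (intro allI impI)
    fix d :: "nat option list \<Rightarrow> nat" assume d: "\<forall>\<tau>. d \<tau> < b"
    obtain g1 where g1: "shape g1 = H1" "rigid A g1 ?T" "trace_homog A ?T d g1"
      by (rule trace_goodD[OF H1, of d]) (use d in auto)
    \<comment> \<open>A route to a node of \<open>G\<close> first passes all roots of
      \<open>g1\<close>; this fixed prefix is absorbed into the colouring for
      \<open>g2\<close>.\<close>
    let ?p = "replicate (nroots H1) None"
    obtain g2 where g2: "shape g2 = H2" "rigid A g2 G" "trace_homog A G (\<lambda>\<tau>. d (?p @ \<tau>)) g2"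
      by (rule trace_goodD[OF H2, of "\<lambda>\<tau>. d (?p @ \<tau>)"]) (use d in auto)
    have nr: "nroots g1 = nroots H1" using g1(1) by auto
    show "\<exists>g. shape g = app H1 H2 \<and> rigid A g (Tr t C G) \<and> trace_homog A (Tr t C G) d g"
    proof (intro exI[of _ "app g1 g2"] conjI)
      show "shape (app g1 g2) = app H1 H2" using g1 g2 by simp
      show "rigid A (app g1 g2) (Tr t C G)" using rigid_app[OF g1(2) g2(2)] by simp
      show "trace_homog A (Tr t C G) d (app g1 g2)" unfolding trace_homog_def
      proof (intro ballI allI impI)
        fix v f f' assume v: "v \<in> labels (Tr t C G)" and f: "fixing A f" "fixing A f'"
          and fA: "f ` labels (Tr t C G) \<subseteq> A" "f' ` labels (Tr t C G) \<subseteq> A"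
        show "d (map (map_option f) (tr v (app g1 g2))) = d (map (map_option f') (tr v (app g1 g2)))"
        proof (cases "v \<in> labels ?T")
          case True
          then have "v \<in> labels g1" using rigid_labels_onto[OF g1(2)] by blast
          then have "tr v (app g1 g2) = tr v g1" by (rule tr_app_left)
          then show ?thesis using trace_homogD[OF g1(3) True f] fA by auto
        next
          case False
          then have vG: "v \<in> labels G" using v by auto
          have "v \<notin> A" using vG dG by auto
          then have "v \<notin> labels g1" using rigid_labels[OF g1(2)] False by blast
          then have "tr v (app g1 g2) = ?p @ tr v g2" using tr_app_right nr by metis
          then show ?thesis using trace_homogD[OF g2(3) vG f] fA by auto
        qed
      qed
    qed
  qed
  then show ?case by blast
qed

subsection \<open>Colourings of nodes\<close>

text \<open>The recursion of \<open>rigid\<close> without labels: only the nodes that receive nodes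
  of the target are restricted, namely to colour \<open>i\<close>.\<close>

fun emb :: "nat \<Rightarrow> nat forest \<Rightarrow> 'x forest \<Rightarrow> bool" where
  "emb i Void Void \<longleftrightarrow> True"
| "emb i Void (Tr t D G) \<longleftrightarrow> False"
| "emb i (Tr k C K) Void \<longleftrightarrow> True"
| "emb i (Tr k C K) (Tr t D G) \<longleftrightarrow> emb i K (Tr t D G) \<or>
     emb i K G \<and> (k = i \<and> emb i C D \<or> emb i C (Tr t D Void))"

lemma emb_Void [simp]: "emb i \<kappa> Void"
  by (cases \<kappa>) auto

lemma emb_app_right: "emb i \<kappa>' F \<Longrightarrow> emb i (app \<kappa> \<kappa>') F"
  by (induction \<kappa>) (cases F; auto)+

lemma emb_app: "emb i \<kappa> F \<Longrightarrow> emb i \<kappa>' F' \<Longrightarrow> emb i (app \<kappa> \<kappa>') (app F F')"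
proof (induction i \<kappa> F rule: emb.induct)
  case (3 i k C K)
  then show ?case using emb_app_right[of i \<kappa>' F' "Tr k C K"] by simp
qed auto

lemma emb_app_left: "emb i \<kappa> F \<Longrightarrow> emb i (app \<kappa> \<kappa>') F"
  using emb_app[of i \<kappa> F \<kappa>' Void] by simp

lemma emb_shape: "emb i \<kappa> (shape F) \<longleftrightarrow> emb i \<kappa> F"
  by (induction i \<kappa> F rule: emb.induct) auto

lemma shape_app_split: "shape \<kappa> = app X Y \<Longrightarrow> \<exists>\<kappa>1 \<kappa>2. \<kappa> = app \<kappa>1 \<kappa>2 \<and> shape \<kappa>1 = X \<and> shape \<kappa>2 = Y"
proof (induction X arbitrary: \<kappa>)
  case Void
  then show ?case by (intro exI[of _ Void] exI[of _ \<kappa>]) auto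
next
  case (Tr x C G)
  then obtain k C' K where k: "\<kappa> = Tr k C' K" "shape C' = C" "shape K = app G Y" by (cases \<kappa>) auto
  obtain \<kappa>1 \<kappa>2 where "K = app \<kappa>1 \<kappa>2" "shape \<kappa>1 = G" "shape \<kappa>2 = Y" using Tr.IH(2)[OF k(3)] by blast
  then show ?case using k by (intro exI[of _ "Tr k C' \<kappa>1"] exI[of _ \<kappa>2]) auto
qed

definition node_good :: "nat \<Rightarrow> unit forest \<Rightarrow> (nat \<Rightarrow> unit forest) \<Rightarrow> bool" where
  "node_good b H F \<longleftrightarrow> (\<forall>\<kappa>. shape \<kappa> = H \<longrightarrow> labels \<kappa> \<subseteq> {..<b} \<longrightarrow> (\<exists>i<b. emb i \<kappa> (F i)))"

lemma node_goodD: "node_good b H F \<Longrightarrow> shape \<kappa> = H \<Longrightarrow> labels \<kappa> \<subseteq> {..<b} \<Longrightarrow> \<exists>i<b. emb i \<kappa> (F i)"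
  unfolding node_good_def by blast

text \<open>Which target is wanted will depend on a colour that is seen later, so one shape has to
  serve all of them. Concatenation does it, as each part may be ignored in favour of the
  others.\<close>

lemma node_good_all:
  fixes n :: nat
  assumes "\<And>i. i < n \<Longrightarrow> \<exists>X. node_good b X (F i)"
  shows "\<exists>X. \<forall>i<n. node_good b X (F i)"
  using assms
proof (induction n)
  case (Suc n)
  obtain X where X: "\<forall>i<n. node_good b X (F i)" using Suc by auto
  obtain Y where Y: "node_good b Y (F n)" using Suc by blast
  have 1: "node_good b (app X Y) G" if good: "node_good b X G" for G
    unfolding node_good_def
  proof (intro allI impI)
    fix \<kappa> :: "nat forest" assume k: "shape \<kappa> = app X Y" "labels \<kappa> \<subseteq> {..<b}"
    then obtain \<kappa>1 \<kappa>2 where "\<kappa> = app \<kappa>1 \<kappa>2" "shape \<kappa>1 = X" using shape_app_split by blast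
    moreover from this obtain i where "i < b" "emb i \<kappa>1 (G i)"
      using node_goodD[OF good, of \<kappa>1] k by auto
    ultimately show "\<exists>i<b. emb i \<kappa> (G i)" using emb_app_left by blast
  qed
  have 2: "node_good b (app X Y) G" if good: "node_good b Y G" for G
    unfolding node_good_def
  proof (intro allI impI)
    fix \<kappa> :: "nat forest" assume k: "shape \<kappa> = app X Y" "labels \<kappa> \<subseteq> {..<b}"
    then obtain \<kappa>1 \<kappa>2 where "\<kappa> = app \<kappa>1 \<kappa>2" "shape \<kappa>2 = Y" using shape_app_split by blast
    moreover from this obtain i where "i < b" "emb i \<kappa>2 (G i)"
      using node_goodD[OF good, of \<kappa>2] k by auto
    ultimately show "\<exists>i<b. emb i \<kappa> (G i)" using emb_app_right by blast
  qed
  have "node_good b (app X Y) (F i)" if "i < Suc n" for i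
  proof (cases "i = n")
    case True
    then show ?thesis using 2 Y by simp
  next
    case False
    then show ?thesis using 1 X that by simp
  qed
  then show ?case by blast
qed auto

text \<open>An asymmetric pigeonhole principle, one forest for each colour, is what makes the
  induction work; it is on the total size of these forests.\<close>

lemma node_good_exists:
  assumes "b > 0"
  shows "\<exists>H. node_good b H F"
proof (induction "\<Sum>i<b. size (F i)" arbitrary: F rule: less_induct)
  case less
  have smaller: "\<exists>H. node_good b H (F(i := D))" if i: "i < b" "size D < size (F i)" for i D
  proof (rule less)
    show "(\<Sum>j<b. size ((F(i := D)) j)) < (\<Sum>j<b. size (F j))"
      by (rule sum_strict_mono_ex1) (use i in auto)
  qed
  show ?case
  proof (cases "\<exists>i<b. F i = Void")
    case True
    then obtain i where "i < b" "F i = Void" by blast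
    then have "node_good b Void F" unfolding node_good_def using emb_Void by metis
    then show ?thesis by blast
  next
    case False
    then have "\<forall>i<b. \<exists>D R. F i = Tr () D R" by (metis forest.exhaust unit.exhaust)
    then obtain D R where F: "\<And>i. i < b \<Longrightarrow> F i = Tr () (D i) (R i)" by metis
    show ?thesis
    proof (cases "\<forall>i<b. R i = Void")
      case True
      \<comment> \<open>The colour \<open>k\<close> of the root is unknown when \<open>X\<close> is
        chosen. Above the root, either another colour succeeds with its full target, or
        \<open>k\<close> succeeds with \<open>D k\<close> and the root completes it.\<close>
      have "\<exists>X. \<forall>i<b. node_good b X (F(i := D i))"
        by (rule node_good_all, rule smaller) (use F in auto)
      then obtain X where X: "\<And>i. i < b \<Longrightarrow> node_good b X (F(i := D i))" by blast
      have "node_good b (Tr () X Void) F" unfolding node_good_def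
      proof (intro allI impI)
        fix \<kappa> :: "nat forest" assume k: "shape \<kappa> = Tr () X Void" "labels \<kappa> \<subseteq> {..<b}"
        then obtain k \<kappa>' K where "\<kappa> = Tr k \<kappa>' K" "shape \<kappa>' = X" "shape K = Void"
          by (cases \<kappa>) auto
        then have k': "\<kappa> = Tr k \<kappa>' Void" "shape \<kappa>' = X" by (cases K; simp)+
        then have kb: "k < b" "labels \<kappa>' \<subseteq> {..<b}" using k(2) by auto
        obtain j where j: "j < b" "emb j \<kappa>' ((F(k := D k)) j)"
          using node_goodD[OF X[OF kb(1)] k'(2) kb(2)] by blast
        have "emb j \<kappa> (F j)"
        proof (cases "j = k")
          case True
          then show ?thesis using j F[OF j(1)] k'(1) \<open>\<forall>i<b. R i = Void\<close> by simp
        next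
          case False
          then show ?thesis using j F[OF j(1)] k'(1) \<open>\<forall>i<b. R i = Void\<close> by simp
        qed
        then show "\<exists>i<b. emb i \<kappa> (F i)" using j(1) by blast
      qed
      then show ?thesis by blast
    next
      case False
      then obtain i0 where i0: "i0 < b" "R i0 \<noteq> Void" by blast
      \<comment> \<open>The left part looks for the first tree of a target. The colour
        \<open>j\<close> that succeeds there decides which target is shortened on the right, where
        \<open>j\<close> completes its target or another colour finds its own.\<close>
      let ?T = "\<lambda>i. Tr () (D i) Void"
      have "\<exists>X. node_good b X ?T"
      proof (rule less)
        have "size (R i0) > 0" using i0 by (cases "R i0") auto
        then show "(\<Sum>i<b. size (?T i)) < (\<Sum>i<b. size (F i))"
          by (intro sum_strict_mono_ex1) (use i0 F in \<open>auto intro!: bexI[of _ i0]\<close>)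
      qed
      then obtain X where X: "node_good b X ?T" by blast
      have "\<exists>Y. \<forall>i<b. node_good b Y (F(i := R i))"
        by (rule node_good_all, rule smaller) (use F in auto)
      then obtain Y where Y: "\<And>i. i < b \<Longrightarrow> node_good b Y (F(i := R i))" by blast
      have "node_good b (app X Y) F" unfolding node_good_def
      proof (intro allI impI)
        fix \<kappa> :: "nat forest" assume k: "shape \<kappa> = app X Y" "labels \<kappa> \<subseteq> {..<b}"
        then obtain \<kappa>1 \<kappa>2 where k': "\<kappa> = app \<kappa>1 \<kappa>2" "shape \<kappa>1 = X" "shape \<kappa>2 = Y"
          using shape_app_split by blast
        have kb: "labels \<kappa>1 \<subseteq> {..<b}" "labels \<kappa>2 \<subseteq> {..<b}" using k(2) k'(1) by auto
        obtain j where j: "j < b" "emb j \<kappa>1 (?T j)" using node_goodD[OF X k'(2) kb(1)] by blast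
        obtain i where i: "i < b" "emb i \<kappa>2 ((F(j := R j)) i)"
          using node_goodD[OF Y[OF j(1)] k'(3) kb(2)] by blast
        have "emb i \<kappa> (F i)"
        proof (cases "i = j")
          case True
          then show ?thesis using emb_app[OF j(2), of \<kappa>2 "R j"] i F[OF i(1)] k'(1) by simp
        next
          case False
          then show ?thesis using emb_app_right i k'(1) by simp
        qed
        then show "\<exists>i<b. emb i \<kappa> (F i)" using i(1) by blast
      qed
      then show ?thesis by blast
    qed
  qed
qed

text \<open>Nodes of the image receive labels of \<open>G\<close>, all others the default constant
  \<open>a\<close>. A node that can later carry a value outside \<open>A\<close> therefore has
  colour \<open>i\<close>.\<close>

lemma emb_rigid:
  fixes K :: "'x forest"
  assumes a: "a \<in> A"
  shows "fdist K \<Longrightarrow> emb i (fmap \<chi> K) G \<Longrightarrow>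
    \<exists>h. rigid A (fmap h K) G \<and> (\<forall>x\<in>labels K. h x \<in> A \<or> \<chi> x = i)"
proof (induction K arbitrary: G)
  case Void
  then show ?case by (cases G) auto
next
  case (Tr x C K)
  have glue: "fmap (\<lambda>z. if z = x then y else if z \<in> labels C then h1 z else h2 z) (Tr x C K) =
    Tr y (fmap h1 C) (fmap h2 K)" for y h1 h2
    using Tr.prems(1) by (auto intro!: forest.map_cong0)
  have mk: "\<exists>h. rigid A (fmap h (Tr x C K)) G \<and> (\<forall>z\<in>labels (Tr x C K). h z \<in> A \<or> \<chi> z = i)"
    if r: "rigid A (Tr y (fmap h1 C) (fmap h2 K)) G" and y: "y \<in> A \<or> \<chi> x = i"
      and h: "\<forall>z\<in>labels C. h1 z \<in> A \<or> \<chi> z = i" "\<forall>z\<in>labels K. h2 z \<in> A \<or> \<chi> z = i" for y h1 h2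
    by (rule exI[of _ "\<lambda>z. if z = x then y else if z \<in> labels C then h1 z else h2 z"], unfold glue)
      (use r y h in auto)
  have ca: "labels (fmap (\<lambda>_. a) M) \<subseteq> A" for M :: "'x forest" using a by (auto simp: forest.set_map)
  show ?case
  proof (cases G)
    case Void
    then show ?thesis using a ca[of C] ca[of K] by (intro mk[of a "\<lambda>_. a" "\<lambda>_. a"]) auto
  next
    case (Tr t D G')
    have "fdist C" "fdist K" using Tr.prems(1) by auto
    note IH = Tr.IH(1)[OF this(1)] Tr.IH(2)[OF this(2)]
    consider (1) "emb i (fmap \<chi> K) G"
      | (2) "emb i (fmap \<chi> K) G'" "\<chi> x = i" "emb i (fmap \<chi> C) D"
      | (3) "emb i (fmap \<chi> K) G'" "emb i (fmap \<chi> C) (Tr t D Void)"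
      using Tr.prems(2) Tr by auto
    then show ?thesis
    proof cases
      case 1
      obtain h where h: "rigid A (fmap h K) G" "\<forall>z\<in>labels K. h z \<in> A \<or> \<chi> z = i" using IH(2)[OF 1] by blast
      show ?thesis using a ca[of C] h Tr by (intro mk[of a "\<lambda>_. a" h]) auto
    next
      case 2
      obtain h2 where h2: "rigid A (fmap h2 K) G'" "\<forall>z\<in>labels K. h2 z \<in> A \<or> \<chi> z = i" using IH(2)[OF 2(1)] by blast
      obtain h1 where h1: "rigid A (fmap h1 C) D" "\<forall>z\<in>labels C. h1 z \<in> A \<or> \<chi> z = i" using IH(1)[OF 2(3)] by blast
      have "rigid (insert t A) (fmap h1 C) D" using h1(1) by (rule rigid_mono) auto
      then show ?thesis using h1 h2 2 Tr by (intro mk[of t h1 h2]) auto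
    next
      case 3
      obtain h2 where h2: "rigid A (fmap h2 K) G'" "\<forall>z\<in>labels K. h2 z \<in> A \<or> \<chi> z = i" using IH(2)[OF 3(1)] by blast
      obtain h1 where h1: "rigid A (fmap h1 C) (Tr t D Void)" "\<forall>z\<in>labels C. h1 z \<in> A \<or> \<chi> z = i" using IH(1)[OF 3(2)] by blast
      show ?thesis using a h1 h2 Tr by (intro mk[of a h1 h2]) auto
    qed
  qed
qed

subsection \<open>The Ramsey theorem for labelled forests\<close>

theorem ramsey_rigid:
  "finite A \<Longrightarrow> A \<noteq> {} \<Longrightarrow> fdist F \<Longrightarrow> labels F \<inter> A = {} \<Longrightarrow> ramsey A (both_rigid A F)"
proof (induction F arbitrary: A)
  case Void
  then show ?case by (intro ramsey_words)
next
  case (Tr s D F)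
  have s: "s \<notin> A" using Tr.prems by auto
  have RD: "ramsey (insert s A) (both_rigid (insert s A) D)"
    by (rule Tr.IH(1)) (use Tr.prems in auto)
  have RF: "ramsey A (both_rigid A F)" by (rule Tr.IH(2)) (use Tr.prems in auto)
  note A = Tr.prems(1,2)
  note Q = ramsey_same_trace[OF A s RD RF]
  let ?F = "Tr s D F"
  obtain a0 where a0: "a0 \<in> A" using A by blast
  have "\<exists>H. good A b H G (both_rigid A ?F)" if G: "fdist G" "labels G \<inter> A = {}" for b G
  proof (cases "b = 0")
    case True
    then show ?thesis unfolding good_def by auto
  next
    case False
    then have "b > 0" by simp
    \<comment> \<open>It is unknown which colour will succeed, so every colour has the target
      \<open>G\<close>.\<close>
    from node_good_exists[OF this] obtain H2 where H2: "node_good b H2 (\<lambda>_. shape G)" by blast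
    obtain G2 where G2: "shape G2 = H2" "fdist G2" "labels G2 \<inter> A = {}"
      using labelled_exists[OF A(1)] by blast
    obtain H1 where H1: "trace_good A b H1 G2" using trace_good_exists[OF A G2(2,3)] by blast
    obtain G1 where G1: "shape G1 = H1" "fdist G1" "labels G1 \<inter> A = {}"
      using labelled_exists[OF A(1)] by blast
    obtain H where H: "good A b H G1 (same_trace A s ?F)"
      using Q G1(2,3) unfolding ramsey_def by blast
    have "good A b H G (both_rigid A ?F)" unfolding good_def
    proof (intro allI impI)
      fix c :: "nat forest \<Rightarrow> nat" assume c: "\<forall>\<phi>. c \<phi> < b"
      obtain g1 where g1: "shape g1 = H" "rigid A g1 G1" "homog A G1 (same_trace A s ?F) c g1"
        by (rule goodD[OF H, of c]) (use c in auto)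
      define adm where "adm = (\<lambda>\<tau> f. fixing A f \<and> rigid A (fmap f G1) ?F \<and> tr s (fmap f G1) = \<tau>)"
      \<comment> \<open>By homogeneity any labelling with the given trace represents its colour. For
        lists that are not traces the choice is arbitrary, but the value stays below
        \<open>b\<close> because \<open>c\<close> is bounded everywhere.\<close>
      define d where "d = (\<lambda>\<tau>. c (fmap (SOME f. adm \<tau> f) g1))"
      have d: "c (fmap f g1) = d (tr s (fmap f G1))" if f: "fixing A f" "rigid A (fmap f G1) ?F" for f
      proof -
        let ?f = "SOME f'. adm (tr s (fmap f G1)) f'"
        have "adm (tr s (fmap f G1)) f" using f by (simp add: adm_def)
        then have "adm (tr s (fmap f G1)) ?f" by (rule someI[of "adm (tr s (fmap f G1))"])
        then have f': "fixing A ?f" "same_trace A s ?F (fmap f G1) (fmap ?f G1)"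
          using f by (auto simp: adm_def same_trace_def both_rigid_def)
        show ?thesis unfolding d_def by (rule homogD[OF g1(3) f(1) f'])
      qed
      obtain g2 where g2: "shape g2 = H1" "rigid A g2 G2" "trace_homog A G2 d g2"
        by (rule trace_goodD[OF H1, of d]) (use c in \<open>auto simp: d_def\<close>)
      let ?f0 = "\<lambda>x. if x \<in> A then x else a0"
      define \<chi> where "\<chi> = (\<lambda>v. d (map (map_option ?f0) (tr v g2)))"
      have "labels (fmap \<chi> G2) \<subseteq> {..<b}" using c by (auto simp: \<chi>_def d_def forest.set_map)
      moreover have "shape (fmap \<chi> G2) = H2" using G2 by simp
      ultimately obtain i where "emb i (fmap \<chi> G2) (shape G)" using node_goodD[OF H2] by blast
      then have "emb i (fmap \<chi> G2) G" by (simp add: emb_shape)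
      from emb_rigid[OF a0 G2(2) this]
      obtain h where h: "rigid A (fmap h G2) G" "\<forall>x\<in>labels G2. h x \<in> A \<or> \<chi> x = i" by blast
      define h3 where "h3 = (\<lambda>x. if x \<in> A then x else h x)"
      have h3: "fixing A h3" "rigid A (fmap h3 G2) G" "\<forall>x\<in>labels G2. h3 x \<in> A \<or> \<chi> x = i"
      proof -
        have "fmap h3 G2 = fmap h G2" using G2(3) by (intro forest.map_cong0) (auto simp: h3_def)
        then show "rigid A (fmap h3 G2) G" using h(1) by simp
      qed (use h(2) in \<open>auto simp: h3_def\<close>)
      define h2 where "h2 = relab A G1 g2"
      have h2: "fmap h2 G1 = g2" "fixing A h2"
        using relab[of G1 A g2] G1 g2(1) by (auto simp: h2_def)
      have r2: "rigid A (fmap h2 g1) G2"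
        by (rule rigid_comp[OF g1(2)]) (use h2 g2 in auto)
      have r3: "rigid A (fmap h3 (fmap h2 g1)) G"
        by (rule rigid_comp[OF r2 h3(2)]) (use h3(1) in auto)
      have col: "c (fmap f (fmap h3 (fmap h2 g1))) = i"
        if f: "fixing A f" "rigid A (fmap f G) ?F" for f
      proof -
        let ?k = "\<lambda>x. f (h3 x)"
        have k: "fixing A ?k" using f h3(1) by simp
        have kG2: "rigid A (fmap ?k G2) ?F"
          using rigid_comp[OF h3(2) f(2)] f(1) by auto
        have kg2: "fmap (\<lambda>x. ?k (h2 x)) G1 = fmap ?k g2" using h2(1) fmap_fmap[of ?k h2 G1] by simp
        have kG1: "rigid A (fmap (\<lambda>x. ?k (h2 x)) G1) ?F"
          unfolding kg2 by (rule rigid_comp[OF g2(2) kG2]) (use k in auto)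
        have kh: "fixing A (\<lambda>x. ?k (h2 x))" using k h2(2) by simp
        have cd: "c (fmap (\<lambda>x. ?k (h2 x)) g1) = d (tr s (fmap ?k g2))"
          using d[OF kh kG1] unfolding kg2 .
        have kA: "?k ` A \<subseteq> A" using k by auto
        obtain v where v: "v \<in> labels G2" "?k v = s"
          "tr s (fmap ?k g2) = map (map_option ?k) (tr v g2)"
          using tr_comp[OF g2(2) kG2 kA s] by blast
        \<comment> \<open>Homogeneity for traces concerns assignments into \<open>A\<close>, while
          \<open>?k\<close> also takes values in the target. The letters on the route to
          \<open>v\<close> are constants, so replacing other values by \<open>a0\<close> does not
          alter the trace.\<close>
        let ?k' = "\<lambda>x. if ?k x \<in> A then ?k x else a0"
        have "rigid A (fmap ?k g2) ?F" using kG1 unfolding kg2 .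
        from tr_rigid_subset[OF this s]
        have inA: "x \<in> A" if "Some x \<in> set (map (map_option ?k) (tr v g2))" for x
          using that unfolding v(3) by blast
        have "map (map_option ?k) (tr v g2) = map (map_option ?k') (tr v g2)"
        proof (rule map_cong[OF refl])
          fix y assume y: "y \<in> set (tr v g2)"
          show "map_option ?k y = map_option ?k' y"
          proof (cases y)
            case (Some x)
            have "Some (?k x) \<in> set (map (map_option ?k) (tr v g2))"
              using y Some by (metis image_eqI list.set_map option.simps(9))
            then show ?thesis using inA[of "?k x"] Some by simp
          qed simp
        qed
        moreover have "d (map (map_option ?k') (tr v g2)) = \<chi> v" unfolding \<chi>_def
          by (rule trace_homogD[OF g2(3) v(1)]) (use k a0 in auto)
        moreover have "\<chi> v = i"
        proof -
          have "h3 v \<notin> A" using v(2) f(1) s by auto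
          then show ?thesis using h3(3) v(1) by blast
        qed
        ultimately have "d (map (map_option ?k) (tr v g2)) = i" by (simp only:)
        then show ?thesis using v(3) cd by simp
      qed
      show "\<exists>g. shape g = H \<and> rigid A g G \<and> homog A G (both_rigid A ?F) c g"
      proof (intro exI[of _ "fmap h3 (fmap h2 g1)"] conjI)
        show "shape (fmap h3 (fmap h2 g1)) = H" using g1(1) by simp
        show "homog A G (both_rigid A ?F) c (fmap h3 (fmap h2 g1))"
          unfolding homog_def both_rigid_def using col by (intro allI impI) (simp del: fmap_fmap)
      qed (rule r3)
    qed
    then show ?thesis by blast
  qed
  then show ?case unfolding ramsey_def by blast
qed

subsection \<open>The orders of a forest\<close>

fun anc :: "'x forest \<Rightarrow> 'x \<Rightarrow> 'x \<Rightarrow> bool" where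
  "anc Void x y \<longleftrightarrow> False"
| "anc (Tr t C G) x y \<longleftrightarrow> x = t \<and> (y = t \<or> y \<in> labels C) \<or> anc C x y \<or> anc G x y"

text \<open>Strict depth-first order: a node, then everything above it, then the later siblings. For
  trees it is the strict part of \<open>lexle\<close>.\<close>

fun bef :: "'x forest \<Rightarrow> 'x \<Rightarrow> 'x \<Rightarrow> bool" where
  "bef Void x y \<longleftrightarrow> False"
| "bef (Tr t C G) x y \<longleftrightarrow> x = t \<and> (y \<in> labels C \<or> y \<in> labels G) \<or> bef C x y \<or>
     x \<in> labels C \<and> y \<in> labels G \<or> bef G x y"

lemma anc_labels: "anc G x y \<Longrightarrow> x \<in> labels G \<and> y \<in> labels G"
  by (induction G) auto

lemma bef_labels: "bef G x y \<Longrightarrow> x \<in> labels G \<and> y \<in> labels G"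
  by (induction G) auto

lemma anc_refl: "x \<in> labels G \<Longrightarrow> anc G x x"
  by (induction G) auto

lemma anc_left: "fdist (Tr t C G) \<Longrightarrow> y \<in> labels C \<Longrightarrow> anc (Tr t C G) x y \<longleftrightarrow> x = t \<or> anc C x y"
  using anc_labels[of G x y] by auto

lemma anc_right: "fdist (Tr t C G) \<Longrightarrow> y \<in> labels G \<Longrightarrow> anc (Tr t C G) x y \<longleftrightarrow> anc G x y"
  using anc_labels[of C x y] by auto

lemma anc_root: "fdist (Tr t C G) \<Longrightarrow> anc (Tr t C G) x t \<longleftrightarrow> x = t"
  using anc_labels[of C x t] anc_labels[of G x t] by auto

lemma bef_right: "fdist (Tr t C G) \<Longrightarrow> x \<in> labels G \<Longrightarrow> bef (Tr t C G) x y \<longleftrightarrow> bef G x y"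
  using bef_labels[of C x y] by auto

lemma bef_left: "fdist (Tr t C G) \<Longrightarrow> x \<in> labels C \<Longrightarrow>
    bef (Tr t C G) x y \<longleftrightarrow> bef C x y \<or> y \<in> labels G"
  using bef_labels[of G x y] by auto

lemma not_bef_root: "fdist (Tr t C G) \<Longrightarrow> \<not> bef (Tr t C G) x t"
  using bef_labels[of C x t] bef_labels[of G x t] by auto

lemma anc_antisym: "fdist G \<Longrightarrow> anc G x y \<Longrightarrow> anc G y x \<Longrightarrow> x = y"
proof (induction G)
  case (Tr t C G)
  have "x \<in> labels (Tr t C G)" using anc_labels[OF Tr.prems(2)] by blast
  then consider "x = t" | "x \<in> labels C" | "x \<in> labels G" by auto
  then show ?case
  proof cases
    case 1
    then show ?thesis using Tr.prems(2,3) anc_root[OF Tr.prems(1)] by metis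
  next
    case 2
    then have "y = t \<or> anc C y x" using Tr.prems anc_left[OF Tr.prems(1)] by blast
    then show ?thesis
    proof
      assume "y = t"
      then show ?thesis using Tr.prems(2,3) anc_root[OF Tr.prems(1)] by metis
    next
      assume y: "anc C y x"
      then have "y \<in> labels C" by (auto dest: anc_labels)
      then have "anc C x y" using Tr.prems 2 anc_left[OF Tr.prems(1), of y x] by auto
      then show ?thesis using Tr.IH(1) Tr.prems(1) y by simp
    qed
  next
    case 3
    then have y: "anc G y x" using Tr.prems anc_right[OF Tr.prems(1)] by blast
    then have "y \<in> labels G" by (auto dest: anc_labels)
    then have "anc G x y" using Tr.prems anc_right[OF Tr.prems(1)] by blast
    then show ?thesis using Tr.IH(2) Tr.prems(1) y by simp
  qed
qed auto

lemma anc_trans: "fdist G \<Longrightarrow> anc G x y \<Longrightarrow> anc G y z \<Longrightarrow> anc G x z"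
proof (induction G)
  case (Tr t C G)
  have "z \<in> labels (Tr t C G)" using anc_labels[OF Tr.prems(3)] by blast
  then consider "z = t" | "z \<in> labels C" | "z \<in> labels G" by auto
  then show ?case
  proof cases
    case 1
    then show ?thesis using Tr.prems(2,3) anc_root[OF Tr.prems(1)] by metis
  next
    case 2
    then have "y = t \<or> anc C y z" using Tr.prems anc_left[OF Tr.prems(1)] by blast
    then show ?thesis
    proof
      assume "y = t"
      then show ?thesis using Tr.prems(2,3) anc_root[OF Tr.prems(1)] by metis
    next
      assume y: "anc C y z"
      then have "y \<in> labels C" by (auto dest: anc_labels)
      then have "x = t \<or> anc C x y" using Tr.prems anc_left[OF Tr.prems(1)] by blast
      then show ?thesis using Tr.IH(1) Tr.prems(1) y 2 by auto
    qed
  next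
    case 3
    then have y: "anc G y z" using Tr.prems anc_right[OF Tr.prems(1)] by blast
    then have "y \<in> labels G" by (auto dest: anc_labels)
    then have "anc G x y" using Tr.prems anc_right[OF Tr.prems(1)] by blast
    then show ?thesis using Tr.IH(2) Tr.prems(1) y by simp
  qed
qed auto

lemma anc_chain: "fdist G \<Longrightarrow> anc G x z \<Longrightarrow> anc G y z \<Longrightarrow> anc G x y \<or> anc G y x"
proof (induction G)
  case (Tr t C G)
  have "z \<in> labels (Tr t C G)" using anc_labels[OF Tr.prems(3)] by blast
  then consider "z = t" | "z \<in> labels C" | "z \<in> labels G" by auto
  then show ?case
  proof cases
    case 1
    then show ?thesis using Tr.prems(2,3) anc_root[OF Tr.prems(1)] by metis
  next
    case 2
    then have *: "y = t \<or> anc C y z" "x = t \<or> anc C x z"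
      using Tr.prems anc_left[OF Tr.prems(1)] by blast+
    then show ?thesis using Tr.IH(1) Tr.prems(1) anc_labels[of C] by auto
  next
    case 3
    then have *: "anc G y z" "anc G x z" using Tr.prems anc_right[OF Tr.prems(1)] by blast+
    then show ?thesis using Tr.IH(2) Tr.prems(1) by auto
  qed
qed auto

lemma bef_total: "x \<in> labels G \<Longrightarrow> y \<in> labels G \<Longrightarrow> x = y \<or> bef G x y \<or> bef G y x"
  by (induction G) auto

lemma bef_asym: "fdist G \<Longrightarrow> bef G x y \<Longrightarrow> \<not> bef G y x"
proof (induction G)
  case (Tr t C G)
  have sub: "x \<in> labels M \<and> y \<in> labels M" if "bef M x y \<or> bef M y x" for M
    using that by (auto dest: bef_labels)
  show ?case using Tr sub[of C] sub[of G] by auto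
qed auto

lemma bef_trans: "fdist G \<Longrightarrow> bef G x y \<Longrightarrow> bef G y z \<Longrightarrow> bef G x z"
proof (induction G)
  case (Tr t C G)
  have "x \<in> labels (Tr t C G)" using bef_labels[OF Tr.prems(2)] by blast
  then consider "x = t" | "x \<in> labels C" | "x \<in> labels G" by auto
  then show ?case
  proof cases
    case 1
    have "z \<in> labels (Tr t C G)" using bef_labels[OF Tr.prems(3)] by blast
    moreover have "z \<noteq> t" using Tr.prems(3) not_bef_root[OF Tr.prems(1)] by metis
    ultimately show ?thesis using 1 by auto
  next
    case 2
    then have "bef C x y \<or> y \<in> labels G" using bef_left[OF Tr.prems(1)] Tr.prems by blast
    then show ?thesis
    proof
      assume y: "bef C x y"
      then have "y \<in> labels C" by (auto dest: bef_labels)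
      then have "bef C y z \<or> z \<in> labels G" using bef_left[OF Tr.prems(1)] Tr.prems by blast
      then show ?thesis using 2 y Tr.IH(1) Tr.prems(1) by auto
    next
      assume "y \<in> labels G"
      then have "bef G y z" using bef_right[OF Tr.prems(1)] Tr.prems by blast
      then show ?thesis using 2 bef_labels[of G y z] by auto
    qed
  next
    case 3
    then have y: "bef G x y" using bef_right[OF Tr.prems(1)] Tr.prems by blast
    then have "y \<in> labels G" by (auto dest: bef_labels)
    then have "bef G y z" using bef_right[OF Tr.prems(1)] Tr.prems by blast
    then show ?thesis using y Tr.IH(2) Tr.prems(1) by auto
  qed
qed auto

lemma anc_imp_bef: "fdist G \<Longrightarrow> anc G x y \<Longrightarrow> x = y \<or> bef G x y"
  by (induction G) auto

text \<open>Allows incomparable nodes to be compared through the successors of their meet that lie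
  below them.\<close>

lemma bef_cones:
  "fdist G \<Longrightarrow> bef G p q \<Longrightarrow> \<not> anc G p q \<Longrightarrow> anc G p x \<Longrightarrow> anc G q y \<Longrightarrow> bef G x y"
proof (induction G)
  case (Tr t C G)
  have "p \<in> labels (Tr t C G)" using bef_labels[OF Tr.prems(2)] by blast
  then consider "p = t" | "p \<in> labels C" | "p \<in> labels G" by auto
  then show ?case
  proof cases
    case 1
    then have "q \<in> labels G" using Tr.prems(2,3) bef_labels[of C p q] bef_labels[of G p q] by auto
    moreover have "y \<in> labels G" using calculation Tr.prems(1,5) anc_labels[of C q y] anc_labels[of G q y] by auto
    moreover have "x = t \<or> x \<in> labels C" using 1 Tr.prems(1,4) anc_labels[of C p x] anc_labels[of G p x] by auto
    ultimately show ?thesis by auto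
  next
    case 2
    have px: "anc C p x" using 2 Tr.prems(1,4) anc_labels[of G p x] by auto
    have "bef C p q \<or> q \<in> labels G" using bef_left[OF Tr.prems(1) 2] Tr.prems by blast
    then show ?thesis
    proof
      assume q: "bef C p q"
      then have qC: "q \<in> labels C" by (auto dest: bef_labels)
      have "anc C q y" using qC Tr.prems(1,5) anc_labels[of G q y] by auto
      moreover have "\<not> anc C p q" using Tr.prems(3) by auto
      ultimately show ?thesis using Tr.IH(1) Tr.prems(1) px q by auto
    next
      assume q: "q \<in> labels G"
      have "anc G q y" using q Tr.prems(1,5) anc_labels[of C q y] by auto
      then show ?thesis using px anc_labels[of C p x] anc_labels[of G q y] by auto
    qed
  next
    case 3
    have q: "bef G p q" using bef_right[OF Tr.prems(1) 3] Tr.prems by blast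
    then have qG: "q \<in> labels G" by (auto dest: bef_labels)
    have "anc G q y" using qG Tr.prems(1,5) anc_labels[of C q y] by auto
    moreover have "anc G p x" using 3 Tr.prems(1,4) anc_labels[of C p x] by auto
    moreover have "\<not> anc G p q" using Tr.prems(3) by auto
    ultimately show ?thesis using Tr.IH(2) Tr.prems(1) q by auto
  qed
qed auto

text \<open>\<open>e\<close> is the embedding that witnesses rigidity. Condition three says that \<open>e\<close> preserves
  meets; for roots of different trees of a forest, that their images have no common ancestor.\<close>

definition connects :: "'x set \<Rightarrow> 'y forest \<Rightarrow> 'x forest \<Rightarrow> ('x \<Rightarrow> 'y) \<Rightarrow> ('y \<Rightarrow> 'x) \<Rightarrow> bool" where
  "connects A G F e f \<longleftrightarrow> (\<forall>s\<in>labels F. e s \<in> labels G \<and> f (e s) = s) \<and>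
     (\<forall>y s. anc F y s \<longrightarrow> anc G (e y) (e s)) \<and>
     (\<forall>s\<in>labels F. \<forall>s'\<in>labels F. \<forall>x. anc G x (e s) \<longrightarrow> anc G x (e s') \<longrightarrow>
        (\<exists>y. anc F y s \<and> anc F y s' \<and> anc G x (e y))) \<and>
     (\<forall>s s'. bef F s s' \<longrightarrow> bef G (e s) (e s')) \<and>
     (\<forall>w\<in>labels G. f w \<in> A \<or> f w \<in> labels F \<and> anc G (e (f w)) w)"

lemma connectsD:
  assumes "connects A G F e f"
  shows "s \<in> labels F \<Longrightarrow> e s \<in> labels G" "s \<in> labels F \<Longrightarrow> f (e s) = s"
    "anc F y s \<Longrightarrow> anc G (e y) (e s)"
    "s \<in> labels F \<Longrightarrow> s' \<in> labels F \<Longrightarrow> anc G x (e s) \<Longrightarrow> anc G x (e s') \<Longrightarrow>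
      \<exists>y. anc F y s \<and> anc F y s' \<and> anc G x (e y)"
    "bef F s s' \<Longrightarrow> bef G (e s) (e s')"
    "w \<in> labels G \<Longrightarrow> f w \<in> A \<or> f w \<in> labels F \<and> anc G (e (f w)) w"
  using assms unfolding connects_def by blast+

lemma connectsI:
  assumes "\<And>s. s \<in> labels F \<Longrightarrow> e s \<in> labels G" "\<And>s. s \<in> labels F \<Longrightarrow> f (e s) = s"
    "\<And>y s. anc F y s \<Longrightarrow> anc G (e y) (e s)"
    "\<And>s s' x. s \<in> labels F \<Longrightarrow> s' \<in> labels F \<Longrightarrow> anc G x (e s) \<Longrightarrow> anc G x (e s') \<Longrightarrow>
      \<exists>y. anc F y s \<and> anc F y s' \<and> anc G x (e y)"
    "\<And>s s'. bef F s s' \<Longrightarrow> bef G (e s) (e s')"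
    "\<And>w. w \<in> labels G \<Longrightarrow> f w \<in> A \<or> f w \<in> labels F \<and> anc G (e (f w)) w"
  shows "connects A G F e f"
  using assms unfolding connects_def by blast

section \<open>Witnessing embeddings and the recursive description\<close>

lemma anc_split: "anc (Tr t C G) x y \<longleftrightarrow> anc (Tr t C Void) x y \<or> anc G x y"
  by auto

lemma bef_split: "bef (Tr t C G) x y \<longleftrightarrow> bef (Tr t C Void) x y \<or>
    x \<in> labels (Tr t C Void) \<and> y \<in> labels G \<or> bef G x y"
  by auto

lemma anc_from_left: "fdist (Tr t C G) \<Longrightarrow> x \<in> labels C \<Longrightarrow> anc (Tr t C G) x y \<Longrightarrow> anc C x y"
  using anc_labels[of G x y] by auto

lemma anc_from_right: "fdist (Tr t C G) \<Longrightarrow> x \<in> labels G \<Longrightarrow> anc (Tr t C G) x y \<Longrightarrow> anc G x y"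
  using anc_labels[of C x y] by auto

text \<open>If \<open>e s\<close> is in the first tree, a node of a later tree of \<open>F\<close>
  sent there as well would share the ancestor \<open>t\<close> with \<open>e s\<close>. The
  condition on common ancestors would then give a common ancestor in \<open>F\<close> of nodes from
  different trees.\<close>

lemma connects_rigid_right:
  assumes dG: "fdist (Tr t C G)" and dF: "fdist (Tr s D F)" and c: "connects A (Tr t C G) (Tr s D F) e f"
    and es: "e s = t \<or> e s \<in> labels C"
  shows "connects A G F e f \<and> (\<forall>z\<in>insert s (labels D). e z \<in> insert t (labels C))"
proof -
  let ?G = "Tr t C G" and ?F = "Tr s D F"
  note c = connectsD[OF c]
  have left: "e z \<in> insert t (labels C)" if z: "z \<in> insert s (labels D)" for z
  proof -
    have "anc ?F s z" using z by auto
    then have "anc ?G (e s) (e z)" by (rule c(3))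
    then show ?thesis using es
      anc_from_left[OF dG, of "e s" "e z"] anc_labels[of C "e s" "e z"] anc_labels[of G "e s" "e z"] dG by auto
  qed
  have right: "e z \<in> labels G" if z: "z \<in> labels F" for z
  proof (rule ccontr)
    assume n: "e z \<notin> labels G"
    have "e z \<in> labels ?G" using c(1)[of z] z by simp
    then have "anc ?G t (e z)" "anc ?G t (e s)" using n es by auto
    then obtain y where y: "anc ?F y s" "anc ?F y z" using c(4)[of s z t] z by auto
    have "y = s" using y(1) anc_root[OF dF] by simp
    then have "anc F s z" using y(2) anc_right[OF dF z] by metis
    then show False using anc_labels[of F s z] dF by simp
  qed
  have "connects A G F e f"
  proof (rule connectsI)
    fix z assume "z \<in> labels F"
    then show "e z \<in> labels G" "f (e z) = z" using right c(2)[of z] by auto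
  next
    fix y z assume "anc F y z"
    moreover from this have "z \<in> labels F" by (auto dest: anc_labels)
    ultimately show "anc G (e y) (e z)" using c(3)[of y z] anc_right[OF dG right[of z]] by simp
  next
    fix z z' x assume z: "z \<in> labels F" "z' \<in> labels F" and x: "anc G x (e z)" "anc G x (e z')"
    then obtain y where y: "anc ?F y z" "anc ?F y z'" "anc ?G x (e y)" using c(4)[of z z' x] by auto
    then have "anc F y z" "anc F y z'" using anc_right[OF dF z(1)] anc_right[OF dF z(2)] by auto
    moreover from this have "y \<in> labels F" by (auto dest: anc_labels)
    then have "anc G x (e y)" using y(3) anc_right[OF dG right[of y]] by simp
    ultimately show "\<exists>y. anc F y z \<and> anc F y z' \<and> anc G x (e y)" by blast
  next
    fix z z' assume "bef F z z'"
    moreover from this have "z \<in> labels F" by (auto dest: bef_labels)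
    ultimately show "bef G (e z) (e z')" using c(5)[of z z'] bef_right[OF dG right[of z]] by simp
  next
    fix w assume w: "w \<in> labels G"
    then consider "f w \<in> A" | "f w \<in> labels ?F" "anc ?G (e (f w)) w" using c(6)[of w] by auto
    then show "f w \<in> A \<or> f w \<in> labels F \<and> anc G (e (f w)) w"
    proof cases
      case 2
      then have a: "anc G (e (f w)) w" using anc_right[OF dG w] by blast
      then have "e (f w) \<in> labels G" by (auto dest: anc_labels)
      then have "e (f w) \<notin> insert t (labels C)" using dG by auto
      then have "f w \<notin> insert s (labels D)" using left by blast
      then show ?thesis using a 2 by auto
    qed auto
  qed
  then show ?thesis using left by blast
qed

text \<open>The three places of \<open>e s\<close>, at \<open>t\<close>, above \<open>t\<close> or
  in a later tree, correspond to the disjuncts of \<open>rigid\<close>; in each case the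
  restrictions of \<open>e\<close> are again witnesses.\<close>

lemma connects_rigid:
  "fdist G \<Longrightarrow> fdist F \<Longrightarrow> labels F \<inter> A = {} \<Longrightarrow> connects A G F e f \<Longrightarrow> rigid A (fmap f G) F"
proof (induction G arbitrary: A F)
  case Void
  then show ?case using connectsD(1)[OF Void.prems(4)] by (cases F) auto
next
  case (Tr t C G)
  let ?G = "Tr t C G"
  note dG = Tr.prems(1) and dF = Tr.prems(2) and c = connectsD[OF Tr.prems(4)]
  show ?case
  proof (cases F)
    case Void
    have "f w \<in> A" if "w \<in> labels ?G" for w using c(6)[OF that] Void by simp
    then show ?thesis using Void by (auto simp: forest.set_map)
  next
    case F: (Tr s D F')
    have dF': "fdist (Tr s D F')" using dF F by simp
    have sA: "s \<notin> A" and dA: "labels D \<inter> A = {}" "labels F' \<inter> A = {}" using Tr.prems(3) F by auto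
    have "e s \<in> labels ?G" using c(1)[of s] F by simp
    then consider (root) "e s = t" | (left) "e s \<in> labels C" | (right) "e s \<in> labels G" by auto
    then show ?thesis
    proof cases
      case right
      \<comment> \<open>In the depth-first order \<open>s\<close> comes first, so every other node
        of \<open>F\<close> is sent behind \<open>e s\<close> and hence into \<open>G\<close> as
        well.\<close>
      have all: "e z \<in> labels G" if z: "z \<in> labels F" for z
      proof (cases "z = s")
        case False
        then have "bef F s z" using z F by simp
        then have "bef G (e s) (e z)" using c(5)[of s z] bef_right[OF dG right] by simp
        then show ?thesis by (auto dest: bef_labels)
      qed (use right in simp)
      have "connects A G F e f"
      proof (rule connectsI)
        fix z assume "z \<in> labels F"
        then show "e z \<in> labels G" "f (e z) = z" using all c(2)[of z] by auto
      next
        fix y z assume "anc F y z"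
        moreover from this have "z \<in> labels F" by (auto dest: anc_labels)
        ultimately show "anc G (e y) (e z)" using c(3)[of y z] anc_right[OF dG all[of z]] by simp
      next
        fix z z' x assume z: "z \<in> labels F" "z' \<in> labels F" and x: "anc G x (e z)" "anc G x (e z')"
        then obtain y where y: "anc F y z" "anc F y z'" "anc ?G x (e y)" using c(4)[of z z' x] by auto
        moreover from this have "y \<in> labels F" by (auto dest: anc_labels)
        then have "anc G x (e y)" using y(3) anc_right[OF dG all[of y]] by simp
        ultimately show "\<exists>y. anc F y z \<and> anc F y z' \<and> anc G x (e y)" by blast
      next
        fix z z' assume "bef F z z'"
        moreover from this have "z \<in> labels F" by (auto dest: bef_labels)
        ultimately show "bef G (e z) (e z')" using c(5)[of z z'] bef_right[OF dG all[of z]] by simp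
      next
        fix w assume w: "w \<in> labels G"
        then show "f w \<in> A \<or> f w \<in> labels F \<and> anc G (e (f w)) w"
          using c(6)[of w] anc_right[OF dG w] by auto
      qed
      then have "rigid A (fmap f G) F" using Tr.IH(2) dG dF Tr.prems(3) by simp
      moreover have "f w \<in> A" if w: "w \<in> insert t (labels C)" for w
      proof (rule ccontr)
        assume "f w \<notin> A"
        then have "f w \<in> labels F" "anc ?G (e (f w)) w" using c(6)[of w] w by auto
        then have "anc G (e (f w)) w" using anc_from_right[OF dG all] by blast
        then have "w \<in> labels G" by (auto dest: anc_labels)
        then show False using w dG by auto
      qed
      ultimately show ?thesis using F by (auto simp: forest.set_map)
    next
      case root
      have cr: "connects A G F' e f" "\<forall>z\<in>insert s (labels D). e z \<in> insert t (labels C)"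
        using connects_rigid_right[OF dG dF', of A e f] Tr.prems(4) F root by auto
      have eD: "e z \<in> labels C" if z: "z \<in> labels D" for z
      proof -
        have "f (e z) = z" "f (e s) = s" using c(2)[of z] c(2)[of s] z F by auto
        moreover have "z \<noteq> s" using z dF' by auto
        ultimately have "e z \<noteq> t" using root by auto
        then show ?thesis using cr(2) z by blast
      qed
      have ft: "f t = s" using c(2)[of s] root F by simp
      have tC: "t \<notin> labels C" using dG by simp
      have "connects (insert s A) C D e f"
      proof (rule connectsI)
        fix z assume "z \<in> labels D"
        then show "e z \<in> labels C" "f (e z) = z" using eD c(2)[of z] F by auto
      next
        fix y z assume yz: "anc D y z"
        then have l: "z \<in> labels D" "y \<in> labels D" by (auto dest: anc_labels)
        have "anc ?G (e y) (e z)" using c(3)[of y z] yz F by simp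
        then show "anc C (e y) (e z)" using anc_from_left[OF dG eD[OF l(2)]] by blast
      next
        fix z z' x assume z: "z \<in> labels D" "z' \<in> labels D" and x: "anc C x (e z)" "anc C x (e z')"
        then obtain y where y: "anc F y z" "anc F y z'" "anc ?G x (e y)" using c(4)[of z z' x] F by auto
        have xC: "x \<in> labels C" using x(1) by (auto dest: anc_labels)
        then have "y \<noteq> s" using y(3) anc_root[OF dG, of x] root tC by auto
        then have "anc D y z" "anc D y z'" using y(1,2) anc_left[OF dF' z(1)] anc_left[OF dF' z(2)] F by auto
        moreover have "anc C x (e y)" using anc_from_left[OF dG xC y(3)] .
        ultimately show "\<exists>y. anc D y z \<and> anc D y z' \<and> anc C x (e y)" by blast
      next
        fix z z' assume zz: "bef D z z'"
        then have l: "z \<in> labels D" "z' \<in> labels D" by (auto dest: bef_labels)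
        have "bef ?G (e z) (e z')" using c(5)[of z z'] zz F by simp
        then show "bef C (e z) (e z')" using bef_left[OF dG eD[OF l(1)]] eD[OF l(2)] dG by auto
      next
        fix w assume w: "w \<in> labels C"
        then consider "f w \<in> A" | "f w = s" | "f w \<in> labels D" "anc ?G (e (f w)) w"
          | "f w \<in> labels F'" "anc ?G (e (f w)) w" using c(6)[of w] F by auto
        then show "f w \<in> insert s A \<or> f w \<in> labels D \<and> anc C (e (f w)) w"
        proof cases
          case 3
          then show ?thesis using anc_from_left[OF dG eD] by blast
        next
          case 4
          then have "anc G (e (f w)) w" using anc_from_right[OF dG] connectsD(1)[OF cr(1)] by blast
          then have "w \<in> labels G" by (auto dest: anc_labels)
          then show ?thesis using w dG by auto
        qed auto
      qed
      then have "rigid (insert s A) (fmap f C) D" using Tr.IH(1)[of D "insert s A"] dG dF' dA by auto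
      moreover have "rigid A (fmap f G) F'" using Tr.IH(2)[of F' A] cr(1) dG dF' dA by auto
      ultimately show ?thesis using F ft by auto
    next
      case left
      have cr: "connects A G F' e f" "\<forall>z\<in>insert s (labels D). e z \<in> insert t (labels C)"
        using connects_rigid_right[OF dG dF', of A e f] Tr.prems(4) F left by auto
      let ?S = "Tr s D Void"
      have tC: "t \<notin> labels C" using dG by simp
      have eS: "e z \<in> labels C" if z: "z \<in> labels ?S" for z
      proof -
        have "anc F s z" using z F by auto
        then have "anc C (e s) (e z)" using anc_from_left[OF dG left] c(3)[of s z] by blast
        then show ?thesis by (auto dest: anc_labels)
      qed
      have ft: "f t \<in> A"
      proof (rule ccontr)
        assume "f t \<notin> A"
        then have "f t \<in> labels F" "anc ?G (e (f t)) t" using c(6)[of t] by auto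
        then have "e (f t) = t" using anc_root[OF dG] by blast
        then have "f t \<notin> labels ?S" using eS tC by metis
        then have "f t \<in> labels F'" using \<open>f t \<in> labels F\<close> F by auto
        then have "t \<in> labels G" using connectsD(1)[OF cr(1)] \<open>e (f t) = t\<close> by metis
        then show False using dG by simp
      qed
      have ancS: "anc ?S y z" if "anc F y z" "z \<in> labels ?S" for y z
      proof -
        have "z \<notin> labels F'" using that(2) dF' by auto
        then have "\<not> anc F' y z" by (auto dest: anc_labels)
        then show ?thesis using that(1) F anc_split[of s D F' y z] by blast
      qed
      have "connects A C ?S e f"
      proof (rule connectsI)
        fix z assume "z \<in> labels ?S"
        then show "e z \<in> labels C" "f (e z) = z" using eS c(2)[of z] F by auto
      next
        fix y z assume yz: "anc ?S y z"
        then have l: "y \<in> labels ?S" by (auto dest: anc_labels)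
        have "anc F y z" using yz F by auto
        then have "anc ?G (e y) (e z)" by (rule c(3))
        then show "anc C (e y) (e z)" using anc_from_left[OF dG eS[OF l]] by blast
      next
        fix z z' x assume z: "z \<in> labels ?S" "z' \<in> labels ?S" and x: "anc C x (e z)" "anc C x (e z')"
        then obtain y where y: "anc F y z" "anc F y z'" "anc ?G x (e y)" using c(4)[of z z' x] F by auto
        have xC: "x \<in> labels C" using x(1) by (auto dest: anc_labels)
        have "anc C x (e y)" using anc_from_left[OF dG xC y(3)] .
        then show "\<exists>y. anc ?S y z \<and> anc ?S y z' \<and> anc C x (e y)" using ancS y(1,2) z by blast
      next
        fix z z' assume zz: "bef ?S z z'"
        then have l: "z \<in> labels ?S" "z' \<in> labels ?S" using bef_labels[OF zz] by auto
        have "bef F z z'" using zz F by auto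
        then have "bef ?G (e z) (e z')" by (rule c(5))
        then show "bef C (e z) (e z')" using bef_left[OF dG eS[OF l(1)]] eS[OF l(2)] dG by auto
      next
        fix w assume w: "w \<in> labels C"
        then consider "f w \<in> A" | "f w \<in> labels ?S" "anc ?G (e (f w)) w"
          | "f w \<in> labels F'" "anc ?G (e (f w)) w" using c(6)[of w] F by auto
        then show "f w \<in> A \<or> f w \<in> labels ?S \<and> anc C (e (f w)) w"
        proof cases
          case 2
          then show ?thesis using anc_from_left[OF dG eS] by blast
        next
          case 3
          then have "anc G (e (f w)) w" using anc_from_right[OF dG] connectsD(1)[OF cr(1)] by blast
          then have "w \<in> labels G" by (auto dest: anc_labels)
          then show ?thesis using w dG by auto
        qed auto
      qed
      then have "rigid A (fmap f C) ?S" using Tr.IH(1)[of ?S A] dG dF' dA sA by auto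
      moreover have "rigid A (fmap f G) F'" using Tr.IH(2)[of F' A] cr(1) dG dF' dA by auto
      ultimately show ?thesis using F ft by auto
    qed
  qed
qed

lemma connects_skip:
  assumes dG: "fdist (Tr t C G)" and c: "connects A G F e f" and "f ` insert t (labels C) \<subseteq> A"
  shows "connects A (Tr t C G) F e f"
proof (rule connectsI)
  note c = connectsD[OF c]
  fix s s' x assume s: "s \<in> labels F" "s' \<in> labels F" and x: "anc (Tr t C G) x (e s)" "anc (Tr t C G) x (e s')"
  have "anc G x (e s)" "anc G x (e s')"
    using x anc_right[OF dG c(1)[OF s(1)]] anc_right[OF dG c(1)[OF s(2)]] by auto
  then show "\<exists>y. anc F y s \<and> anc F y s' \<and> anc (Tr t C G) x (e y)" using c(4)[OF s] by auto
next
  fix w assume w: "w \<in> labels (Tr t C G)"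
  show "f w \<in> A \<or> f w \<in> labels F \<and> anc (Tr t C G) (e (f w)) w"
  proof (cases "w \<in> labels G")
    case True
    then show ?thesis using connectsD(6)[OF c True] by auto
  next
    case False
    then show ?thesis using w assms(3) by auto
  qed
qed (use connectsD(1,2,3,5)[OF c] in auto)

lemma connects_root:
  assumes dG: "fdist (Tr t C Void)" and dF: "fdist (Tr s D Void)" and c: "connects (insert s A) C D e f" and ft: "f t = s"
  shows "connects A (Tr t C Void) (Tr s D Void) (e(s := t)) f"
proof (rule connectsI)
  note c = connectsD[OF c]
  let ?e = "e(s := t)"
  have sD: "s \<notin> labels D" and tC: "t \<notin> labels C" using dG dF by auto
  have eD: "?e z = e z" if "z \<in> labels D" for z using that sD by auto
  {
    fix z assume "z \<in> labels (Tr s D Void)"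
    then show "?e z \<in> labels (Tr t C Void)" "f (?e z) = z" using c(1,2)[of z] ft by auto
  next
    fix y z assume yz: "anc (Tr s D Void) y z"
    show "anc (Tr t C Void) (?e y) (?e z)"
    proof (cases "y = s")
      case True
      have "z \<in> labels (Tr s D Void)" using anc_labels[OF yz] by blast
      then show ?thesis using True c(1)[of z] by auto
    next
      case False
      then have "anc D y z" using yz by auto
      then show ?thesis using c(3)[of y z] eD anc_labels[of D y z] by auto
    qed
  next
    fix z z' x assume z: "z \<in> labels (Tr s D Void)" "z' \<in> labels (Tr s D Void)"
      and x: "anc (Tr t C Void) x (?e z)" "anc (Tr t C Void) x (?e z')"
    show "\<exists>y. anc (Tr s D Void) y z \<and> anc (Tr s D Void) y z' \<and> anc (Tr t C Void) x (?e y)"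
    proof (cases "x = t")
      case True
      then show ?thesis using z by (intro exI[of _ s]) auto
    next
      case False
      then have "z \<noteq> s" "z' \<noteq> s" using x anc_root[OF dG, of x] by auto
      then have zD: "z \<in> labels D" "z' \<in> labels D" using z by auto
      have "anc C x (e z)" "anc C x (e z')" using x False eD zD by auto
      then obtain y where y: "anc D y z" "anc D y z'" "anc C x (e y)" using c(4)[OF zD] by blast
      then show ?thesis using eD[of y] anc_labels[of D y z] by (intro exI[of _ y]) auto
    qed
  next
    fix z z' assume zz: "bef (Tr s D Void) z z'"
    have "z' \<in> labels D" using zz bef_labels[of D z z'] by auto
    show "bef (Tr t C Void) (?e z) (?e z')"
    proof (cases "z = s")
      case True
      then show ?thesis using c(1)[of z'] \<open>z' \<in> labels D\<close> eD by auto
    next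
      case False
      then have "bef D z z'" using zz by auto
      then show ?thesis using c(5)[of z z'] eD bef_labels[of D z z'] by auto
    qed
  next
    fix w assume w: "w \<in> labels (Tr t C Void)"
    then show "f w \<in> A \<or> f w \<in> labels (Tr s D Void) \<and> anc (Tr t C Void) (?e (f w)) w"
      using c(6)[of w] ft eD by auto
  }
qed

lemma connects_up:
  assumes dG: "fdist (Tr t C Void)" and c: "connects A C (Tr s D Void) e f" and ft: "f t \<in> A"
  shows "connects A (Tr t C Void) (Tr s D Void) e f"
proof (rule connectsI)
  note c = connectsD[OF c]
  let ?S = "Tr s D Void"
  {
    fix z z' x assume z: "z \<in> labels ?S" "z' \<in> labels ?S"
      and x: "anc (Tr t C Void) x (e z)" "anc (Tr t C Void) x (e z')"
    show "\<exists>y. anc ?S y z \<and> anc ?S y z' \<and> anc (Tr t C Void) x (e y)"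
    proof (cases "x = t")
      case True
      then show ?thesis using z c(1)[of s] by (intro exI[of _ s]) auto
    next
      case False
      then have "anc C x (e z)" "anc C x (e z')" using x by auto
      then obtain y where "anc ?S y z" "anc ?S y z'" "anc C x (e y)" using c(4)[OF z] by blast
      then show ?thesis by (intro exI[of _ y]) auto
    qed
  next
    fix z assume "z \<in> labels ?S"
    then show "e z \<in> labels (Tr t C Void)" "f (e z) = z" using c(1,2)[of z] by auto
  next
    fix y z assume "anc ?S y z"
    from c(3)[OF this] show "anc (Tr t C Void) (e y) (e z)" by auto
  next
    fix y z assume "bef ?S y z"
    from c(5)[OF this] show "bef (Tr t C Void) (e y) (e z)" by auto
  next
    fix w assume "w \<in> labels (Tr t C Void)"
    then show "f w \<in> A \<or> f w \<in> labels ?S \<and> anc (Tr t C Void) (e (f w)) w"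
      using c(6)[of w] ft by auto
  }
qed

text \<open>Nodes of the first tree and of the remaining forest have no common ancestor, so the
  condition on common ancestors has to be checked only within each piece; between them the order is
  automatic.\<close>

lemma connects_glue:
  assumes dG: "fdist (Tr t C G)" and dF: "fdist (Tr s D F)"
    and c1: "connects A (Tr t C Void) (Tr s D Void) e1 f" and c2: "connects A G F e2 f"
  shows "connects A (Tr t C G) (Tr s D F) (\<lambda>z. if z \<in> labels F then e2 z else e1 z) f"
proof (rule connectsI)
  note c1 = connectsD[OF c1] and c2 = connectsD[OF c2]
  let ?e = "\<lambda>z. if z \<in> labels F then e2 z else e1 z"
  let ?S = "Tr s D Void" and ?T = "Tr t C Void"
  have disj: "labels ?S \<inter> labels F = {}" "labels ?T \<inter> labels G = {}" using dG dF by auto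
  have eS: "?e z = e1 z" "e1 z \<in> labels ?T" "e1 z \<notin> labels G" if "z \<in> labels ?S" for z
    using that disj c1(1)[OF that] by auto
  have eF: "?e z = e2 z" "e2 z \<in> labels G" "e2 z \<notin> labels ?T" if "z \<in> labels F" for z
    using that disj c2(1)[OF that] by auto
  have ancT: "anc (Tr t C G) x y \<longleftrightarrow> anc ?T x y" if "y \<in> labels ?T" for x y
    using that disj anc_split[of t C G x y] anc_labels[of G x y] by blast
  have ancG: "anc (Tr t C G) x y \<longleftrightarrow> anc G x y" if "y \<in> labels G" for x y
    using that anc_right[OF dG] by blast
  {
    fix z assume "z \<in> labels (Tr s D F)"
    then consider "z \<in> labels ?S" | "z \<in> labels F" by auto
    then show "?e z \<in> labels (Tr t C G)" "f (?e z) = z"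
      by (cases; use c1(2)[of z] c2(2)[of z] eS[of z] eF[of z] in auto)+
  next
    fix y z assume "anc (Tr s D F) y z"
    then consider "anc ?S y z" | "anc F y z" using anc_split[of s D F y z] by blast
    then show "anc (Tr t C G) (?e y) (?e z)"
    proof cases
      case 1
      have "anc (Tr t C G) (e1 y) (e1 z)" using c1(3)[OF 1] anc_split[of t C G] by blast
      moreover have "?e y = e1 y" "?e z = e1 z" using eS(1) anc_labels[OF 1] by blast+
      ultimately show ?thesis by (simp only:)
    next
      case 2
      have "anc (Tr t C G) (e2 y) (e2 z)" using c2(3)[OF 2] anc_split[of t C G] by blast
      moreover have "?e y = e2 y" "?e z = e2 z" using eF(1) anc_labels[OF 2] by blast+
      ultimately show ?thesis by (simp only:)
    qed
  next
    fix z z' x assume z: "z \<in> labels (Tr s D F)" "z' \<in> labels (Tr s D F)"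
      and x: "anc (Tr t C G) x (?e z)" "anc (Tr t C G) x (?e z')"
    have inT: "x \<in> labels ?T" if "z \<in> labels ?S" "anc (Tr t C G) x (?e z)" for z
      using that eS[OF that(1)] ancT[of "e1 z" x] anc_labels[of ?T x "e1 z"] by auto
    have inG: "x \<in> labels G" if "z \<in> labels F" "anc (Tr t C G) x (?e z)" for z
      using that eF[OF that(1)] ancG[of "e2 z" x] anc_labels[of G x "e2 z"] by auto
    show "\<exists>y. anc (Tr s D F) y z \<and> anc (Tr s D F) y z' \<and> anc (Tr t C G) x (?e y)"
    proof (cases "z \<in> labels ?S")
      case True
      then have "z' \<notin> labels F" using inT[OF True x(1)] inG[of z'] x(2) disj by blast
      then have z': "z' \<in> labels ?S" using z by auto
      have "anc ?T x (e1 z)" "anc ?T x (e1 z')" using x eS[OF True] eS[OF z'] ancT by auto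
      then obtain y where y: "anc ?S y z" "anc ?S y z'" "anc ?T x (e1 y)" using c1(4)[OF True z'] by blast
      have "?e y = e1 y" using eS anc_labels[OF y(1)] by blast
      moreover have "anc (Tr t C G) x (e1 y)" using y(3) by (subst anc_split) (rule disjI1)
      ultimately have "anc (Tr t C G) x (?e y)" by (simp only:)
      moreover have "anc (Tr s D F) y z" "anc (Tr s D F) y z'"
        by (subst anc_split, rule disjI1, rule y)+
      ultimately show ?thesis by blast
    next
      case False
      then have zF: "z \<in> labels F" using z by auto
      then have "z' \<notin> labels ?S" using inG[OF zF x(1)] inT[of z'] x(2) disj by blast
      then have z': "z' \<in> labels F" using z by auto
      have "anc G x (e2 z)" "anc G x (e2 z')" using x eF[OF zF] eF[OF z'] ancG by auto
      then obtain y where y: "anc F y z" "anc F y z'" "anc G x (e2 y)" using c2(4)[OF zF z'] by blast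
      have "?e y = e2 y" using eF anc_labels[OF y(1)] by blast
      moreover have "anc (Tr t C G) x (e2 y)" using y(3) by (subst anc_split) (rule disjI2)
      ultimately have "anc (Tr t C G) x (?e y)" by (simp only:)
      moreover have "anc (Tr s D F) y z" "anc (Tr s D F) y z'"
        by (subst anc_split, rule disjI2, rule y)+
      ultimately show ?thesis by blast
    qed
  next
    fix z z' assume "bef (Tr s D F) z z'"
    then consider "bef ?S z z'" | "z \<in> labels ?S" "z' \<in> labels F" | "bef F z z'"
      using bef_split[of s D F z z'] by blast
    then show "bef (Tr t C G) (?e z) (?e z')"
    proof cases
      case 1
      have "bef (Tr t C G) (e1 z) (e1 z')" using c1(5)[OF 1] bef_split[of t C G] by blast
      moreover have "?e z = e1 z" "?e z' = e1 z'" using eS(1) bef_labels[OF 1] by blast+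
      ultimately show ?thesis by (simp only:)
    next
      case 2
      have "bef (Tr t C G) (e1 z) (e2 z')" using eS(2)[OF 2(1)] eF(2)[OF 2(2)] bef_split[of t C G] by blast
      then show ?thesis using eS(1)[OF 2(1)] eF(1)[OF 2(2)] by (simp only:)
    next
      case 3
      have "bef (Tr t C G) (e2 z) (e2 z')" using c2(5)[OF 3] bef_split[of t C G] by blast
      moreover have "?e z = e2 z" "?e z' = e2 z'" using eF(1) bef_labels[OF 3] by blast+
      ultimately show ?thesis by (simp only:)
    qed
  next
    fix w assume "w \<in> labels (Tr t C G)"
    then consider "w \<in> labels ?T" | "w \<in> labels G" by auto
    then show "f w \<in> A \<or> f w \<in> labels (Tr s D F) \<and> anc (Tr t C G) (?e (f w)) w"
    proof cases
      case 1
      from c1(6)[OF 1] show ?thesis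
      proof
        assume a: "f w \<in> labels ?S \<and> anc ?T (e1 (f w)) w"
        then have "?e (f w) = e1 (f w)" using eS(1) by blast
        moreover have "anc (Tr t C G) (e1 (f w)) w" using a ancT[OF 1] by blast
        ultimately have "anc (Tr t C G) (?e (f w)) w" by (simp only:)
        moreover have "f w \<in> labels (Tr s D F)" using a by auto
        ultimately show ?thesis by blast
      qed blast
    next
      case 2
      from c2(6)[OF 2] show ?thesis
      proof
        assume a: "f w \<in> labels F \<and> anc G (e2 (f w)) w"
        then have "?e (f w) = e2 (f w)" using eF(1) by blast
        moreover have "anc (Tr t C G) (e2 (f w)) w" using a ancG[OF 2] by blast
        ultimately have "anc (Tr t C G) (?e (f w)) w" by (simp only:)
        moreover have "f w \<in> labels (Tr s D F)" using a by auto
        ultimately show ?thesis by blast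
      qed blast
    qed
  }
qed

text \<open>Each disjunct of \<open>rigid\<close> says where \<open>s\<close> goes; the embedding is
  assembled along the recursion from these decisions.\<close>

lemma rigid_connects:
  "fdist G \<Longrightarrow> fdist F \<Longrightarrow> rigid A (fmap f G) F \<Longrightarrow> \<exists>e. connects A G F e f"
proof (induction G arbitrary: A F)
  case Void
  then show ?case by (auto simp: connects_def)
next
  case (Tr t C G)
  note dG = Tr.prems(1)
  have d: "fdist C" "fdist G" "fdist (Tr t C Void)" using dG by auto
  show ?case
  proof (cases F)
    case Void
    have "f w \<in> A" if "w \<in> labels (Tr t C G)" for w
      using Tr.prems(3) that Void unfolding Void rigid_Void forest.set_map by blast
    then show ?thesis using Void by (auto simp: connects_def)
  next
    case F: (Tr s D F')
    have dF: "fdist (Tr s D F')" "fdist D" "fdist F'" "fdist (Tr s D Void)" using Tr.prems(2) F by auto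
    consider (skip) "f t \<in> A" "labels (fmap f C) \<subseteq> A" "rigid A (fmap f G) F"
      | (root) "f t = s" "rigid (insert s A) (fmap f C) D" "rigid A (fmap f G) F'"
      | (up) "f t \<in> A" "rigid A (fmap f C) (Tr s D Void)" "rigid A (fmap f G) F'"
      using Tr.prems(3) F by auto
    then show ?thesis
    proof cases
      case skip
      obtain e where "connects A G F e f" using Tr.IH(2)[OF d(2) Tr.prems(2) skip(3)] by blast
      then show ?thesis using connects_skip[OF dG, of A F e f] skip by (auto simp: forest.set_map)
    next
      case root
      obtain e1 where "connects (insert s A) C D e1 f" using Tr.IH(1)[OF d(1) dF(2) root(2)] by blast
      from connects_root[OF d(3) dF(4) this root(1)]
      have "connects A (Tr t C Void) (Tr s D Void) (e1(s := t)) f" .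
      moreover obtain e2 where "connects A G F' e2 f" using Tr.IH(2)[OF d(2) dF(3) root(3)] by blast
      ultimately show ?thesis using connects_glue[OF dG dF(1)] F by blast
    next
      case up
      obtain e1 where "connects A C (Tr s D Void) e1 f" using Tr.IH(1)[OF d(1) dF(4) up(2)] by blast
      from connects_up[OF d(3) this up(1)]
      have "connects A (Tr t C Void) (Tr s D Void) e1 f" .
      moreover obtain e2 where "connects A G F' e2 f" using Tr.IH(2)[OF d(2) dF(3) up(3)] by blast
      ultimately show ?thesis using connects_glue[OF dG dF(1)] F by blast
    qed
  qed
qed

subsection \<open>Ordered trees\<close>

lemma ordered_treeD:
  assumes "ordered_tree T"
  shows "finite (nodes T)" "nodes T \<noteq> {}"
    "v \<in> nodes T \<Longrightarrow> tle T v v"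
    "v \<in> nodes T \<Longrightarrow> w \<in> nodes T \<Longrightarrow> tle T v w \<Longrightarrow> tle T w v \<Longrightarrow> v = w"
    "u \<in> nodes T \<Longrightarrow> v \<in> nodes T \<Longrightarrow> w \<in> nodes T \<Longrightarrow> tle T u v \<Longrightarrow> tle T v w \<Longrightarrow> tle T u w"
    "\<exists>r\<in>nodes T. \<forall>v\<in>nodes T. tle T r v"
    "u \<in> nodes T \<Longrightarrow> w \<in> nodes T \<Longrightarrow> v \<in> nodes T \<Longrightarrow> tle T u v \<Longrightarrow> tle T w v \<Longrightarrow> tle T u w \<or> tle T w u"
  using assms unfolding ordered_tree_def is_tree_def by (elim conjE; blast)+

lemma ordered_treeD_sle:
  assumes "ordered_tree T" "v \<in> nodes T"
  shows "x \<in> im T v \<Longrightarrow> sle T x x"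
    "x \<in> im T v \<Longrightarrow> y \<in> im T v \<Longrightarrow> sle T x y \<Longrightarrow> sle T y x \<Longrightarrow> x = y"
    "x \<in> im T v \<Longrightarrow> y \<in> im T v \<Longrightarrow> z \<in> im T v \<Longrightarrow> sle T x y \<Longrightarrow> sle T y z \<Longrightarrow> sle T x z"
    "x \<in> im T v \<Longrightarrow> y \<in> im T v \<Longrightarrow> sle T x y \<or> sle T y x"
  using assms unfolding ordered_tree_def by (elim conjE; blast)+

lemma imD:
  assumes "y \<in> im T v"
  shows "y \<in> nodes T" "tle T v y" "y \<noteq> v"
    "u \<in> nodes T \<Longrightarrow> tle T v u \<Longrightarrow> tle T u y \<Longrightarrow> u = v \<or> u = y"
  using assms unfolding im_def by blast+

lemma root_eq:
  assumes T: "ordered_tree T" and "r \<in> nodes T" "\<forall>v\<in>nodes T. tle T r v"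
  shows "root T = r"
  unfolding root_def
proof (rule the_equality)
  fix s assume "s \<in> nodes T \<and> (\<forall>v\<in>nodes T. tle T s v)"
  then show "s = r" using ordered_treeD(4)[OF T, of s r] assms by blast
qed (use assms in blast)

lemma meet_eq:
  assumes T: "ordered_tree T" and "u \<in> nodes T" "tle T u v" "tle T u w"
    "\<And>u'. u' \<in> nodes T \<Longrightarrow> tle T u' v \<Longrightarrow> tle T u' w \<Longrightarrow> tle T u' u"
  shows "meet T v w = u"
  unfolding meet_def
proof (rule the_equality)
  fix u' assume "u' \<in> nodes T \<and> tle T u' v \<and> tle T u' w \<and>
    (\<forall>u\<in>nodes T. tle T u v \<and> tle T u w \<longrightarrow> tle T u u')"
  then show "u' = u" using ordered_treeD(4)[OF T, of u' u] assms by blast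
qed (use assms in blast)

lemma chain_has_max:
  assumes T: "ordered_tree T" and "finite X" "X \<noteq> {}" "X \<subseteq> nodes T"
    "\<And>x y. x \<in> X \<Longrightarrow> y \<in> X \<Longrightarrow> tle T x y \<or> tle T y x"
  shows "\<exists>m\<in>X. \<forall>x\<in>X. tle T x m"
  using assms(2-5)
proof (induction X rule: finite_ne_induct)
  case (singleton x)
  then show ?case using ordered_treeD(3)[OF T] by auto
next
  case (insert x X)
  then obtain m where m: "m \<in> X" "\<forall>y\<in>X. tle T y m" by auto
  have "tle T x m \<or> tle T m x" using insert m by auto
  then show ?case
  proof
    assume "tle T x m"
    then show ?thesis using m by auto
  next
    assume mx: "tle T m x"
    have "tle T y x" if "y \<in> X" for y
      using ordered_treeD(5)[OF T, of y m x] m mx insert.prems(1) that by auto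
    then show ?thesis using ordered_treeD(3)[OF T, of x] insert.prems(1) by auto
  qed
qed

lemma chain_has_min:
  assumes T: "ordered_tree T" and "finite X" "X \<noteq> {}" "X \<subseteq> nodes T"
    "\<And>x y. x \<in> X \<Longrightarrow> y \<in> X \<Longrightarrow> tle T x y \<or> tle T y x"
  shows "\<exists>m\<in>X. \<forall>x\<in>X. tle T m x"
  using assms(2-5)
proof (induction X rule: finite_ne_induct)
  case (singleton x)
  then show ?case using ordered_treeD(3)[OF T] by auto
next
  case (insert x X)
  then obtain m where m: "m \<in> X" "\<forall>y\<in>X. tle T m y" by auto
  have "tle T x m \<or> tle T m x" using insert m by auto
  then show ?case
  proof
    assume "tle T m x"
    then show ?thesis using m by auto
  next
    assume mx: "tle T x m"
    have "tle T x y" if "y \<in> X" for y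
      using ordered_treeD(5)[OF T, of x m y] m mx insert.prems(1) that by auto
    then show ?thesis using ordered_treeD(3)[OF T, of x] insert.prems(1) by auto
  qed
qed

lemma meet_exists:
  assumes T: "ordered_tree T" and vw: "v \<in> nodes T" "w \<in> nodes T"
  shows "meet T v w \<in> nodes T" "tle T (meet T v w) v" "tle T (meet T v w) w"
    "\<And>u. u \<in> nodes T \<Longrightarrow> tle T u v \<Longrightarrow> tle T u w \<Longrightarrow> tle T u (meet T v w)"
proof -
  let ?X = "{u \<in> nodes T. tle T u v \<and> tle T u w}"
  have "\<exists>m\<in>?X. \<forall>x\<in>?X. tle T x m"
  proof (rule chain_has_max[OF T])
    show "finite ?X" using ordered_treeD(1)[OF T] by simp
    show "?X \<noteq> {}" using ordered_treeD(6)[OF T] vw by blast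
    fix x y assume "x \<in> ?X" "y \<in> ?X"
    then show "tle T x y \<or> tle T y x" using ordered_treeD(7)[OF T, of x y v] vw by blast
  qed auto
  then obtain m where m: "m \<in> nodes T" "tle T m v" "tle T m w"
    "\<And>u. u \<in> nodes T \<Longrightarrow> tle T u v \<Longrightarrow> tle T u w \<Longrightarrow> tle T u m" by blast
  have "meet T v w = m" by (rule meet_eq[OF T m])
  then show "meet T v w \<in> nodes T" "tle T (meet T v w) v" "tle T (meet T v w) w"
    "\<And>u. u \<in> nodes T \<Longrightarrow> tle T u v \<Longrightarrow> tle T u w \<Longrightarrow> tle T u (meet T v w)"
    using m by auto
qed

lemma im_below:
  assumes T: "ordered_tree T" and vw: "v \<in> nodes T" "w \<in> nodes T" "tle T v w" "v \<noteq> w"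
  obtains y where "y \<in> im T v" "tle T y w"
proof -
  let ?X = "{u \<in> nodes T. tle T v u \<and> u \<noteq> v \<and> tle T u w}"
  have "\<exists>m\<in>?X. \<forall>x\<in>?X. tle T m x"
  proof (rule chain_has_min[OF T])
    show "finite ?X" using ordered_treeD(1)[OF T] by simp
    show "?X \<noteq> {}" using ordered_treeD(3)[OF T] vw by blast
    fix x y assume "x \<in> ?X" "y \<in> ?X"
    then show "tle T x y \<or> tle T y x" using ordered_treeD(7)[OF T, of x y w] vw by blast
  qed auto
  then obtain y where y: "y \<in> nodes T" "tle T v y" "y \<noteq> v" "tle T y w"
    "\<And>u. u \<in> nodes T \<Longrightarrow> tle T v u \<Longrightarrow> u \<noteq> v \<Longrightarrow> tle T u w \<Longrightarrow> tle T y u" by blast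
  have "u = v \<or> u = y" if u: "u \<in> nodes T" "tle T v u" "tle T u y" for u
  proof (rule ccontr)
    assume n: "\<not> ?thesis"
    have "tle T u w" using ordered_treeD(5)[OF T, of u y w] u y vw by blast
    then have "tle T y u" using y(5) u n by blast
    then show False using ordered_treeD(4)[OF T, of u y] u y n by blast
  qed
  then have "y \<in> im T v" using y unfolding im_def by blast
  then show ?thesis using that y by blast
qed

lemma im_unique:
  assumes T: "ordered_tree T" and v: "v \<in> nodes T" and y: "y \<in> im T v" "y' \<in> im T v"
    and x: "x \<in> nodes T" "tle T y x" "tle T y' x"
  shows "y = y'"
proof -
  have "tle T y y' \<or> tle T y' y" using ordered_treeD(7)[OF T, of y y' x] imD(1)[OF y(1)] imD(1)[OF y(2)] x by blast
  then show ?thesis using imD[OF y(1)] imD[OF y(2)] by metis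
qed

lemma pred_in_im_eq:
  assumes T: "ordered_tree T" and v: "v \<in> nodes T" and y: "y \<in> im T v" and x: "x \<in> nodes T" "tle T y x"
  shows "pred_in_im T v x = y"
  unfolding pred_in_im_def
  by (rule the_equality) (use im_unique[OF T v _ y x(1) _ x(2)] y x in blast)+

text \<open>Only one successor of \<open>v\<close> lies below \<open>x'\<close>, so a common
  predecessor of \<open>x\<close> and \<open>x'\<close> cannot lie above \<open>y\<close>; being
  comparable with \<open>y\<close>, it is properly below \<open>y\<close> and thus at most
  \<open>v\<close>. Hence \<open>v\<close> is the meet, and the order of the two successors
  decides.\<close>

lemma separated:
  assumes T: "ordered_tree T" and v: "v \<in> nodes T" and y: "y \<in> im T v" "y' \<in> im T v" "y \<noteq> y'"
    and x: "x \<in> nodes T" "tle T y x" and x': "x' \<in> nodes T" "tle T y' x'"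
  shows "\<not> tle T x x'" "meet T x x' = v" "lexle T x x' \<longleftrightarrow> sle T y y'"
proof -
  note D = ordered_treeD[OF T]
  note i = imD[OF y(1)] and i' = imD[OF y(2)]
  have nn: "\<not> tle T u x'" if "u \<in> nodes T" "tle T y u" for u
  proof
    assume "tle T u x'"
    then have "tle T y x'" using D(5)[of y u x'] that i(1) x' by blast
    then show False using im_unique[OF T v y(1,2) x'(1) _ x'(2)] y(3) by blast
  qed
  show 1: "\<not> tle T x x'" using nn x by blast
  have 2: "\<not> tle T x' x"
  proof
    assume "tle T x' x"
    then have "tle T y' x" using D(5)[of y' x' x] x x' i'(1) by blast
    then show False using im_unique[OF T v y(1,2) x(1) x(2)] y(3) by blast
  qed
  show 3: "meet T x x' = v"
  proof (rule meet_eq[OF T v])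
    show "tle T v x" using D(5)[of v y x] v i(1,2) x by blast
    show "tle T v x'" using D(5)[of v y' x'] v i'(1,2) x' by blast
    then have vx: "tle T v x" using \<open>tle T v x\<close> by blast
    fix u assume u: "u \<in> nodes T" "tle T u x" "tle T u x'"
    have "tle T u y \<or> tle T y u" using D(7)[of u y x] u i(1) x by blast
    then have uy: "tle T u y" using nn u by blast
    have "u \<noteq> y" using nn u D(3)[of y] by blast
    have "tle T u v \<or> tle T v u" using D(7)[of u v x] u v vx x by blast
    then show "tle T u v"
    proof
      assume "tle T v u"
      then have "u = v" using i(4)[OF u(1) _ uy] \<open>u \<noteq> y\<close> by blast
      then show ?thesis using D(3) v by blast
    qed
  qed
  have "pred_in_im T v x = y" "pred_in_im T v x' = y'"
    using pred_in_im_eq[OF T v] y x x' by blast+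
  then show "lexle T x x' \<longleftrightarrow> sle T y y'" unfolding lexle_def 3 using 1 2 by simp
qed

text \<open>Rigid surjections see a tree through \<open>tle\<close> and \<open>lexle\<close> only,
  since meets and the root are determined by \<open>tle\<close>. These two orders are what the
  forest has to record.\<close>

definition represents :: "'a otree \<Rightarrow> 'a forest \<Rightarrow> bool" where
  "represents T \<Phi> \<longleftrightarrow> ordered_tree T \<and> fdist \<Phi> \<and> nodes T = labels \<Phi> \<and>
     (\<forall>x\<in>nodes T. \<forall>y\<in>nodes T. tle T x y \<longleftrightarrow> anc \<Phi> x y) \<and>
     (\<forall>x\<in>nodes T. \<forall>y\<in>nodes T. lexle T x y \<longleftrightarrow> x = y \<or> bef \<Phi> x y)"

lemma representsD:
  assumes "represents T \<Phi>"
  shows "ordered_tree T" "fdist \<Phi>" "nodes T = labels \<Phi>"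
    "x \<in> nodes T \<Longrightarrow> y \<in> nodes T \<Longrightarrow> tle T x y \<longleftrightarrow> anc \<Phi> x y"
    "x \<in> nodes T \<Longrightarrow> y \<in> nodes T \<Longrightarrow> lexle T x y \<longleftrightarrow> x = y \<or> bef \<Phi> x y"
  using assms unfolding represents_def by blast+

lemma sorted_enumeration:
  assumes "finite X"
    "\<And>x. x \<in> X \<Longrightarrow> r x x"
    "\<And>x y z. x \<in> X \<Longrightarrow> y \<in> X \<Longrightarrow> z \<in> X \<Longrightarrow> r x y \<Longrightarrow> r y z \<Longrightarrow> r x z"
    "\<And>x y. x \<in> X \<Longrightarrow> y \<in> X \<Longrightarrow> r x y \<or> r y x"
  shows "\<exists>xs. set xs = X \<and> distinct xs \<and> sorted_wrt r xs"
  using assms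
proof (induction X rule: finite_induct)
  case (insert z X)
  have "\<exists>xs. set xs = X \<and> distinct xs \<and> sorted_wrt r xs"
  proof (rule insert.IH)
    fix x y z assume "x \<in> X" "y \<in> X" "z \<in> X" "r x y" "r y z"
    then show "r x z" using insert.prems(2)[of x y z] by simp
  next
    fix x y assume "x \<in> X" "y \<in> X"
    then show "r x y \<or> r y x" using insert.prems(3)[of x y] by simp
  qed (use insert.prems(1) in simp)
  then obtain xs where xs: "set xs = X" "distinct xs" "sorted_wrt r xs" by blast
  let ?ys = "filter (\<lambda>x. \<not> r z x) xs @ z # filter (r z) xs"
  have low: "r x z" if "x \<in> X" "\<not> r z x" for x using insert.prems(3)[of x z] that by auto
  have "r x y" if "x \<in> X" "\<not> r z x" "y \<in> X" "r z y" for x y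
    using insert.prems(2)[of x z y] low that by auto
  then have "sorted_wrt r ?ys" using xs low by (auto simp: sorted_wrt_append sorted_wrt_filter)
  moreover have "set ?ys = insert z X" "distinct ?ys" using xs insert.hyps(2) by auto
  ultimately show ?case by blast
qed auto

text \<open>The cones of the immediate successors of \<open>v\<close> are concatenated in the order
  \<open>sle\<close>; by \<open>separated\<close> this is how \<open>lexle\<close> orders nodes of
  different cones.\<close>

lemma cone_forest:
  assumes T: "ordered_tree T"
  shows "v \<in> nodes T \<Longrightarrow> \<exists>C. fdist (Tr v C Void) \<and> labels (Tr v C Void) = {w \<in> nodes T. tle T v w} \<and>
    (\<forall>x\<in>labels (Tr v C Void). \<forall>y\<in>labels (Tr v C Void).
       (tle T x y \<longleftrightarrow> anc (Tr v C Void) x y) \<and> (lexle T x y \<longleftrightarrow> x = y \<or> bef (Tr v C Void) x y))"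
proof (induction "card {w \<in> nodes T. tle T v w}" arbitrary: v rule: less_induct)
  case (less v)
  note D = ordered_treeD[OF T]
  note v = less.prems
  let ?cone = "\<lambda>v. {w \<in> nodes T. tle T v w}"
  define ok where "ok = (\<lambda>F. \<forall>x\<in>labels F. \<forall>y\<in>labels F.
       (tle T x y \<longleftrightarrow> anc F x y) \<and> (lexle T x y \<longleftrightarrow> x = y \<or> bef F x y))"
  have IH: "\<exists>C. fdist (Tr y C Void) \<and> labels (Tr y C Void) = ?cone y \<and> ok (Tr y C Void)" if y: "y \<in> im T v" for y
    unfolding ok_def
  proof (rule less.hyps)
    note i = imD[OF y]
    show "y \<in> nodes T" by (rule i(1))
    have "?cone y \<subseteq> ?cone v" using D(5)[of v y] v i(1,2) by blast
    moreover have "v \<in> ?cone v" "v \<notin> ?cone y" using D(3) v D(4)[of v y] i(1-3) by auto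
    ultimately have "?cone y \<subset> ?cone v" by blast
    then show "card (?cone y) < card (?cone v)" using D(1) by (intro psubset_card_mono) auto
  qed
  have "\<exists>xs. set xs = im T v \<and> distinct xs \<and> sorted_wrt (sle T) xs"
  proof (rule sorted_enumeration)
    have "im T v \<subseteq> nodes T" by (auto simp: im_def)
    then show "finite (im T v)" by (rule finite_subset) (rule D(1))
  qed (rule ordered_treeD_sle[OF T v]; assumption)+
  then obtain xs where xs: "set xs = im T v" "distinct xs" "sorted_wrt (sle T) xs" by blast
  \<comment> \<open>Stated for every sorted list of successors, so that the forest can be built by
    putting one cone at a time in front.\<close>
  have "\<exists>F. fdist F \<and> labels F = (\<Union>y\<in>set ys. ?cone y) \<and> ok F"
    if "set ys \<subseteq> im T v" "distinct ys" "sorted_wrt (sle T) ys" for ys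
    using that
  proof (induction ys)
    case Nil
    then show ?case by (intro exI[of _ Void]) (simp add: ok_def)
  next
    case (Cons y ys)
    have "\<exists>F. fdist F \<and> labels F = (\<Union>y\<in>set ys. ?cone y) \<and> ok F"
      by (rule Cons.IH) (use Cons.prems in auto)
    then obtain F where F: "fdist F" "labels F = (\<Union>y\<in>set ys. ?cone y)" "ok F" by blast
    have yi: "y \<in> im T v" using Cons.prems by simp
    obtain C where C: "fdist (Tr y C Void)" "labels (Tr y C Void) = ?cone y" "ok (Tr y C Void)"
      using IH[OF yi] by blast
    have sep: "\<not> tle T a b \<and> \<not> tle T b a \<and> lexle T a b \<and> \<not> lexle T b a \<and> a \<noteq> b"
      if a: "a \<in> labels (Tr y C Void)" and b: "b \<in> labels F" for a b
    proof -
      obtain y' where y': "y' \<in> set ys" "b \<in> ?cone y'" using b F(2) by blast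
      have a': "a \<in> nodes T" "tle T y a" using a C(2) by auto
      have b': "b \<in> nodes T" "tle T y' b" using y' by auto
      have ne: "y \<noteq> y'" using Cons.prems(2) y' by auto
      have yi': "y' \<in> im T v" using Cons.prems(1) y' by auto
      have "sle T y y'" using Cons.prems(3) y'(1) by auto
      moreover from this have "\<not> sle T y' y" using ordered_treeD_sle(2)[OF T v yi yi'] ne by blast
      ultimately show ?thesis
        using separated[OF T v yi yi' ne a' b'] separated[OF T v yi' yi ne[symmetric] b' a'] D(3)[OF a'(1)] by auto
    qed
    have disj: "labels (Tr y C Void) \<inter> labels F = {}" using sep by blast
    have "fdist (Tr y C F)" using C(1) F(1) disj by auto
    moreover have "labels (Tr y C F) = (\<Union>y\<in>set (y # ys). ?cone y)" using C(2) F(2) by auto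
    moreover have "ok (Tr y C F)" unfolding ok_def
    proof (intro ballI)
      fix a b assume ab: "a \<in> labels (Tr y C F)" "b \<in> labels (Tr y C F)"
      have an: "anc (Tr y C F) a b \<longleftrightarrow> anc (Tr y C Void) a b \<or> anc F a b" by (rule anc_split)
      have be: "bef (Tr y C F) a b \<longleftrightarrow> bef (Tr y C Void) a b \<or>
        a \<in> labels (Tr y C Void) \<and> b \<in> labels F \<or> bef F a b" by (rule bef_split)
      note lab = anc_labels[of "Tr y C Void" a b] anc_labels[of F a b] bef_labels[of "Tr y C Void" a b] bef_labels[of F a b]
      consider "a \<in> labels (Tr y C Void)" "b \<in> labels (Tr y C Void)" "a \<notin> labels F" "b \<notin> labels F"
        | "a \<in> labels (Tr y C Void)" "b \<in> labels F" "a \<notin> labels F" "b \<notin> labels (Tr y C Void)"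
        | "a \<in> labels F" "b \<in> labels (Tr y C Void)" "a \<notin> labels (Tr y C Void)" "b \<notin> labels F"
        | "a \<in> labels F" "b \<in> labels F" "a \<notin> labels (Tr y C Void)" "b \<notin> labels (Tr y C Void)"
        using ab disj by auto
      then show "(tle T a b \<longleftrightarrow> anc (Tr y C F) a b) \<and> (lexle T a b \<longleftrightarrow> a = b \<or> bef (Tr y C F) a b)"
      proof cases
        case 1
        then show ?thesis using C(3)[unfolded ok_def, rule_format, OF 1(1,2)] an be lab by blast
      next
        case 2
        then show ?thesis using sep[OF 2(1,2)] an be lab by blast
      next
        case 3
        then show ?thesis using sep[OF 3(2,1)] an be lab by blast
      next
        case 4
        then show ?thesis using F(3)[unfolded ok_def, rule_format, OF 4(1,2)] an be lab by blast
      qed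
    qed
    ultimately show ?case by blast
  qed
  from this[of xs] xs have "\<exists>F. fdist F \<and> labels F = (\<Union>y\<in>im T v. ?cone y) \<and> ok F" by simp
  then obtain F where F: "fdist F" "labels F = (\<Union>y\<in>im T v. ?cone y)" "ok F" by blast
  have vF: "v \<notin> labels F"
  proof
    assume "v \<in> labels F"
    then obtain y where "y \<in> im T v" "tle T y v" using F(2) by blast
    then show False using imD[of y T v] D(4)[of v y] v by blast
  qed
  have cone: "insert v (labels F) = ?cone v"
  proof
    show "insert v (labels F) \<subseteq> ?cone v"
    proof
      fix w assume "w \<in> insert v (labels F)"
      then consider "w = v" | y where "y \<in> im T v" "w \<in> ?cone y" using F(2) by blast
      then show "w \<in> ?cone v"
      proof cases
        case 2
        then show ?thesis using D(5)[of v y w] v imD(1,2)[of y T v] by blast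
      qed (use D(3) v in simp)
    qed
    show "?cone v \<subseteq> insert v (labels F)"
    proof
      fix w assume w: "w \<in> ?cone v"
      show "w \<in> insert v (labels F)"
      proof (cases "w = v")
        case False
        then obtain y where "y \<in> im T v" "tle T y w" using im_below[OF T v, of w] w by auto
        then show ?thesis using F(2) w by auto
      qed simp
    qed
  qed
  let ?F = "Tr v F Void"
  have lab: "labels ?F = ?cone v" using cone by simp
  have up: "tle T v w" "w \<in> nodes T" if "w \<in> labels F" for w using cone that by auto
  have nv: "\<not> tle T w v" if "w \<in> labels F" for w
    using up[OF that] D(4)[of v w] v that vF by blast
  have "ok ?F" unfolding ok_def
  proof (intro ballI)
    fix a b assume ab: "a \<in> labels ?F" "b \<in> labels ?F"
    consider "a = v" "b = v" | "a = v" "b \<in> labels F" | "a \<in> labels F" "b = v" | "a \<in> labels F" "b \<in> labels F"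
      using ab by auto
    then show "(tle T a b \<longleftrightarrow> anc ?F a b) \<and> (lexle T a b \<longleftrightarrow> a = b \<or> bef ?F a b)"
    proof cases
      case 1
      then show ?thesis using D(3)[OF v] by (simp add: lexle_def)
    next
      case 2
      then show ?thesis using up by (simp add: lexle_def)
    next
      case 3
      then have "a \<noteq> v" using vF by auto
      then show ?thesis using 3 nv[of a] up[of a] vF anc_labels[of F a v] bef_labels[of F a v]
        by (auto simp: lexle_def)
    next
      case 4
      then have "a \<noteq> v" using vF by auto
      then show ?thesis using 4 F(3)[unfolded ok_def, rule_format, OF 4] by simp
    qed
  qed
  moreover have "fdist ?F" using F(1) vF by simp
  ultimately show ?case using lab unfolding ok_def by blast
qed

lemma represents_exists:
  assumes T: "ordered_tree T"
  obtains r C where "represents T (Tr r C Void)"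
proof -
  obtain r where r: "r \<in> nodes T" "\<forall>v\<in>nodes T. tle T r v" using ordered_treeD(6)[OF T] by blast
  obtain C where C: "fdist (Tr r C Void)" "labels (Tr r C Void) = {w \<in> nodes T. tle T r w}"
    "\<forall>x\<in>labels (Tr r C Void). \<forall>y\<in>labels (Tr r C Void).
       (tle T x y \<longleftrightarrow> anc (Tr r C Void) x y) \<and> (lexle T x y \<longleftrightarrow> x = y \<or> bef (Tr r C Void) x y)"
    using cone_forest[OF T r(1)] by blast
  have "nodes T = labels (Tr r C Void)" using C(2) r by auto
  then have "represents T (Tr r C Void)" using C(1,3) T unfolding represents_def by auto
  then show ?thesis by (rule that)
qed

definition otree_of :: "'a forest \<Rightarrow> 'a otree" where
  "otree_of \<Phi> = \<lparr>nodes = labels \<Phi>, tle = anc \<Phi>, sle = (\<lambda>x y. x = y \<or> bef \<Phi> x y)\<rparr>"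

text \<open>The point is that \<open>lexle\<close>, computed from the order of siblings, gives back
  the depth-first order: incomparable nodes are compared at the successors \<open>p\<close> and
  \<open>q\<close> of their meet, and \<open>bef_cones\<close>, applied to both orders of
  \<open>p\<close> and \<open>q\<close>, transfers the comparison.\<close>

lemma represents_otree_of:
  assumes "fdist (Tr r C Void)"
  shows "represents (otree_of (Tr r C Void)) (Tr r C Void)"
proof -
  define \<Phi> where "\<Phi> = Tr r C Void"
  define T where "T = otree_of \<Phi>"
  have d: "fdist \<Phi>" using assms by (simp add: \<Phi>_def)
  have sel: "nodes T = labels \<Phi>" "tle T = anc \<Phi>" "sle T = (\<lambda>x y. x = y \<or> bef \<Phi> x y)"
    by (auto simp: T_def otree_of_def)
  have r: "r \<in> labels \<Phi>" "\<forall>v\<in>labels \<Phi>. anc \<Phi> r v" by (auto simp: \<Phi>_def)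
  have irr: "\<not> bef \<Phi> x x" for x using bef_asym[OF d] by blast
  have tree: "is_tree (nodes T) (tle T)" unfolding is_tree_def sel
  proof (intro conjI ballI impI)
    show "labels \<Phi> \<noteq> {}" "\<exists>r\<in>labels \<Phi>. \<forall>v\<in>labels \<Phi>. anc \<Phi> r v" using r by blast+
    fix v u w assume "anc \<Phi> u v \<and> anc \<Phi> w v"
    then show "anc \<Phi> u w \<or> anc \<Phi> w u" using anc_chain[OF d, of u v w] by blast
  next
    fix u v w assume "anc \<Phi> u v \<and> anc \<Phi> v w"
    then show "anc \<Phi> u w" using anc_trans[OF d, of u v w] by blast
  next
    fix u v assume "anc \<Phi> u v \<and> anc \<Phi> v u"
    then show "u = v" using anc_antisym[OF d, of u v] by blast
  qed (simp_all add: anc_refl)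
  have im: "x \<in> labels \<Phi>" if "x \<in> im T v" for v x using imD(1)[OF that] by (simp add: sel)
  have T: "ordered_tree T" unfolding ordered_tree_def sel(3)
  proof (intro conjI ballI impI tree)
    fix v x y assume "x \<in> im T v" "y \<in> im T v" "(x = y \<or> bef \<Phi> x y) \<and> (y = x \<or> bef \<Phi> y x)"
    then show "x = y" using bef_asym[OF d, of x y] by blast
  next
    fix v x y z assume "(x = y \<or> bef \<Phi> x y) \<and> (y = z \<or> bef \<Phi> y z)"
    then show "x = z \<or> bef \<Phi> x z" using bef_trans[OF d, of x y z] by blast
  next
    fix v x y assume "x \<in> im T v" "y \<in> im T v"
    then show "(x = y \<or> bef \<Phi> x y) \<or> (y = x \<or> bef \<Phi> y x)" using bef_total[OF im im] by blast
  qed simp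
  have lex: "lexle T x y \<longleftrightarrow> x = y \<or> bef \<Phi> x y" if x: "x \<in> labels \<Phi>" and y: "y \<in> labels \<Phi>" for x y
  proof -
    consider "anc \<Phi> x y" | "anc \<Phi> y x" "\<not> anc \<Phi> x y" | "\<not> anc \<Phi> y x" "\<not> anc \<Phi> x y" by blast
    then show ?thesis
    proof cases
      case 1
      then show ?thesis using anc_imp_bef[OF d 1] by (simp add: lexle_def sel)
    next
      case 2
      then have "bef \<Phi> y x" using anc_imp_bef[OF d 2(1)] by metis
      then show ?thesis using 2 bef_asym[OF d, of y x] irr[of x] anc_refl[OF x] by (auto simp: lexle_def sel)
    next
      case 3
      define m where "m = meet T x y"
      have m: "m \<in> nodes T" "tle T m x" "tle T m y" "\<And>u. u \<in> nodes T \<Longrightarrow> tle T u x \<Longrightarrow> tle T u y \<Longrightarrow> tle T u m"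
        using meet_exists[OF T, of x y] x y by (auto simp: m_def sel)
      have xy: "x \<in> nodes T" "y \<in> nodes T" "m \<noteq> x" "m \<noteq> y" using x y 3 m(2,3) by (auto simp: sel)
      obtain p where p: "p \<in> im T m" "tle T p x" using im_below[OF T m(1) xy(1) m(2) xy(3)] .
      obtain q where q: "q \<in> im T m" "tle T q y" using im_below[OF T m(1) xy(2) m(3) xy(4)] .
      note ip = imD[OF p(1)] and iq = imD[OF q(1)]
      have pq: "p \<noteq> q"
      proof
        assume "p = q"
        then have "tle T p m" using m(4)[OF ip(1) p(2)] q(2) by blast
        then show False using ordered_treeD(4)[OF T ip(1) m(1)] ip(2,3) by blast
      qed
      have l: "lexle T x y \<longleftrightarrow> bef \<Phi> p q"
        using separated(3)[OF T m(1) p(1) q(1) pq xy(1) p(2) xy(2) q(2)] pq by (simp add: sel)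
      have n1: "\<not> anc \<Phi> p q"
        using separated(1)[OF T m(1) p(1) q(1) pq ip(1) _ iq(1)] ordered_treeD(3)[OF T] ip(1) iq(1) by (simp add: sel)
      have n2: "\<not> anc \<Phi> q p"
        using separated(1)[OF T m(1) q(1) p(1) _ iq(1) _ ip(1)] pq ordered_treeD(3)[OF T] ip(1) iq(1) by (simp add: sel)
      have px: "anc \<Phi> p x" "anc \<Phi> q y" using p(2) q(2) by (auto simp: sel)
      have "bef \<Phi> p q \<longleftrightarrow> bef \<Phi> x y"
      proof
        assume "bef \<Phi> p q"
        then show "bef \<Phi> x y" using bef_cones[OF d _ n1 px] by blast
      next
        assume "bef \<Phi> x y"
        then have "\<not> bef \<Phi> q p" using bef_cones[OF d _ n2 px(2,1)] bef_asym[OF d] by blast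
        then show "bef \<Phi> p q" using bef_total[of p \<Phi> q] pq ip(1) iq(1) by (simp add: sel)
      qed
      moreover have "x \<noteq> y" using 3 anc_refl[OF x] by blast
      ultimately show ?thesis using l by simp
    qed
  qed
  show ?thesis unfolding represents_def \<Phi>_def[symmetric] T_def[symmetric]
    using T d lex by (simp add: sel)
qed

text \<open>With the empty alphabet every label is a value in \<open>S\<close>. Given monotonicity,
  preservation of meets amounts to the condition on common ancestors: the meet in \<open>S\<close>
  provides the required \<open>y\<close>, and conversely any such \<open>y\<close> lies below the
  meet. Strictness in the order comes from \<open>e\<close> having the left inverse
  \<open>f\<close>.\<close>

theorem rigid_surj_iff:
  assumes RT: "represents T \<Phi>" and RS: "represents S \<Psi>"
  shows "rigid_surj T S f \<longleftrightarrow> rigid {} (fmap f \<Phi>) \<Psi>"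
proof
  note T = representsD[OF RT] and S = representsD[OF RS]
  assume "rigid_surj T S f"
  then obtain e where fN: "f \<in> nodes T \<rightarrow> nodes S" and m: "morphism S T e"
    and fe: "\<And>s. s \<in> nodes S \<Longrightarrow> f (e s) = s" and ef: "\<And>w. w \<in> nodes T \<Longrightarrow> tle T (e (f w)) w"
    unfolding rigid_surj_def by blast
  have eN: "e s \<in> nodes T" if "s \<in> nodes S" for s using m that unfolding morphism_def by blast
  have em: "e (meet S v w) = meet T (e v) (e w)" if "v \<in> nodes S" "w \<in> nodes S" for v w
    using m that unfolding morphism_def by blast
  have el: "lexle T (e v) (e w)" if "v \<in> nodes S" "w \<in> nodes S" "lexle S v w" for v w
    using m that unfolding morphism_def by blast
  have "connects {} \<Phi> \<Psi> e f"
  proof (rule connectsI)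
    fix s assume "s \<in> labels \<Psi>"
    then show "e s \<in> labels \<Phi>" "f (e s) = s" using eN fe S(3) T(3) by auto
  next
    fix y s assume ys: "anc \<Psi> y s"
    then have l: "y \<in> nodes S" "s \<in> nodes S" using anc_labels[OF ys] S(3) by auto
    have "meet S y s = y"
      by (rule meet_eq[OF S(1) l(1)]) (use ordered_treeD(3)[OF S(1) l(1)] S(4)[OF l] ys in auto)
    then have "e y = meet T (e y) (e s)" using em[OF l] by simp
    then have "tle T (e y) (e s)" using meet_exists(3)[OF T(1) eN[OF l(1)] eN[OF l(2)]] by simp
    then show "anc \<Phi> (e y) (e s)" using T(4) eN l by blast
  next
    fix s s' x assume s: "s \<in> labels \<Psi>" "s' \<in> labels \<Psi>" and x: "anc \<Phi> x (e s)" "anc \<Phi> x (e s')"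
    have s': "s \<in> nodes S" "s' \<in> nodes S" using s S(3) by auto
    have xN: "x \<in> nodes T" using anc_labels[OF x(1)] T(3) by simp
    have "tle T x (e s)" "tle T x (e s')" using x T(4) xN eN s' by blast+
    then have "tle T x (e (meet S s s'))"
      using meet_exists(4)[OF T(1) eN[OF s'(1)] eN[OF s'(2)] xN] em[OF s'] by simp
    moreover note ms = meet_exists(1-3)[OF S(1) s']
    ultimately show "\<exists>y. anc \<Psi> y s \<and> anc \<Psi> y s' \<and> anc \<Phi> x (e y)"
      using T(4)[OF xN eN[OF ms(1)]] S(4)[OF ms(1) s'(1)] S(4)[OF ms(1) s'(2)] by blast
  next
    fix s s' assume b: "bef \<Psi> s s'"
    then have l: "s \<in> nodes S" "s' \<in> nodes S" using bef_labels[OF b] S(3) by auto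
    have "lexle T (e s) (e s')" using el[OF l] S(5)[OF l] b by blast
    then have "e s = e s' \<or> bef \<Phi> (e s) (e s')" using T(5)[OF eN[OF l(1)] eN[OF l(2)]] by blast
    moreover have "e s \<noteq> e s'"
    proof
      assume "e s = e s'"
      then have "s = s'" using fe[OF l(1)] fe[OF l(2)] by metis
      then show False using b bef_asym[OF S(2), of s s] by blast
    qed
    ultimately show "bef \<Phi> (e s) (e s')" by blast
  next
    fix w assume "w \<in> labels \<Phi>"
    then have w: "w \<in> nodes T" using T(3) by simp
    then have "f w \<in> nodes S" using fN by blast
    then show "f w \<in> {} \<or> f w \<in> labels \<Psi> \<and> anc \<Phi> (e (f w)) w"
      using ef[OF w] T(4)[OF eN w] S(3) by auto
  qed
  then show "rigid {} (fmap f \<Phi>) \<Psi>" by (intro connects_rigid T(2) S(2)) auto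
next
  note T = representsD[OF RT] and S = representsD[OF RS]
  assume "rigid {} (fmap f \<Phi>) \<Psi>"
  then obtain e where "connects {} \<Phi> \<Psi> e f" using rigid_connects[OF T(2) S(2)] by blast
  note c = connectsD[OF this]
  have eN: "e s \<in> nodes T" "f (e s) = s" if "s \<in> nodes S" for s using c(1,2) that S(3) T(3) by auto
  have fN: "f w \<in> nodes S" "tle T (e (f w)) w" if w: "w \<in> nodes T" for w
  proof -
    have *: "f w \<in> labels \<Psi>" "anc \<Phi> (e (f w)) w" using c(6)[of w] w T(3) by auto
    then show "f w \<in> nodes S" using S(3) by simp
    then show "tle T (e (f w)) w" using *(2) T(4)[OF eN(1) w] by blast
  qed
  have mono: "tle T (e v) (e w)" if "v \<in> nodes S" "w \<in> nodes S" "tle S v w" for v w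
    using c(3)[of v w] that S(4) T(4) eN(1) by blast
  have "morphism S T e" unfolding morphism_def
  proof (intro conjI ballI impI)
    show "e \<in> nodes S \<rightarrow> nodes T" using eN by blast
  next
    fix v w assume v: "v \<in> nodes S" "w \<in> nodes S"
    note ms = meet_exists[OF S(1) v]
    have "meet T (e v) (e w) = e (meet S v w)"
    proof (rule meet_eq[OF T(1)])
      show "e (meet S v w) \<in> nodes T" using eN ms by blast
      show "tle T (e (meet S v w)) (e v)" "tle T (e (meet S v w)) (e w)" using mono ms v by blast+
      fix u assume u: "u \<in> nodes T" "tle T u (e v)" "tle T u (e w)"
      then have "anc \<Phi> u (e v)" "anc \<Phi> u (e w)" using T(4) eN v by blast+
      then obtain y where y: "anc \<Psi> y v" "anc \<Psi> y w" "anc \<Phi> u (e y)" using c(4)[of v w u] v S(3) by auto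
      have yN: "y \<in> nodes S" using anc_labels[OF y(1)] S(3) by simp
      have "tle S y v" "tle S y w" using y S(4) yN v by blast+
      then have "tle S y (meet S v w)" using ms(4) yN by blast
      then have "tle T (e y) (e (meet S v w))" using mono yN ms(1) by blast
      moreover have "tle T u (e y)" using y(3) T(4) u(1) eN(1)[OF yN] by blast
      ultimately show "tle T u (e (meet S v w))"
        using ordered_treeD(5)[OF T(1) u(1) eN(1)[OF yN] eN(1)[OF ms(1)]] by blast
    qed
    then show "e (meet S v w) = meet T (e v) (e w)" by simp
  next
    fix v w assume v: "v \<in> nodes S" "w \<in> nodes S" "lexle S v w"
    then have "v = w \<or> bef \<Psi> v w" using S(5) by blast
    then have "e v = e w \<or> bef \<Phi> (e v) (e w)" using c(5)[of v w] by blast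
    then show "lexle T (e v) (e w)" using T(5) eN v by blast
  next
    obtain r where r: "r \<in> nodes S" "\<forall>v\<in>nodes S. tle S r v" using ordered_treeD(6)[OF S(1)] by blast
    obtain q where q: "q \<in> nodes T" "\<forall>v\<in>nodes T. tle T q v" using ordered_treeD(6)[OF T(1)] by blast
    \<comment> \<open>The image of the root of \<open>S\<close> is below \<open>e (f q)\<close>,
      which is below the root \<open>q\<close>; so the roots correspond.\<close>
    have "tle T (e r) (e (f q))" using mono[OF r(1) fN(1)[OF q(1)]] r(2) fN(1)[OF q(1)] by blast
    then have "tle T (e r) q"
      using ordered_treeD(5)[OF T(1) eN(1)[OF r(1)] eN(1)[OF fN(1)[OF q(1)]] q(1)] fN(2)[OF q(1)] by blast
    then have "e r = q" using ordered_treeD(4)[OF T(1) eN(1)[OF r(1)] q(1)] q(2) eN(1)[OF r(1)] by blast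
    then show "e (root S) = root T" using root_eq[OF S(1) r] root_eq[OF T(1) q] by simp
  qed
  then show "rigid_surj T S f" unfolding rigid_surj_def using eN fN by blast
qed

section \<open>Transfer to ordered trees\<close>

lemma fdist_fmap: "fdist G \<Longrightarrow> inj_on h (labels G) \<Longrightarrow> fdist (fmap h G)"
proof (induction G)
  case (Tr x C G)
  have "inj_on h (labels C)" "inj_on h (labels G)" using Tr.prems(2) by (auto simp: inj_on_def)
  moreover have "h ` labels C \<inter> h ` labels G = {}"
    using Tr.prems by (auto simp: inj_on_def)
  moreover have "h x \<notin> h ` labels C" "h x \<notin> h ` labels G"
    using Tr.prems by (auto simp: inj_on_def)
  ultimately show ?case using Tr by (simp add: forest.set_map)
qed auto

theorem theorem2p4:
  fixes b :: nat and S :: "'a otree" and T :: "'b otree"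
  assumes "b > 0" and "ordered_tree S" and "ordered_tree T"
  shows "\<exists>U :: nat otree. ordered_tree U \<and>
    (\<forall>c :: (nat \<Rightarrow> 'a) \<Rightarrow> nat. (\<forall>f\<in>RS U S. c f < b) \<longrightarrow>
       (\<exists>g0\<in>RS U T. \<exists>i. \<forall>f\<in>RS T S. c (restrict (f \<circ> g0) (nodes U)) = i))"
proof -
  obtain s0 D where S: "represents S (Tr s0 D Void)" using represents_exists[OF assms(2)] .
  obtain t0 C where T: "represents T (Tr t0 C Void)" using represents_exists[OF assms(3)] .
  let ?S = "Tr s0 D Void" and ?T = "Tr t0 C Void"
  have dS: "fdist ?S" "nodes S = labels ?S" and dT: "fdist ?T" "nodes T = labels ?T"
    using representsD(2,3)[OF S] representsD(2,3)[OF T] by auto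
  obtain \<alpha> :: "'a \<Rightarrow> nat" where \<alpha>: "inj_on \<alpha> (labels ?S)"
    using finite_imp_inj_to_nat_seg[OF finite_labels[of ?S]] by blast
  \<comment> \<open>The code of the root of \<open>S\<close>. Above the root of \<open>U\<close>
    this value is always admissible, so it becomes the single constant.\<close>
  define a0 where "a0 = \<alpha> s0"
  obtain \<beta>' :: "'b \<Rightarrow> nat" where \<beta>': "inj_on \<beta>' (labels C)"
    using finite_imp_inj_to_nat_seg[OF finite_labels[of C]] by blast
  \<comment> \<open>The shift keeps the codes of the nodes of \<open>C\<close> away from the
    constant \<open>a0\<close>.\<close>
  define \<beta> where "\<beta> = (\<lambda>x. \<beta>' x + Suc a0)"
  have \<beta>: "inj_on \<beta> (labels C)" "\<And>x. \<beta> x \<noteq> a0" using \<beta>' by (auto simp: \<beta>_def inj_on_def)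
  define D' where "D' = fmap \<alpha> D"
  define C' where "C' = fmap \<beta> C"
  have "inj_on \<alpha> (labels D)" using \<alpha> by (auto simp: inj_on_def)
  then have D': "fdist D'" using fdist_fmap dS(1) by (auto simp: D'_def)
  have "a0 \<notin> labels D'" using \<alpha> dS(1) by (auto simp: D'_def a0_def forest.set_map inj_on_def)
  then have "ramsey {a0} (both_rigid {a0} D')" using D' by (intro ramsey_rigid) auto
  moreover have C': "fdist C'" "labels C' \<inter> {a0} = {}"
    using fdist_fmap[OF _ \<beta>(1)] dT(1) \<beta>(2) by (auto simp: C'_def forest.set_map)
  ultimately obtain H where H: "good {a0} b H C' (both_rigid {a0} D')" unfolding ramsey_def by blast
  \<comment> \<open>The label \<open>0\<close> is reserved for the root of \<open>U\<close>.\<close>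
  obtain \<Psi> where \<Psi>: "shape \<Psi> = H" "fdist \<Psi>" "labels \<Psi> \<inter> {0 :: nat} = {}"
    using labelled_exists[of "{0}" H] by blast
  let ?U = "Tr 0 \<Psi> Void"
  have dU: "fdist ?U" using \<Psi> by simp
  define U where "U = otree_of ?U"
  have RU: "represents U ?U" unfolding U_def by (rule represents_otree_of[OF dU])
  note U = representsD[OF RU]
  \<comment> \<open>The constant encodes both roots: \<open>a0\<close> is read as \<open>t0\<close>
    here, and a rigid surjection \<open>f\<close> has \<open>f t0 = s0\<close>, whose code is
    \<open>a0\<close> again. Hence the recoded \<open>f\<close> fixes the constant.\<close>
  define \<gamma> where "\<gamma> = (\<lambda>x. if x = a0 then t0 else inv_into (labels C) \<beta> x)"
  have \<gamma>\<beta>: "\<gamma> (\<beta> x) = x" if "x \<in> labels C" for x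
    using that \<beta> by (simp add: \<gamma>_def)
  have \<gamma>C: "fmap \<gamma> C' = C"
    unfolding C'_def fmap_fmap by (rule forest.map_ident_strong) (rule \<gamma>\<beta>)
  show ?thesis
  proof (intro exI[of _ U] conjI allI impI U(1))
    fix c :: "(nat \<Rightarrow> 'a) \<Rightarrow> nat" assume c: "\<forall>f\<in>RS U S. c f < b"
    define fun_of where "fun_of = (\<lambda>\<phi>. restrict (\<lambda>u. if u = 0 then s0
      else inv_into (labels ?S) \<alpha> (relab {} \<Psi> \<phi> u)) (nodes U))"
    \<comment> \<open>The bound on \<open>c\<close> is known for rigid surjections only, while
      \<open>good\<close> asks for colourings bounded everywhere; other values become
      \<open>0\<close>, a colour because \<open>b > 0\<close>.\<close>
    define c' where "c' = (\<lambda>\<phi>. if c (fun_of \<phi>) < b then c (fun_of \<phi>) else 0)"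
    have c': "c' \<phi> < b" for \<phi> using assms(1) by (simp add: c'_def)
    obtain g where g: "shape g = H" "rigid {a0} g C'" "homog {a0} C' (both_rigid {a0} D') c' g"
      by (rule goodD[OF H c'])
    define hg where "hg = relab {} \<Psi> g"
    have hg: "fmap hg \<Psi> = g" using relab(1)[of \<Psi> "{}" g] \<Psi> g(1) by (simp add: hg_def)
    define g0 where "g0 = restrict (\<lambda>u. if u = 0 then t0 else \<gamma> (hg u)) (nodes U)"
    have g0\<Psi>: "g0 u = \<gamma> (hg u)" if "u \<in> labels \<Psi>" for u using that \<Psi>(3) U(3) by (auto simp: g0_def)
    have g00: "g0 0 = t0" using U(3) by (simp add: g0_def)
    have "fmap g0 \<Psi> = fmap (\<lambda>u. \<gamma> (hg u)) \<Psi>" by (rule forest.map_cong0) (rule g0\<Psi>)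
    then have g0g: "fmap g0 ?U = Tr t0 (fmap \<gamma> g) Void" using hg fmap_fmap[of \<gamma> hg \<Psi>] g00 by simp
    have "rigid {t0} (fmap \<gamma> g) C"
      using rigid_fmap[OF g(2), of \<gamma>] \<gamma>C by (simp add: \<gamma>_def)
    then have rg0: "rigid {} (fmap g0 ?U) ?T" using g0g by simp
    have g0: "g0 \<in> RS U T"
      using rigid_surj_iff[OF RU T, of g0] rg0 by (simp add: RS_def g0_def)
    have g0N: "g0 u \<in> nodes T" if "u \<in> nodes U" for u
      using rigid_labels[OF rg0] that U(3) dT(2) unfolding forest.set_map by auto
    have key: "c (restrict (f \<circ> g0) (nodes U)) = c' (fmap (\<lambda>x. \<alpha> (f (\<gamma> x))) g) \<and>
        fixing {a0} (\<lambda>x. \<alpha> (f (\<gamma> x))) \<and> rigid {a0} (fmap (\<lambda>x. \<alpha> (f (\<gamma> x))) C') D'"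
      if f: "f \<in> RS T S" for f
    proof -
      let ?f = "\<lambda>x. \<alpha> (f (\<gamma> x))"
      have rf: "rigid {} (fmap f ?T) ?S" using f rigid_surj_iff[OF T S, of f] by (simp add: RS_def)
      have fN: "f v \<in> nodes S" if "v \<in> nodes T" for v
        using f that unfolding RS_def rigid_surj_def by blast
      have ft: "f t0 = s0" "rigid {s0} (fmap f C) D" using rf by auto
      have fxd: "fixing {a0} ?f" using ft by (simp add: \<gamma>_def a0_def)
      have "fmap ?f C' = fmap \<alpha> (fmap f (fmap \<gamma> C'))" by simp
      then have "fmap ?f C' = fmap \<alpha> (fmap f C)" using \<gamma>C by simp
      then have rig: "rigid {a0} (fmap ?f C') D'"
        using rigid_fmap[OF ft(2), of \<alpha>] by (simp add: D'_def a0_def)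
      let ?k = "restrict (f \<circ> g0) (nodes U)"
      have "fun_of (fmap ?f g) u = ?k u" for u
      proof (cases "u \<in> nodes U")
        case uU: True
        show ?thesis
        proof (cases "u = 0")
          case True
          then show ?thesis using uU g00 ft by (simp add: fun_of_def)
        next
          case False
          then have u\<Psi>: "u \<in> labels \<Psi>" using uU U(3) by simp
          have "fmap (relab {} \<Psi> (fmap ?f g)) \<Psi> = fmap (\<lambda>u. ?f (hg u)) \<Psi>"
            using relab(1)[of \<Psi> "{}" "fmap ?f g"] \<Psi> g(1) hg fmap_fmap[of ?f hg \<Psi>] by simp
          then have "relab {} \<Psi> (fmap ?f g) u = \<alpha> (f (g0 u))"
            using fmap_eqD[OF _ u\<Psi>] g0\<Psi>[OF u\<Psi>] by fastforce
          moreover have "f (g0 u) \<in> labels ?S" using fN g0N uU dS(2) by simp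
          ultimately show ?thesis using False uU \<alpha> by (simp add: fun_of_def inv_into_f_f del: forest.set)
        qed
      qed (simp add: fun_of_def)
      then have fo: "fun_of (fmap ?f g) = ?k" by blast
      have "fmap ?k ?U = fmap f (fmap g0 ?U)"
        unfolding fmap_fmap by (rule forest.map_cong0) (simp add: U(3))
      then have "rigid {} (fmap ?k ?U) ?S" using rigid_comp[OF rg0 rf] by simp
      then have "?k \<in> RS U S" using rigid_surj_iff[OF RU S, of ?k] by (simp add: RS_def)
      then have "c ?k < b" using c by blast
      then have "c' (fmap ?f g) = c ?k" by (simp add: c'_def fo)
      then show ?thesis using fxd rig by simp
    qed
    show "\<exists>g0\<in>RS U T. \<exists>i. \<forall>f\<in>RS T S. c (restrict (f \<circ> g0) (nodes U)) = i"
    proof (cases "RS T S = {}")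
      case True
      then show ?thesis using g0 by blast
    next
      case False
      then obtain f0 where f0: "f0 \<in> RS T S" by blast
      have "c (restrict (f \<circ> g0) (nodes U)) = c (restrict (f0 \<circ> g0) (nodes U))" if f: "f \<in> RS T S" for f
        using key[OF f] key[OF f0] homogD[OF g(3), of "\<lambda>x. \<alpha> (f (\<gamma> x))" "\<lambda>x. \<alpha> (f0 (\<gamma> x))"]
        unfolding both_rigid_def by metis
      then show ?thesis using g0 by blast
    qed
  qed
qed

end
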